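(* Let $\mu = 1/32$, let $k\ge 1$ be a fixed integer, and let $F$ be a fixed graph with $k$ vertices and $e$ edges, where $e \ge 10k/\mu^2$. Consider the triangle-free graph process on $n$ vertices, and let $T$ be the event that there exists a copy of $F$ in the triangle-free graph process (i.e. in the graph at some step of the process, equivalently in the final graph). Let $H$, $S_k$ and $S_{2k}$ be the events defined in the context. Then, as $n\to\infty$, $$P\bigl(T \,\big|\, \overline{S_k}\cap\overline{S_{2k}}\cap H\bigr)=o(1).$$
   Context: All graphs are finite and simple; $\log$ is the natural logarithm; asymptotics are as $n\to\infty$; $\overline{A}$ denotes the complement of an event $A$. Triangle-free graph process: on a vertex set $V$ with $|V|=n$, start with the empty graph $G_0$. At step $i\ge1$, $G_i$ is obtained from $G_{i-1}$ by adding an edge chosen uniformly at random among all pairs of vertices that are not edges of $G_{i-1}$ and whose addition to $G_{i-1}$ creates no triangle. The process terminates when no such pair exists (after termination the graph is regarded as unchanged). Let $E_i$ be the edge set of $G_i$. A pair $\{u,v\}$ is closed at step $i$ if inserting the edge $\{u,v\}$ in $G_i$ would result in a triangle. A pair is open at step $i$ if it is neither in $E_i$ nor closed. Let $O_i$ be the set of open pairs at step $i$ and $Q(i)=|O_i|$. For $\{u,v\}\notin E_i$ let $$Y_{u,v}(i)=\bigl\{w\in V:\ |\{\{u,w\},\{v,w\}\}\cap O_i|=|\{\{u,w\},\{v,w\}\}\cap E_i|=1\bigr\}.$$ Let $\mu=1/32$, $m=\mu n^{3/2}\sqrt{\log n}$ (rounded down to an integer when used as a step index), and $t(i)=i/n^{3/2}$.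 Define $$q(t)=\tfrac12 e^{-4t^2},\qquad y(t)=4te^{-4t^2},\qquad g_y(t)=e^{41t^2+40t}n^{-1/6},$$ $$g_q(t)=\begin{cases} e^{41t^2+40t}\,n^{-1/6} & t\le 1,\\ \dfrac{e^{41t^2+40t}}{t}\,n^{-1/6} & t>1.\end{cases}$$ Event $H$: for all $i\le m$ and all pairs $\{u,v\}\notin E_i$, $$|Q(i)-n^2q(t(i))|\le n^2g_q(t(i))\quad\text{and}\quad \bigl||Y_{u,v}(i)|-\sqrt n\,y(t(i))\bigr|\le \sqrt n\,g_y(t(i)).$$ (It is a known theorem of Bohman that $P(H)\to1$ as $n\to\infty$.) For $W\subset V$, $e_i(W)$ is the number of edges of $G_i$ with both endpoints in $W$. For a fixed integer $j\ge 1$, $S_j$ is the event that there exists $W\subset V$ with $|W|=j$ and $e_m(W)\ge 3j$. There is a copy of $F$ in a graph $G$ if there is an injective function $f:V(F)\to V(G)$ with $\{f(u),f(v)\}\in E(G)$ for all $\{u,v\}\in E(F)$ (the copy need not be induced). *)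

theory Defs
  imports "HOL-Probability.Probability" "HOL-Library.Landau_Symbols"
begin

section \<open>Graphs, open and closed pairs\<close>

text \<open>A graph on a vertex set \<open>V\<close> is given by its edge set, a set of two-element subsets of \<open>V\<close>.\<close>

definition pairs :: "'a set \<Rightarrow> 'a set set" where
  "pairs V = {e. e \<subseteq> V \<and> card e = 2}"

definition has_triangle :: "'a set set \<Rightarrow> bool" where
  "has_triangle E \<longleftrightarrow>
     (\<exists>a b c. a \<noteq> b \<and> b \<noteq> c \<and> a \<noteq> c \<and> {a, b} \<in> E \<and> {b, c} \<in> E \<and> {a, c} \<in> E)"

definition closed_pair :: "'a set set \<Rightarrow> 'a set \<Rightarrow> bool" where
  "closed_pair E e \<longleftrightarrow> has_triangle (insert e E)"

definition open_pairs :: "'a set \<Rightarrow> 'a set set \<Rightarrow> 'a set set" where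
  "open_pairs V E = {e \<in> pairs V. e \<notin> E \<and> \<not> closed_pair E e}"

definition Y_set :: "'a set \<Rightarrow> 'a set set \<Rightarrow> 'a \<Rightarrow> 'a \<Rightarrow> 'a set" where
  "Y_set V E u v =
     {w \<in> V. card ({{u, w}, {v, w}} \<inter> open_pairs V E) = 1 \<and> card ({{u, w}, {v, w}} \<inter> E) = 1}"

definition edges_within :: "'a set set \<Rightarrow> 'a set \<Rightarrow> 'a set set" where
  "edges_within E W = {e \<in> E. e \<subseteq> W}"

definition has_copy :: "'b set \<Rightarrow> 'b set set \<Rightarrow> 'a set \<Rightarrow> 'a set set \<Rightarrow> bool" where
  "has_copy VF EF V E \<longleftrightarrow>
     (\<exists>f. inj_on f VF \<and> f ` VF \<subseteq> V \<and> (\<forall>u v. {u, v} \<in> EF \<longrightarrow> {f u, f v} \<in> E))"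


section \<open>The triangle-free graph process on \<open>{..<n}\<close>\<close>

definition tf_step :: "nat \<Rightarrow> nat set set \<Rightarrow> nat set set pmf" where
  "tf_step n E =
     (if open_pairs {..<n} E = {} then return_pmf E
      else map_pmf (\<lambda>e. insert e E) (pmf_of_set (open_pairs {..<n} E)))"

text \<open>
  A trajectory is a function \<open>G\<close> with \<open>G i\<close> the edge set after \<open>i\<close> steps.
  \<open>tf_run n s\<close> is the law of the trajectory that performs the first \<open>s\<close> steps
  and is constant from then on.
\<close>

primrec tf_run :: "nat \<Rightarrow> nat \<Rightarrow> (nat \<Rightarrow> nat set set) pmf" where
  "tf_run n 0 = return_pmf (\<lambda>_. {})"
| "tf_run n (Suc s) =
     bind_pmf (tf_run n s) (\<lambda>G.
       map_pmf (\<lambda>E i. if i \<le> s then G i else E) (tf_step n (G s)))"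

text \<open>
  Every step before termination adds one of the \<open>n choose 2\<close> pairs, so the process has
  terminated after \<open>n choose 2\<close> steps; see \<open>tf_process_terminated\<close> and \<open>tf_run_eq_process\<close> below.
\<close>

definition tf_process :: "nat \<Rightarrow> (nat \<Rightarrow> nat set set) pmf" where
  "tf_process n = tf_run n (n choose 2)"

lemma finite_pairs: "finite V \<Longrightarrow> finite (pairs V)"
  by (simp add: pairs_def)

lemma card_pairs: "finite V \<Longrightarrow> card (pairs V) = card V choose 2"
  using n_subsets[of V 2] by (simp add: pairs_def)

lemma finite_open_pairs: "finite V \<Longrightarrow> finite (open_pairs V E)"
  by (rule finite_subset[OF _ finite_pairs]) (auto simp: open_pairs_def)

lemma tf_run_invariant:
  assumes "G \<in> set_pmf (tf_run n s)"
  shows "G s \<subseteq> pairs {..<n} \<and> (\<forall>i\<ge>s. G i = G s) \<and>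
         (open_pairs {..<n} (G s) = {} \<or> card (G s) = s)"
  using assms
proof (induction s arbitrary: G)
  case 0
  then show ?case by simp
next
  case (Suc s)
  let ?O = "\<lambda>E. open_pairs {..<n} E"
  obtain G' E where G': "G' \<in> set_pmf (tf_run n s)" and E: "E \<in> set_pmf (tf_step n (G' s))"
    and G: "G = (\<lambda>i. if i \<le> s then G' i else E)"
    using Suc.prems by auto
  have sub: "G' s \<subseteq> pairs {..<n}" and card: "?O (G' s) = {} \<or> card (G' s) = s"
    using Suc.IH[OF G'] by blast+
  have GS: "G (Suc s) = E" and const: "\<forall>i\<ge>Suc s. G i = G (Suc s)"
    by (auto simp: G)
  have fin: "finite (G' s)"
    using finite_subset[OF sub finite_pairs] by simp
  show ?case
  proof (cases "?O (G' s) = {}")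
    case True
    then have "E = G' s" using E by (simp add: tf_step_def)
    then have "G (Suc s) = G' s" by (simp add: GS)
    then show ?thesis using sub True const by metis
  next
    case False
    then obtain e where e: "e \<in> ?O (G' s)" "E = insert e (G' s)"
      using E by (auto simp: tf_step_def finite_open_pairs)
    then have "e \<in> pairs {..<n}" "e \<notin> G' s" by (auto simp: open_pairs_def)
    then have "E \<subseteq> pairs {..<n}" and "card E = Suc s"
      using sub card False fin e(2) by auto
    then show ?thesis using const GS by metis
  qed
qed

lemma tf_run_terminated:
  assumes G: "G \<in> set_pmf (tf_run n s)" and s: "n choose 2 \<le> s"
  shows "open_pairs {..<n} (G s) = {}"
proof (rule ccontr)
  assume ne: "open_pairs {..<n} (G s) \<noteq> {}"
  with tf_run_invariant[OF G] have sub: "G s \<subseteq> pairs {..<n}" and card: "card (G s) = s"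
    by blast+
  have "G s = pairs {..<n}"
    using card_seteq[OF finite_pairs sub] card s card_pairs[of "{..<n}"] by simp
  with ne show False by (auto simp: open_pairs_def)
qed

lemma tf_process_terminated:
  "G \<in> set_pmf (tf_process n) \<Longrightarrow> open_pairs {..<n} (G (n choose 2)) = {}"
  unfolding tf_process_def by (rule tf_run_terminated) auto

lemma tf_run_eq_process:
  assumes "n choose 2 \<le> s"
  shows "tf_run n s = tf_process n"
  using assms
proof (induction s rule: dec_induct)
  case base
  show ?case by (simp add: tf_process_def)
next
  case (step s)
  have "map_pmf (\<lambda>E i. if i \<le> s then G i else E) (tf_step n (G s)) = return_pmf G"
    if "G \<in> set_pmf (tf_run n s)" for G
  proof -
    have "tf_step n (G s) = return_pmf (G s)"
      using tf_run_terminated[OF that step.hyps(1)] by (simp add: tf_step_def)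
    moreover have "(\<lambda>i. if i \<le> s then G i else G s) = G"
    proof
      fix i show "(if i \<le> s then G i else G s) = G i"
        using tf_run_invariant[OF that] by (metis nat_le_linear)
    qed
    ultimately show ?thesis by simp
  qed
  then have "tf_run n (Suc s) = bind_pmf (tf_run n s) return_pmf"
    by (auto intro: bind_pmf_cong)
  then show ?case using step.IH by (simp add: bind_return_pmf')
qed


section \<open>The events\<close>

definition mu :: real where
  "mu = 1 / 32"

definition m_step :: "nat \<Rightarrow> nat" where
  "m_step n = nat \<lfloor>mu * real n powr (3/2) * sqrt (ln (real n))\<rfloor>"

definition time :: "nat \<Rightarrow> nat \<Rightarrow> real" where
  "time n i = real i / real n powr (3/2)"

definition q_fun :: "real \<Rightarrow> real" where
  "q_fun t = 1/2 * exp (- 4 * t\<^sup>2)"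

definition y_fun :: "real \<Rightarrow> real" where
  "y_fun t = 4 * t * exp (- 4 * t\<^sup>2)"

definition g_y :: "nat \<Rightarrow> real \<Rightarrow> real" where
  "g_y n t = exp (41 * t\<^sup>2 + 40 * t) * real n powr (-1/6)"

definition g_q :: "nat \<Rightarrow> real \<Rightarrow> real" where
  "g_q n t = (if t \<le> 1 then exp (41 * t\<^sup>2 + 40 * t) * real n powr (-1/6)
              else exp (41 * t\<^sup>2 + 40 * t) / t * real n powr (-1/6))"

definition event_H :: "nat \<Rightarrow> (nat \<Rightarrow> nat set set) \<Rightarrow> bool" where
  "event_H n G \<longleftrightarrow>
     (\<forall>i\<le>m_step n.
        \<bar>real (card (open_pairs {..<n} (G i))) - (real n)\<^sup>2 * q_fun (time n i)\<bar>
          \<le> (real n)\<^sup>2 * g_q n (time n i) \<and>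
        (\<forall>u<n. \<forall>v<n. u \<noteq> v \<and> {u, v} \<notin> G i \<longrightarrow>
           \<bar>real (card (Y_set {..<n} (G i) u v)) - sqrt (real n) * y_fun (time n i)\<bar>
             \<le> sqrt (real n) * g_y n (time n i)))"

definition event_S :: "nat \<Rightarrow> nat \<Rightarrow> (nat \<Rightarrow> nat set set) \<Rightarrow> bool" where
  "event_S j n G \<longleftrightarrow>
     (\<exists>W\<subseteq>{..<n}. card W = j \<and> card (edges_within (G (m_step n)) W) \<ge> 3 * j)"

definition event_T :: "'b set \<Rightarrow> 'b set set \<Rightarrow> nat \<Rightarrow> (nat \<Rightarrow> nat set set) \<Rightarrow> bool" where
  "event_T VF EF n G \<longleftrightarrow> (\<exists>i. has_copy VF EF {..<n} (G i))"

end

(* The denominator of the conditional probability has to be bounded from below, so P(H) -> 1 is proved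
   first. Besides Q and the two halves of Y_{u,v} (which of the two pairs at w is open) one tracks the number of
   w with both pairs open and the codegrees. For each tracked variable Z with trajectory z and tolerance g the
   process exp(rate * (+-(Z - z) - g)) is a supermartingale as long as everything is within tolerance, because g grows faster
   than the drift error; the sum of all these exponentials starts near 0 and tracking fails only when it reaches 1.

   Given H, each step hits a fixed set of 3j pairs with probability O(n^(-2+o(1))) and m = n^(3/2+o(1)), so a
   union bound gives P(S_j and H) -> 0 and the conditioning event has probability at least 1/2 eventually.

   If F appears but S_k fails, then all but 3k of its e edges are open pairs at step m inside a fixed k-set.
   As S_2k fails, fewer than k outside vertices have 6 or more neighbours in that k-set, so up to O(k) errors every
   open pair closes at most 5 of the pattern pairs; hence the pattern survives step i with probability
   at most 1 - (b/5)(4t-1)n^(-3/2), where b > e - 3k is its size. The product over i <= m is at most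
   n^(-2k), which beats the n^k choices of the k-set. *)

theory Submission
  imports Defs "HOL-Real_Asymp.Real_Asymp"
begin

section \<open>Inserting an open pair into a triangle-free graph\<close>

text \<open>The conditioning event looks at the trajectory up to step m, so the conditioned process
  is no longer the same Markov chain. All estimates therefore concern joint probabilities, under
  conditions on the current graph that the conditioning event implies at each step:
  \<open>H_at\<close>, and \<open>locally_sparse\<close> because edges only accumulate. The quotient
  is formed once, at the end.

  The extra variables close the system. The gain of \<open>half_open\<close> is governed by
  \<open>both_open\<close>; a codegree cap bounds a single loss of \<open>half_open\<close> and the
  overlap between the two ways in which a vertex can leave \<open>both_open\<close>. Dividing by Q,
  about n^2 exp(-4t^2)/2, inflates errors by exp(4t^2), so \<open>both_open\<close> is given the
  narrower tolerance exp(-4t^2) \<open>g_y\<close>.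

  The constant 10 in e >= 10k/mu^2: at t near mu sqrt(log n) the survival exponent (b/5) 2t^2, with
  b near 10k/mu^2, is 4k log n. Half of it is spent on lower-order terms, such as the linear term of
  2t^2 - 2t and the 3k edges already present, and 2k log n remains.\<close>

locale triangle_free_graph =
  fixes V :: "'a set" and E :: "'a set set"
  assumes finite_V: "finite V" and E_pairs: "E \<subseteq> pairs V" and no_triangle: "\<not> has_triangle E"
begin

abbreviation "Op \<equiv> open_pairs V E"

end

text \<open>An oriented half of \<open>Y_set\<close>: a vertex leaves it only through the open pair
  at u, and enters it only when its open pair at v becomes an edge.\<close>

definition half_open :: "'a set \<Rightarrow> 'a set set \<Rightarrow> 'a \<Rightarrow> 'a \<Rightarrow> 'a set" where
  "half_open V E u v = {w \<in> V. {u, w} \<in> open_pairs V E \<and> {v, w} \<in> E}"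

definition both_open :: "'a set \<Rightarrow> 'a set set \<Rightarrow> 'a \<Rightarrow> 'a \<Rightarrow> 'a set" where
  "both_open V E u v = {w \<in> V. {u, w} \<in> open_pairs V E \<and> {v, w} \<in> open_pairs V E}"

definition both_edge :: "'a set \<Rightarrow> 'a set set \<Rightarrow> 'a \<Rightarrow> 'a \<Rightarrow> 'a set" where
  "both_edge V E u v = {w \<in> V. {u, w} \<in> E \<and> {v, w} \<in> E}"

text \<open>The open pairs whose insertion closes {u, v}: each is one side of a path of length two
  from u to v whose other side is already an edge.\<close>

definition closers :: "'a set \<Rightarrow> 'a set set \<Rightarrow> 'a \<Rightarrow> 'a \<Rightarrow> 'a set set" where
  "closers V E u v = (\<lambda>z. {u, z}) ` half_open V E u v \<union> (\<lambda>z. {v, z}) ` half_open V E v u"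

text \<open>Double counting of incidences; it turns sums over the inserted pair into sums over the
  tracked vertices.\<close>

lemma sum_card_swap:
  assumes "finite S" "\<And>w. w \<in> S \<Longrightarrow> L w \<subseteq> P" "finite P"
  shows "(\<Sum>e\<in>P. card {w \<in> S. e \<in> L w}) = (\<Sum>w\<in>S. card (L w))"
proof -
  have "(\<Sum>e\<in>P. card {w \<in> S. e \<in> L w}) = (\<Sum>e\<in>P. \<Sum>w\<in>S. if e \<in> L w then 1 else 0)"
    using assms(1) by (simp add: sum.If_cases Int_def)
  also have "\<dots> = (\<Sum>w\<in>S. \<Sum>e\<in>P. if e \<in> L w then 1 else 0)" by (rule sum.swap)
  also have "\<dots> = (\<Sum>w\<in>S. card (L w))"
    using assms by (intro sum.cong) (auto simp: sum.If_cases Int_absorb1)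
  finally show ?thesis .
qed

lemma pairs_iff: "{u, v} \<in> pairs V \<longleftrightarrow> u \<in> V \<and> v \<in> V \<and> u \<noteq> v"
  by (auto simp: pairs_def card_insert_if)

lemma pairsE:
  assumes "e \<in> pairs V"
  obtains u v where "e = {u, v}" "u \<in> V" "v \<in> V" "u \<noteq> v"
  using assms by (auto simp: pairs_def card_2_iff)

context triangle_free_graph
begin

section \<open>Openness and closing in terms of common neighbours\<close>

lemma finite_E: "finite E"
  using finite_subset[OF E_pairs] finite_V by (simp add: finite_pairs)

lemma finite_Op [simp]: "finite Op"
  by (simp add: finite_V finite_open_pairs)

lemma finite_half [simp]: "finite (half_open V E u v)"
  by (simp add: half_open_def finite_V)

lemma finite_both [simp]: "finite (both_open V E u v)"
  by (simp add: both_open_def finite_V)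

lemma finite_both_edge [simp]: "finite (both_edge V E u v)"
  by (simp add: both_edge_def finite_V)

lemma finite_closers [simp]: "finite (closers V E u v)"
  by (simp add: closers_def)

lemma edgeD: "{u, v} \<in> E \<Longrightarrow> u \<in> V \<and> v \<in> V \<and> u \<noteq> v"
  using subsetD[OF E_pairs, of "{u, v}"] by (simp add: pairs_iff)

lemma edge_triangle:
  assumes "{u, v} \<in> E" "{u, w} \<in> E" "{v, w} \<in> E"
  shows False
proof -
  have "u \<noteq> v" "v \<noteq> w" "u \<noteq> w" using assms by (auto dest: edgeD)
  then show False using assms no_triangle unfolding has_triangle_def by blast
qed

text \<open>\<open>E\<close> has no triangle, so a triangle of \<open>insert {u, w} E\<close> must
  use {u, w}, and its third vertex is a common neighbour.\<close>

lemma open_iff: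
  "{u, w} \<in> Op \<longleftrightarrow> u \<in> V \<and> w \<in> V \<and> u \<noteq> w \<and> {u, w} \<notin> E \<and> (\<forall>z. {u, z} \<in> E \<longrightarrow> {w, z} \<notin> E)"
proof (cases "u \<in> V \<and> w \<in> V \<and> u \<noteq> w \<and> {u, w} \<notin> E")
  case True
  \<comment> \<open>Treats a triangle whose side {a, b} is the new pair; the other two positions are
    permutations of this one.\<close>
  have key: "\<exists>z. {u, z} \<in> E \<and> {w, z} \<in> E"
    if ab: "{a, b} = {u, w}" and c: "a \<noteq> c" "b \<noteq> c"
      and bc: "{b, c} \<in> insert {u, w} E" and ac: "{a, c} \<in> insert {u, w} E" for a b c
  proof -
    have "{b, c} \<noteq> {u, w}" "{a, c} \<noteq> {u, w}" using ab c by (auto simp: doubleton_eq_iff)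
    then have "{b, c} \<in> E" "{a, c} \<in> E" using bc ac by auto
    then show ?thesis using ab by (auto simp: doubleton_eq_iff)
  qed
  have "has_triangle (insert {u, w} E) \<longleftrightarrow> (\<exists>z. {u, z} \<in> E \<and> {w, z} \<in> E)"
  proof
    assume "has_triangle (insert {u, w} E)"
    then obtain a b c where abc: "a \<noteq> b" "b \<noteq> c" "a \<noteq> c" "{a, b} \<in> insert {u, w} E"
      "{b, c} \<in> insert {u, w} E" "{a, c} \<in> insert {u, w} E"
      unfolding has_triangle_def by (elim exE conjE)
    then have "{a, b} = {u, w} \<or> {b, c} = {u, w} \<or> {a, c} = {u, w}"
      using no_triangle unfolding has_triangle_def insert_iff by (elim disjE) auto
    then show "\<exists>z. {u, z} \<in> E \<and> {w, z} \<in> E"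
      using abc key[of a b c] key[of b c a] key[of a c b]
      by (elim disjE) (simp_all add: insert_commute)
  next
    assume "\<exists>z. {u, z} \<in> E \<and> {w, z} \<in> E"
    then obtain z where z: "{u, z} \<in> E" "{w, z} \<in> E" by blast
    then have "u \<noteq> z" "w \<noteq> z" using edgeD by blast+
    then show "has_triangle (insert {u, w} E)"
      unfolding has_triangle_def using z True
      by (intro exI[of _ u] exI[of _ w] exI[of _ z]) auto
  qed
  then show ?thesis using True by (auto simp: open_pairs_def closed_pair_def pairs_iff)
next
  case False
  then show ?thesis by (auto simp: open_pairs_def pairs_iff)
qed

lemma openE:
  assumes "e \<in> Op"
  obtains u v where "e = {u, v}" "u \<in> V" "v \<in> V" "u \<noteq> v"
  using assms pairsE unfolding open_pairs_def by blast

lemma open_other: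
  assumes "e \<in> Op" "u \<in> e"
  obtains a where "e = {u, a}" "a \<noteq> u"
  using assms by (metis insertE insert_commute openE singletonD)

lemma triangle_free_insert:
  assumes "e \<in> Op"
  shows "triangle_free_graph V (insert e E)"
  using assms finite_V E_pairs no_triangle
  by (auto simp: triangle_free_graph_def open_pairs_def closed_pair_def)

lemma half_iff: "z \<in> half_open V E u w \<longleftrightarrow> {u, z} \<in> Op \<and> {w, z} \<in> E"
  by (auto simp: half_open_def open_iff)

lemma both_iff: "z \<in> both_open V E u w \<longleftrightarrow> {u, z} \<in> Op \<and> {w, z} \<in> Op"
  by (auto simp: both_open_def open_iff)

lemma both_edge_iff: "z \<in> both_edge V E u w \<longleftrightarrow> {u, z} \<in> E \<and> {w, z} \<in> E"
  using edgeD by (auto simp: both_edge_def)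

lemma closers_iff:
  "e \<in> closers V E u w \<longleftrightarrow>
     e \<in> Op \<and> (\<exists>z. e = {u, z} \<and> {w, z} \<in> E \<or> e = {w, z} \<and> {u, z} \<in> E)"
  by (auto simp: closers_def half_iff)

lemma closers_pair_iff:
  assumes "{a, b} \<in> Op"
  shows "{a, b} \<in> closers V E u w \<longleftrightarrow>
     a = u \<and> {w, b} \<in> E \<or> b = u \<and> {w, a} \<in> E \<or> a = w \<and> {u, b} \<in> E \<or> b = w \<and> {u, a} \<in> E"
  using assms by (auto simp: closers_iff doubleton_eq_iff)

lemma Op_edge: "{u, v} \<in> Op \<Longrightarrow> {u, v} \<notin> E"
  by (simp add: open_iff)

text \<open>A pair in both images would be {u, v} itself and would require a loop in
  \<open>E\<close>.\<close>

lemma card_closers: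
  assumes "u \<noteq> v"
  shows "card (closers V E u v) = card (half_open V E u v) + card (half_open V E v u)"
proof -
  have "(\<lambda>z. {u, z}) ` half_open V E u v \<inter> (\<lambda>z. {v, z}) ` half_open V E v u = {}"
    using assms edgeD by (fastforce simp: half_iff doubleton_eq_iff)
  then show ?thesis
    unfolding closers_def
    by (subst card_Un_disjoint) (auto simp: card_image inj_on_def doubleton_eq_iff)
qed

lemma card_Y_set:
  assumes "u \<noteq> v" "{u, v} \<notin> E"
  shows "card (Y_set V E u v) = card (half_open V E u v) + card (half_open V E v u)"
proof -
  \<comment> \<open>The last disjunct is the degenerate case in which the two pairs
    coincide.\<close>
  have card1: "card ({a, b} \<inter> A) = 1 \<longleftrightarrow> (a \<in> A \<longleftrightarrow> b \<notin> A) \<or> (a = b \<and> a \<in> A)" for a b :: "'a set" and A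
    by (cases "a \<in> A"; cases "b \<in> A") (auto simp: card_insert_if)
  have "Y_set V E u v = half_open V E u v \<union> half_open V E v u"
    unfolding Y_set_def
  proof (intro set_eqI, unfold mem_Collect_eq Un_iff half_iff card1, intro iffI)
    fix w
    show "w \<in> V \<and> (({u, w} \<in> Op) = ({v, w} \<notin> Op) \<or> {u, w} = {v, w} \<and> {u, w} \<in> Op) \<and>
         (({u, w} \<in> E) = ({v, w} \<notin> E) \<or> {u, w} = {v, w} \<and> {u, w} \<in> E) \<Longrightarrow>
         {u, w} \<in> Op \<and> {v, w} \<in> E \<or> {v, w} \<in> Op \<and> {u, w} \<in> E"
      using assms Op_edge by (auto simp: doubleton_eq_iff)
    show "{u, w} \<in> Op \<and> {v, w} \<in> E \<or> {v, w} \<in> Op \<and> {u, w} \<in> E \<Longrightarrow>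
         w \<in> V \<and> (({u, w} \<in> Op) = ({v, w} \<notin> Op) \<or> {u, w} = {v, w} \<and> {u, w} \<in> Op) \<and>
         (({u, w} \<in> E) = ({v, w} \<notin> E) \<or> {u, w} = {v, w} \<and> {u, w} \<in> E)"
      using assms Op_edge edgeD by blast
  qed
  moreover have "half_open V E u v \<inter> half_open V E v u = {}"
    using Op_edge by (auto simp: half_iff)
  ultimately show ?thesis by (simp add: card_Un_disjoint)
qed

text \<open>A common neighbour of u and w created by e uses e as exactly one of its two sides, so e
  was a closer.\<close>

lemma open_insert_iff:
  assumes e: "e \<in> Op"
  shows "{u, w} \<in> open_pairs V (insert e E) \<longleftrightarrow>
           {u, w} \<in> Op \<and> e \<noteq> {u, w} \<and> e \<notin> closers V E u w"
proof -
  interpret I: triangle_free_graph V "insert e E" by (rule triangle_free_insert[OF e])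
  obtain a b where ab: "e = {a, b}" "a \<noteq> b" using e by (rule openE)
  have ab': "{a, b} \<in> Op" using e ab by simp
  have "(\<exists>z. {u, z} \<in> insert e E \<and> {w, z} \<in> insert e E) \<longleftrightarrow>
      (\<exists>z. {u, z} \<in> E \<and> {w, z} \<in> E) \<or> e \<in> closers V E u w" if "u \<noteq> w"
    unfolding ab(1) closers_pair_iff[OF ab'] using that ab(2) by (auto simp: doubleton_eq_iff insert_commute)
  then show ?thesis
    unfolding I.open_iff open_iff by (simp only: insert_iff) blast
qed

text \<open>Two open pairs close each other when they form a triangle with an edge, which is a
  symmetric condition. Hence, besides {u, v} itself, inserting {u, v} destroys exactly the closers
  of {u, v}.\<close>

lemma closers_sym:
  assumes "{a, b} \<in> Op" "{u, w} \<in> Op"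
  shows "{a, b} \<in> closers V E u w \<longleftrightarrow> {u, w} \<in> closers V E a b"
  using assms unfolding closers_iff by (auto simp: doubleton_eq_iff insert_commute)

lemma self_notin_closers: "{u, w} \<notin> closers V E u w"
  using edgeD by (fastforce simp: closers_iff doubleton_eq_iff)

lemma card_open_insert:
  assumes e: "{u, v} \<in> Op"
  shows "card Op = card (open_pairs V (insert {u, v} E)) + 1 + card (closers V E u v)"
proof -
  have 1: "open_pairs V (insert {u, v} E) = Op - insert {u, v} (closers V E u v)"
  proof (intro set_eqI)
    fix p
    show "p \<in> open_pairs V (insert {u, v} E) \<longleftrightarrow> p \<in> Op - insert {u, v} (closers V E u v)"
    proof (cases "p \<in> pairs V")
      case True
      then obtain a b where "p = {a, b}" by (rule pairsE)
      then show ?thesis using open_insert_iff[OF e, of a b] closers_sym[OF e, of a b] by auto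
    qed (auto simp: open_pairs_def)
  qed
  have sub: "insert {u, v} (closers V E u v) \<subseteq> Op" using e by (auto simp: closers_iff)
  then have "card Op = card (Op - insert {u, v} (closers V E u v)) + card (insert {u, v} (closers V E u v))"
    by (metis card_Diff_subset card_mono finite_Op finite_subset le_add_diff_inverse2)
  then show ?thesis using self_notin_closers by (simp add: 1)
qed

text \<open>A gained w has e = {v, w}; this e cannot close {u, w}, since that would need {u, v} to
  be an edge. For e = {u, v} the vertices become adjacent and leave the bookkeeping.\<close>

lemma half_open_insert:
  assumes e: "e \<in> Op" and uv: "u \<noteq> v" "{u, v} \<notin> E" "e \<noteq> {u, v}"
  shows "half_open V (insert e E) u v =
     (half_open V E u v - {w \<in> half_open V E u v. e = {u, w} \<or> e \<in> closers V E u w})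
       \<union> {w \<in> both_open V E u v. e = {v, w}}"
proof -
  interpret I: triangle_free_graph V "insert e E" by (rule triangle_free_insert[OF e])
  have "e \<notin> closers V E u w \<and> e \<noteq> {u, w}" if "e = {v, w}" for w
    using that uv by (auto simp: closers_iff doubleton_eq_iff insert_commute)
  moreover have "{v, w} \<in> Op" if "e = {v, w}" for w using e that by simp
  ultimately show ?thesis
    unfolding set_eq_iff Un_iff Diff_iff mem_Collect_eq I.half_iff half_iff both_iff open_insert_iff[OF e] by blast
qed

lemma card_half_open_insert:
  assumes e: "e \<in> Op" and uv: "u \<noteq> v" "{u, v} \<notin> E" "e \<noteq> {u, v}"
  shows "real (card (half_open V (insert e E) u v)) = real (card (half_open V E u v))
     + (real (card {w \<in> both_open V E u v. e = {v, w}})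
        - real (card {w \<in> half_open V E u v. e = {u, w} \<or> e \<in> closers V E u w}))"
proof -
  let ?A = "half_open V E u v" and ?L = "{w \<in> half_open V E u v. e = {u, w} \<or> e \<in> closers V E u w}"
  let ?G = "{w \<in> both_open V E u v. e = {v, w}}"
  have d: "(?A - ?L) \<inter> ?G = {}" using Op_edge by (auto simp: half_iff both_iff)
  have "card ((?A - ?L) \<union> ?G) = card (?A - ?L) + card ?G"
    by (rule card_Un_disjoint) (use d in auto)
  moreover have "card (?A - ?L) = card ?A - card ?L" "card ?L \<le> card ?A"
    by (auto intro!: card_Diff_subset card_mono finite_subset[OF _ finite_half])
  ultimately show ?thesis by (simp add: half_open_insert[OF assms])
qed

lemma both_open_insert:
  assumes e: "e \<in> Op"
  shows "both_open V (insert e E) u v = both_open V E u v -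
     {w \<in> both_open V E u v. e \<in> {{u, w}, {v, w}} \<union> closers V E u w \<union> closers V E v w}"
proof -
  interpret I: triangle_free_graph V "insert e E" by (rule triangle_free_insert[OF e])
  show ?thesis
    unfolding set_eq_iff Diff_iff mem_Collect_eq I.both_iff open_insert_iff[OF e]
    by (simp add: both_iff) blast
qed

lemma card_both_open_insert:
  assumes e: "e \<in> Op"
  shows "real (card (both_open V (insert e E) u v)) = real (card (both_open V E u v))
     - real (card {w \<in> both_open V E u v. e \<in> {{u, w}, {v, w}} \<union> closers V E u w \<union> closers V E v w})"
  unfolding both_open_insert[OF e]
  by (subst card_Diff_subset) (auto intro!: of_nat_diff card_mono finite_subset[OF _ finite_both])

text \<open>A new common neighbour w satisfies e = {u, w} or e = {v, w}, and as e differs from {u,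
  v} this determines w.\<close>

lemma card_both_edge_insert:
  assumes e: "e \<in> Op" and uv: "u \<noteq> v" "e \<noteq> {u, v}"
  shows "card (both_edge V (insert e E) u v) \<le> card (both_edge V E u v) + (if e \<in> closers V E u v then 1 else 0)"
proof -
  interpret I: triangle_free_graph V "insert e E" by (rule triangle_free_insert[OF e])
  let ?D = "{w. e = {u, w} \<and> {v, w} \<in> E \<or> e = {v, w} \<and> {u, w} \<in> E}"
  have sub: "both_edge V (insert e E) u v \<subseteq> both_edge V E u v \<union> ?D"
    using uv by (auto simp: I.both_edge_iff both_edge_iff doubleton_eq_iff)
  have "\<exists>w0. ?D \<subseteq> {w0}"
  proof (cases "?D = {}")
    case False
    then obtain w0 where w0: "e = {u, w0} \<or> e = {v, w0}" by blast
    have "?D \<subseteq> {w0}"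
    proof
      fix w assume "w \<in> ?D"
      then have "e = {u, w} \<or> e = {v, w}" by blast
      with w0 show "w \<in> {w0}" using uv by (elim disjE) (auto simp: doubleton_eq_iff)
    qed
    then show ?thesis by blast
  qed blast
  then obtain w0 where w0: "?D \<subseteq> {w0}" by blast
  have D1: "card ?D \<le> 1" "finite ?D"
    using card_mono[OF _ w0] finite_subset[OF w0] by simp_all
  have D0: "?D = {}" if "e \<notin> closers V E u v" using that e by (auto simp: closers_iff)
  have "card (both_edge V (insert e E) u v) \<le> card (both_edge V E u v \<union> ?D)"
    by (rule card_mono[OF _ sub]) (use D1 in auto)
  also have "\<dots> \<le> card (both_edge V E u v) + card ?D" by (rule card_Un_le)
  also have "card ?D \<le> (if e \<in> closers V E u v then 1 else 0)"
    using D1 D0 by (auto simp del: Collect_empty_eq)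
  finally show ?thesis by simp
qed

section \<open>Total and largest changes caused by one insertion\<close>

lemma sum_gain:
  "(\<Sum>e\<in>Op. card {w \<in> both_open V E u v. e = {v, w}}) = card (both_open V E u v)"
  using sum_card_swap[of "both_open V E u v" "\<lambda>w. {{v, w}}" Op] by (auto simp: both_iff)

lemma gain_le_1: "card {w \<in> both_open V E u v. e = {v, w}} \<le> 1"
proof -
  have "w = w'" if "e = {v, w}" "e = {v, w'}" for w w'
    using that by (auto simp: doubleton_eq_iff)
  then show ?thesis by (auto simp: card_le_Suc0_iff_eq)
qed

text \<open>A vertex w is lost through {u, w} itself, which gives the 1, or through a closer of {u,
  w}, and these are different pairs.\<close>

lemma sum_half_loss:
  "(\<Sum>e\<in>Op. card {w \<in> half_open V E u v. e = {u, w} \<or> e \<in> closers V E u w})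
     = (\<Sum>w\<in>half_open V E u v. 1 + card (closers V E u w))"
proof -
  have "(\<Sum>e\<in>Op. card {w \<in> half_open V E u v. e \<in> insert {u, w} (closers V E u w)})
    = (\<Sum>w\<in>half_open V E u v. card (insert {u, w} (closers V E u w)))"
    by (rule sum_card_swap) (auto simp: half_iff closers_iff)
  then show ?thesis using self_notin_closers by simp
qed

text \<open>If e = {u, a}, a lost w other than a is adjacent to a and, being half-open, to v, so it
  is a common neighbour of a and v. If u is not in e, a lost w is an endpoint of e. The codegrees
  thus control the jumps of \<open>half_open\<close>.\<close>

lemma half_loss_le:
  assumes e: "e \<in> Op" "e \<noteq> {u, v}" and Z: "\<And>a b. a \<noteq> b \<Longrightarrow> card (both_edge V E a b) \<le> z"
  shows "card {w \<in> half_open V E u v. e = {u, w} \<or> e \<in> closers V E u w} \<le> 2 + z"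
proof (cases "u \<in> e")
  case True
  then obtain a where a: "e = {u, a}" "a \<noteq> u" using e(1) open_other by blast
  then have av: "a \<noteq> v" using e by blast
  have aO: "{u, a} \<in> Op" using a e by simp
  have "w \<in> insert a (both_edge V E a v)" if w: "w \<in> half_open V E u v"
    and "e = {u, w} \<or> e \<in> closers V E u w" for w
  proof -
    have "w \<noteq> u" using w by (auto simp: half_iff open_iff)
    then have "w = a \<or> {w, a} \<in> E"
      using that(2) unfolding a(1) closers_pair_iff[OF aO] using a(2) by (auto simp: doubleton_eq_iff)
    then show ?thesis using w by (auto simp: half_iff both_edge_iff insert_commute)
  qed
  then have "{w \<in> half_open V E u v. e = {u, w} \<or> e \<in> closers V E u w} \<subseteq> insert a (both_edge V E a v)"
    by blast
  then have "card {w \<in> half_open V E u v. e = {u, w} \<or> e \<in> closers V E u w} \<le> card (insert a (both_edge V E a v))"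
    by (intro card_mono) auto
  also have "\<dots> \<le> 1 + z" using Z[OF av] by (simp add: card_insert_if)
  finally show ?thesis by simp
next
  case False
  have "{w \<in> half_open V E u v. e = {u, w} \<or> e \<in> closers V E u w} \<subseteq> e"
    using False by (auto simp: closers_iff)
  then have "card {w \<in> half_open V E u v. e = {u, w} \<or> e \<in> closers V E u w} \<le> card e"
    using e(1) by (intro card_mono) (auto simp: open_pairs_def pairs_def card_ge_0_finite)
  then show ?thesis using e(1) by (simp add: open_pairs_def pairs_def)
qed

text \<open>Inserting {u, v} closes {u, w} only if {v, w} is an edge, but {v, w} is open.\<close>

lemma uv_notin_both_loss:
  assumes "u \<noteq> v" "w \<in> both_open V E u v"
  shows "{u, v} \<notin> {{u, w}, {v, w}} \<union> closers V E u w \<union> closers V E v w"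
  using assms by (auto simp: closers_iff both_iff doubleton_eq_iff open_iff insert_commute)

lemma sum_both_loss:
  "(\<Sum>e\<in>Op. card {w \<in> both_open V E u v. e \<in> {{u, w}, {v, w}} \<union> closers V E u w \<union> closers V E v w})
     = (\<Sum>w\<in>both_open V E u v. card ({{u, w}, {v, w}} \<union> closers V E u w \<union> closers V E v w))"
  by (rule sum_card_swap) (auto simp: both_iff closers_iff)

lemma card_both_killers_le:
  "card ({{u, w}, {v, w}} \<union> closers V E u w \<union> closers V E v w)
     \<le> 2 + card (closers V E u w) + card (closers V E v w)"
proof -
  have "card ({{u, w}, {v, w}} \<union> closers V E u w \<union> closers V E v w)
     \<le> card {{u, w}, {v, w}} + card (closers V E u w) + card (closers V E v w)"
    by (meson add_le_mono1 card_Un_le le_trans)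
  moreover have "card {{u, w}, {v, w}} \<le> 2" by (simp add: card_insert_if)
  ultimately show ?thesis by linarith
qed

text \<open>A pair closing both {u, w} and {v, w} has the form {w, z} with z a common neighbour of u
  and v, so the overlap is at most a codegree.\<close>

lemma card_both_killers_ge:
  assumes w: "w \<in> both_open V E u v" and uv: "u \<noteq> v"
  shows "card (closers V E u w) + card (closers V E v w) \<le>
     card ({{u, w}, {v, w}} \<union> closers V E u w \<union> closers V E v w) + card (both_edge V E u v)"
proof -
  have nE: "{u, w} \<notin> E" "{v, w} \<notin> E" "w \<noteq> u" "w \<noteq> v" using w by (auto simp: both_iff open_iff)
  have nE': "{w, u} \<notin> E" "{w, v} \<notin> E" "{w} \<notin> E"
    using nE edgeD[of w w] by (auto simp: insert_commute)
  have "e \<in> (\<lambda>z. {w, z}) ` both_edge V E u v" if e: "e \<in> closers V E u w" "e \<in> closers V E v w" for e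
  proof -
    obtain z where z: "e = {u, z} \<and> {w, z} \<in> E \<or> e = {w, z} \<and> {u, z} \<in> E"
      using e(1) by (auto simp: closers_iff)
    obtain z' where z': "e = {v, z'} \<and> {w, z'} \<in> E \<or> e = {w, z'} \<and> {v, z'} \<in> E"
      using e(2) by (auto simp: closers_iff)
    have "e = {w, z} \<and> {u, z} \<in> E \<and> {v, z} \<in> E"
      using z z' nE nE' uv by (elim disjE) (auto simp: doubleton_eq_iff)
    then show ?thesis by (auto simp: both_edge_iff)
  qed
  then have "closers V E u w \<inter> closers V E v w \<subseteq> (\<lambda>z. {w, z}) ` both_edge V E u v" by blast
  then have "card (closers V E u w \<inter> closers V E v w) \<le> card (both_edge V E u v)"
    by (meson card_image_le card_mono finite_both_edge finite_imageI le_trans)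
  moreover have "card (closers V E u w \<union> closers V E v w)
      \<le> card ({{u, w}, {v, w}} \<union> closers V E u w \<union> closers V E v w)"
    by (rule card_mono) auto
  ultimately show ?thesis
    using card_Un_Int[of "closers V E u w" "closers V E v w"] by simp
qed

text \<open>If e = {u, a}, a lost w other than a is adjacent to a while {u, w} is open, so it lies
  in \<open>half_open V E u a\<close>. Jumps of \<open>both_open\<close> are therefore bounded by
  the size of a \<open>half_open\<close> set, not by a codegree.\<close>

lemma both_loss_le:
  assumes e: "e \<in> Op" "e \<noteq> {u, v}" and uv: "u \<noteq> v" "{u, v} \<notin> E"
    and A: "\<And>a b. a \<noteq> b \<Longrightarrow> {a, b} \<notin> E \<Longrightarrow> card (half_open V E a b) \<le> c"
  shows "card {w \<in> both_open V E u v. e \<in> {{u, w}, {v, w}} \<union> closers V E u w \<union> closers V E v w} \<le> 2 + c"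
    (is "card (?L u v) \<le> _")
proof -
  have half: "card (?L u v) \<le> 2 + c" if ue: "u \<in> e" and ev: "e \<noteq> {u, v}" and uv: "u \<noteq> v" "{u, v} \<notin> E" for u v
  proof -
    obtain a where a: "e = {u, a}" "a \<noteq> u" using e(1) ue open_other by blast
    then have av: "a \<noteq> v" using ev by blast
    have aO: "{u, a} \<in> Op" using a e by simp
    have "w \<in> insert a (half_open V E u a)" if w: "w \<in> ?L u v" for w
    proof -
      have wo: "w \<noteq> u" "w \<noteq> v" "{u, w} \<in> Op" "{v, u} \<notin> E"
        using w uv by (auto simp: both_iff open_iff insert_commute)
      have "e = {u, w} \<or> e = {v, w} \<or> e \<in> closers V E u w \<or> e \<in> closers V E v w" using w by blast
      then have "w = a \<or> {w, a} \<in> E"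
        unfolding a(1) closers_pair_iff[OF aO] using a(2) av wo uv by (auto simp: doubleton_eq_iff)
      then show ?thesis using wo by (auto simp: half_iff insert_commute)
    qed
    then have "?L u v \<subseteq> insert a (half_open V E u a)" by blast
    then have "card (?L u v) \<le> card (insert a (half_open V E u a))"
      by (intro card_mono) auto
    also have "\<dots> \<le> 1 + c" using A[of u a] a e(1) by (auto simp add: card_insert_if open_iff)
    finally show ?thesis by simp
  qed
  have sw: "?L u v = ?L v u" by (auto simp: both_iff)
  consider "u \<in> e" | "v \<in> e" | "u \<notin> e" "v \<notin> e" by blast
  then show ?thesis
  proof cases
    case 1 then show ?thesis using half e uv by blast
  next
    case 2 then show ?thesis unfolding sw using half[of v u] e uv by (simp add: insert_commute)
  next
    case 3
    have "?L u v \<subseteq> e" using 3 by (auto simp: closers_iff)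
    then have "card (?L u v) \<le> card e"
      using e(1) by (intro card_mono) (auto simp: open_pairs_def pairs_def card_ge_0_finite)
    then show ?thesis using e(1) by (simp add: open_pairs_def pairs_def)
  qed
qed

end

section \<open>Supermartingales along the process\<close>

lemma triangle_free_graph_empty: "finite V \<Longrightarrow> triangle_free_graph V {}"
  by (simp add: triangle_free_graph_def has_triangle_def)

lemma triangle_free_graph_step:
  assumes "triangle_free_graph {..<n} E" "E' \<in> set_pmf (tf_step n E)"
  shows "triangle_free_graph {..<n} E'" "E \<subseteq> E'"
proof -
  interpret triangle_free_graph "{..<n}" E by fact
  show "triangle_free_graph {..<n} E'" "E \<subseteq> E'"
    using assms triangle_free_insert by (auto simp: tf_step_def split: if_splits)
qed

lemma finite_set_tf_step: "finite (set_pmf (tf_step n E))"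
  by (simp add: tf_step_def finite_open_pairs)

lemma finite_set_tf_run: "finite (set_pmf (tf_run n s))"
  by (induction s) (auto simp: finite_set_tf_step)

lemma tf_run_triangle_free:
  assumes "G \<in> set_pmf (tf_run n s)"
  shows "triangle_free_graph {..<n} (G i)"
  using assms
proof (induction s arbitrary: G i)
  case 0
  then show ?case by (simp add: triangle_free_graph_empty)
next
  case (Suc s)
  then obtain G' E where "G' \<in> set_pmf (tf_run n s)" "E \<in> set_pmf (tf_step n (G' s))"
    "G = (\<lambda>i. if i \<le> s then G' i else E)" by auto
  then show ?case using Suc.IH triangle_free_graph_step(1) by (metis (full_types))
qed

lemma tf_run_mono:
  assumes "G \<in> set_pmf (tf_run n s)" "i \<le> j"
  shows "G i \<subseteq> G j"
  using assms
proof (induction s arbitrary: G i j)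
  case 0
  then show ?case by simp
next
  case (Suc s)
  then obtain G' E where G': "G' \<in> set_pmf (tf_run n s)" and E: "E \<in> set_pmf (tf_step n (G' s))"
    and G: "G = (\<lambda>i. if i \<le> s then G' i else E)" by auto
  have sE: "G' s \<subseteq> E" using triangle_free_graph_step(2)[OF tf_run_triangle_free[OF G'] E] .
  have "G' i \<subseteq> E" if "i \<le> s" using Suc.IH[OF G' that] sE by (rule order_trans)
  then show ?case using Suc.IH[OF G' Suc.prems(2)] Suc.prems(2) unfolding G by simp
qed

text \<open>The shorter run is the longer one frozen at step r. Events that only look at steps up to
  r thus have the same probability in both.\<close>

lemma tf_run_marginal:
  assumes "r \<le> s"
  shows "map_pmf (\<lambda>G i. G (min i r)) (tf_run n s) = tf_run n r"
  using assms
proof (induction s rule: dec_induct)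
  case base
  have "map_pmf (\<lambda>G i. G (min i r)) (tf_run n r) = map_pmf id (tf_run n r)"
  proof (rule map_pmf_cong[OF refl])
    fix G assume "G \<in> set_pmf (tf_run n r)"
    then have const: "\<forall>i\<ge>r. G i = G r" using tf_run_invariant by blast
    have "G (min i r) = G i" for i
      using const[rule_format, of i] by (cases "r \<le> i") (simp_all add: min_def)
    then show "(\<lambda>i. G (min i r)) = id G" by (simp add: fun_eq_iff)
  qed
  then show ?case by simp
next
  case (step s)
  \<comment> \<open>The step from s to s + 1 lies beyond r and disappears under the
    truncation.\<close>
  have eq: "(\<lambda>i. if min i r \<le> s then G (min i r) else E) = (\<lambda>i. G (min i r))"
    for G :: "nat \<Rightarrow> nat set set" and E
    using step.hyps(1) by (simp add: fun_eq_iff min_le_iff_disj)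
  have "map_pmf (\<lambda>G i. G (min i r)) (tf_run n (Suc s)) =
      bind_pmf (tf_run n s) (\<lambda>G. map_pmf (\<lambda>E i. G (min i r)) (tf_step n (G s)))"
    unfolding tf_run.simps map_bind_pmf map_pmf_comp eq ..
  also have "\<dots> = map_pmf (\<lambda>G i. G (min i r)) (tf_run n s)"
    by (simp add: map_pmf_const) (simp add: map_pmf_def)
  finally show ?case using step.IH by simp
qed

lemma prob_tf_run_marginal:
  assumes "r \<le> s" and "\<And>G. P (\<lambda>i. G (min i r)) \<longleftrightarrow> P G"
  shows "measure_pmf.prob (tf_run n s) {G. P G} = measure_pmf.prob (tf_run n r) {G. P G}"
proof -
  have "measure_pmf.prob (tf_run n r) {G. P G} = measure_pmf.prob (tf_run n s) {G. P (\<lambda>i. G (min i r))}"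
    unfolding tf_run_marginal[OF assms(1), symmetric] by (simp add: vimage_def)
  then show ?thesis by (simp add: assms(2))
qed

lemma expectation_tf_step:
  assumes "open_pairs {..<n} E \<noteq> {}"
  shows "measure_pmf.expectation (tf_step n E) (f :: _ \<Rightarrow> real) =
    (\<Sum>e\<in>open_pairs {..<n} E. f (insert e E)) / card (open_pairs {..<n} E)"
  using assms by (simp add: tf_step_def integral_pmf_of_set finite_open_pairs)

text \<open>The value \<open>c\<close> is what the stopped process pays once \<open>good\<close> fails: with \<open>c = 0\<close> the lemma bounds
  the expectation on the event that \<open>good\<close> holds throughout, with \<open>c = 1\<close> it is a maximal inequality.\<close>

lemma tf_run_supermartingale:
  fixes \<Phi> :: "nat \<Rightarrow> nat set set \<Rightarrow> real"
  assumes drift: "\<And>i E. i < s \<Longrightarrow> triangle_free_graph {..<n} E \<Longrightarrow> good i E \<Longrightarrow>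
      measure_pmf.expectation (tf_step n E) (\<Phi> (Suc i)) \<le> \<Phi> i E"
    and stop: "\<And>i E. i < s \<Longrightarrow> \<not> good i E \<Longrightarrow> c \<le> \<Phi> i E"
  shows "measure_pmf.expectation (tf_run n s) (\<lambda>G. if \<forall>i<s. good i (G i) then \<Phi> s (G s) else c) \<le> \<Phi> 0 {}"
  using assms
proof (induction s)
  case 0
  then show ?case by simp
next
  case (Suc s)
  let ?f = "\<lambda>s G. if \<forall>i<s. good i (G i) then \<Phi> s (G s) else c"
  let ?A = "set_pmf (tf_run n s)"
  let ?k = "\<lambda>G. map_pmf (\<lambda>E i. if i \<le> s then G i else E) (tf_step n (G s))"
  have inner: "measure_pmf.expectation (?k G) (?f (Suc s)) \<le> ?f s G" if G: "G \<in> ?A" for G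
  proof -
    have "measure_pmf.expectation (?k G) (?f (Suc s)) =
      measure_pmf.expectation (tf_step n (G s)) (\<lambda>E. if \<forall>i<Suc s. good i (G i) then \<Phi> (Suc s) E else c)"
      by (auto intro!: Bochner_Integration.integral_cong simp: less_Suc_eq_le)
    also have "\<dots> \<le> ?f s G"
    proof (cases "\<forall>i<Suc s. good i (G i)")
      case True
      then show ?thesis using Suc.prems(1)[of s "G s"] tf_run_triangle_free[OF G] by simp
    next
      case False
      then have "measure_pmf.expectation (tf_step n (G s))
          (\<lambda>E. if \<forall>i<Suc s. good i (G i) then \<Phi> (Suc s) E else c) = c" by (simp only: if_False) simp
      \<comment> \<open>Either \<open>good\<close> failed before s and both sides equal c, or it
        first fails at s and \<open>stop\<close> gives the inequality.\<close>
      also have "c \<le> ?f s G" using False Suc.prems(2)[of s "G s"] by (auto simp: less_Suc_eq)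
      finally show ?thesis .
    qed
    finally show ?thesis .
  qed
  have "measure_pmf.expectation (tf_run n (Suc s)) (?f (Suc s)) =
     (\<Sum>G\<in>?A. pmf (tf_run n s) G *\<^sub>R measure_pmf.expectation (?k G) (?f (Suc s)))"
    unfolding tf_run.simps
    by (rule pmf_expectation_bind) (auto simp: finite_set_tf_run finite_set_tf_step)
  also have "\<dots> \<le> (\<Sum>G\<in>?A. pmf (tf_run n s) G * ?f s G)"
    using inner by (auto intro!: sum_mono mult_left_mono)
  also have "\<dots> = measure_pmf.expectation (tf_run n s) (?f s)"
    using integral_measure_pmf_real[OF finite_set_tf_run, where f = "?f s"] by (simp add: mult.commute)
  also have "\<dots> \<le> \<Phi> 0 {}"
    by (rule Suc.IH) (use Suc.prems in auto)
  finally show ?case .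
qed

lemma integrable_tf_run: "integrable (measure_pmf (tf_run n s)) (f :: _ \<Rightarrow> real)"
  by (rule integrable_measure_pmf_finite[OF finite_set_tf_run])

lemma prob_le_expectation_tf_run:
  fixes f :: "_ \<Rightarrow> real"
  assumes "\<And>G. G \<in> set_pmf (tf_run n s) \<Longrightarrow> 0 \<le> f G" "\<And>G. G \<in> set_pmf (tf_run n s) \<Longrightarrow> P G \<Longrightarrow> 1 \<le> f G"
  shows "measure_pmf.prob (tf_run n s) {G. P G} \<le> measure_pmf.expectation (tf_run n s) f"
proof -
  have "measure_pmf.prob (tf_run n s) {G. P G} = measure_pmf.expectation (tf_run n s) (indicator {G. P G})"
    by simp
  also have "\<dots> \<le> measure_pmf.expectation (tf_run n s) f"
    using assms by (intro integral_mono_AE integrable_tf_run)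
      (auto simp: AE_measure_pmf_iff indicator_def)
  finally show ?thesis .
qed

text \<open>Markov's inequality for the process that is stopped with value 0 once
  \<open>good\<close> fails.\<close>

lemma prob_good_and_le:
  fixes \<Phi> :: "nat \<Rightarrow> nat set set \<Rightarrow> real"
  assumes drift: "\<And>i E. i < s \<Longrightarrow> triangle_free_graph {..<n} E \<Longrightarrow> good i E \<Longrightarrow>
      measure_pmf.expectation (tf_step n E) (\<Phi> (Suc i)) \<le> \<Phi> i E"
    and nonneg: "\<And>i E. 0 \<le> \<Phi> i E" and R: "\<And>E. triangle_free_graph {..<n} E \<Longrightarrow> R E \<Longrightarrow> b \<le> \<Phi> s E" and b: "b > 0"
  shows "measure_pmf.prob (tf_run n s) {G. (\<forall>i<s. good i (G i)) \<and> R (G s)} \<le> \<Phi> 0 {} / b"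
proof -
  have "measure_pmf.prob (tf_run n s) {G. (\<forall>i<s. good i (G i)) \<and> R (G s)}
      \<le> measure_pmf.expectation (tf_run n s) (\<lambda>G. (if \<forall>i<s. good i (G i) then \<Phi> s (G s) else 0) / b)"
    using b by (intro prob_le_expectation_tf_run) (auto simp: nonneg R tf_run_triangle_free)
  also have "\<dots> = measure_pmf.expectation (tf_run n s) (\<lambda>G. if \<forall>i<s. good i (G i) then \<Phi> s (G s) else 0) / b"
    by simp
  also have "\<dots> \<le> \<Phi> 0 {} / b"
    by (intro divide_right_mono tf_run_supermartingale) (use assms in auto)
  finally show ?thesis .
qed

text \<open>Stopping with value 1 when the potential reaches 1 means that the drift bound is used
  only below 1, that is, only while everything is within tolerance.\<close>

lemma prob_exceed_le:
  fixes \<Phi> :: "nat \<Rightarrow> nat set set \<Rightarrow> real"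
  assumes drift: "\<And>i E. i < s \<Longrightarrow> triangle_free_graph {..<n} E \<Longrightarrow> \<Phi> i E < 1 \<Longrightarrow>
      measure_pmf.expectation (tf_step n E) (\<Phi> (Suc i)) \<le> \<Phi> i E"
    and nonneg: "\<And>i E. 0 \<le> \<Phi> i E"
  shows "measure_pmf.prob (tf_run n s) {G. \<exists>i\<le>s. \<Phi> i (G i) \<ge> 1} \<le> \<Phi> 0 {}"
proof -
  have "measure_pmf.prob (tf_run n s) {G. \<exists>i\<le>s. \<Phi> i (G i) \<ge> 1}
      \<le> measure_pmf.expectation (tf_run n s) (\<lambda>G. if \<forall>i<s. \<Phi> i (G i) < 1 then \<Phi> s (G s) else 1)"
    by (intro prob_le_expectation_tf_run) (auto simp: nonneg not_less dest: le_neq_implies_less)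
  also have "\<dots> \<le> \<Phi> 0 {}"
    by (rule tf_run_supermartingale) (use drift in auto)
  finally show ?thesis .
qed

section \<open>Analytic estimates\<close>

lemma exp_le_quadratic:
  fixes x :: real
  assumes "\<bar>x\<bar> \<le> 1"
  shows "exp x \<le> 1 + x + x\<^sup>2"
proof (cases "x \<ge> 0")
  case True
  then show ?thesis using assms exp_bound by simp
next
  case False
  \<comment> \<open>For x = -y the claim reads 1 <= (1 - y + y^2) exp y, and the quadratic Taylor
    polynomial of exp y is enough for it.\<close>
  define y where "y = - x"
  have y: "y > 0" using False by (simp add: y_def)
  have "0 < 1 - y + y\<^sup>2"
    using zero_le_power2[of "y - 1/2"] by (simp add: power2_diff power_divide)
  then have "(1 - y + y\<^sup>2) * (1 + y + y\<^sup>2 / 2) \<le> (1 - y + y\<^sup>2) * exp y"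
    using y by (intro mult_left_mono exp_lower_Taylor_quadratic) auto
  moreover have "(1 - y + y\<^sup>2) * (1 + y + y\<^sup>2 / 2) = 1 + (y\<^sup>2 + y ^ 3 + y ^ 4) / 2"
    by (simp add: field_simps power2_eq_square power3_eq_cube power4_eq_xxxx)
  moreover have "1 \<le> 1 + (y\<^sup>2 + y ^ 3 + y ^ 4) / 2" using y by simp
  ultimately have "1 \<le> (1 - y + y\<^sup>2) * exp y" by (metis order_trans)
  then have "exp (- y) \<le> 1 - y + y\<^sup>2" by (simp add: exp_minus field_simps)
  then show ?thesis by (simp add: y_def)
qed

text \<open>\<open>exp_le_quadratic\<close> is applied to each term; then 1 + x <= exp x moves the
  mean and the second moment into the exponent.\<close>

lemma average_exp_le:
  fixes d :: "'a \<Rightarrow> real"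
  assumes "finite P" "P \<noteq> {}" "\<And>e. e \<in> P \<Longrightarrow> \<bar>l * d e\<bar> \<le> 1"
  shows "(\<Sum>e\<in>P. exp (l * d e)) / card P
    \<le> exp (l * ((\<Sum>e\<in>P. d e) / card P) + l\<^sup>2 * ((\<Sum>e\<in>P. (d e)\<^sup>2) / card P))"
proof -
  have c: "real (card P) > 0" using assms by (simp add: card_gt_0_iff)
  have "(\<Sum>e\<in>P. exp (l * d e)) \<le> (\<Sum>e\<in>P. 1 + l * d e + (l * d e)\<^sup>2)"
    by (intro sum_mono exp_le_quadratic assms)
  also have "\<dots> = card P + l * (\<Sum>e\<in>P. d e) + l\<^sup>2 * (\<Sum>e\<in>P. (d e)\<^sup>2)"
    by (simp add: sum.distrib sum_distrib_left power_mult_distrib)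
  finally have "(\<Sum>e\<in>P. exp (l * d e)) / card P
      \<le> 1 + (l * ((\<Sum>e\<in>P. d e) / card P) + l\<^sup>2 * ((\<Sum>e\<in>P. (d e)\<^sup>2) / card P))"
    using c by (simp add: field_simps)
  also have "\<dots> \<le> exp (l * ((\<Sum>e\<in>P. d e) / card P) + l\<^sup>2 * ((\<Sum>e\<in>P. (d e)\<^sup>2) / card P))"
    by (rule exp_ge_add_one_self)
  finally show ?thesis .
qed

text \<open>Here d is the random increment of a tracked variable and r the deterministic increment
  of trajectory and tolerance. The exponential does not grow on average once r covers the mean of d
  plus l times its second moment. The subset P' leaves out the insertion after which the pair is no
  longer tracked.\<close>

lemma average_exp_drift:
  fixes d :: "'a \<Rightarrow> real"
  assumes P: "finite P" "P \<noteq> {}" and l: "l > 0" "\<And>e. e \<in> P \<Longrightarrow> l * \<bar>d e\<bar> \<le> 1"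
    and r: "(\<Sum>e\<in>P. d e) / card P + l * ((\<Sum>e\<in>P. (d e)\<^sup>2) / card P) \<le> r"
    and w: "P' \<subseteq> P" "\<And>e. e \<in> P' \<Longrightarrow> w e = exp (b + l * (d e - r))"
  shows "(\<Sum>e\<in>P'. w e) / card P \<le> exp b"
proof -
  have "(\<Sum>e\<in>P'. w e) \<le> (\<Sum>e\<in>P. exp (b + l * (d e - r)))"
    using sum_mono2[OF P(1) w(1), of "\<lambda>e. exp (b + l * (d e - r))"] w(2) by simp
  also have "\<dots> = (\<Sum>e\<in>P. exp (b - l * r) * exp (l * d e))"
    by (intro sum.cong refl) (simp add: algebra_simps flip: exp_add)
  also have "\<dots> = exp (b - l * r) * (\<Sum>e\<in>P. exp (l * d e))"
    by (rule sum_distrib_left[symmetric])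
  finally have "(\<Sum>e\<in>P'. w e) / card P \<le> exp (b - l * r) * ((\<Sum>e\<in>P. exp (l * d e)) / card P)"
    by (simp add: divide_right_mono)
  also have "\<dots> \<le> exp (b - l * r) *
      exp (l * ((\<Sum>e\<in>P. d e) / card P) + l\<^sup>2 * ((\<Sum>e\<in>P. (d e)\<^sup>2) / card P))"
    using l by (intro mult_left_mono average_exp_le P) (auto simp: abs_mult)
  also have "\<dots> = exp (b - l * r + l * ((\<Sum>e\<in>P. d e) / card P + l * ((\<Sum>e\<in>P. (d e)\<^sup>2) / card P)))"
    by (simp add: distrib_left power2_eq_square mult.assoc flip: exp_add)
  also have "\<dots> \<le> exp b"
    using mult_left_mono[OF r, of l] l(1) by simp
  finally show ?thesis .
qed

text \<open>The mean value theorem for the function and then for its derivative. The resulting C in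
  place of Taylor's C/2 is harmless at step size n^(-3/2).\<close>

lemma second_order_bound:
  fixes \<phi> :: "real \<Rightarrow> real"
  assumes d1: "\<And>s. (\<phi> has_real_derivative \<phi>' s) (at s)"
    and d2: "\<And>s. (\<phi>' has_real_derivative \<phi>'' s) (at s)"
    and bd: "\<And>s. s \<ge> 0 \<Longrightarrow> \<bar>\<phi>'' s\<bar> \<le> C" and t: "t \<ge> 0" "\<delta> > 0"
  shows "\<bar>\<phi> (t + \<delta>) - \<phi> t - \<delta> * \<phi>' t\<bar> \<le> C * \<delta>\<^sup>2"
proof -
  obtain z where z: "z > t" "z < t + \<delta>" "\<phi> (t + \<delta>) - \<phi> t = \<delta> * \<phi>' z"
    using MVT2[of t "t + \<delta>" \<phi> \<phi>'] t d1 by auto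
  obtain w where w: "w > t" "w < z" "\<phi>' z - \<phi>' t = (z - t) * \<phi>'' w"
    using MVT2[of t z \<phi>' \<phi>''] z d2 by auto
  have "\<phi> (t + \<delta>) - \<phi> t - \<delta> * \<phi>' t = \<delta> * (\<phi>' z - \<phi>' t)"
    using z(3) by (simp add: right_diff_distrib)
  also have "\<dots> = \<delta> * ((z - t) * \<phi>'' w)" by (simp add: w(3))
  also have "\<bar>\<dots>\<bar> = \<delta> * ((z - t) * \<bar>\<phi>'' w\<bar>)" using t z by (simp add: abs_mult)
  also have "\<dots> \<le> \<delta> * (\<delta> * C)"
    using t z w bd[of w] by (intro mult_left_mono mult_mono) auto
  finally show ?thesis by (simp add: power2_eq_square mult_ac)
qed

lemma le_exp_square:
  fixes t :: real
  assumes "t \<ge> 0"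
  shows "t \<le> exp (4 * t\<^sup>2)" "t\<^sup>2 \<le> exp (4 * t\<^sup>2)" "t ^ 3 \<le> exp (4 * t\<^sup>2)" "4 * t \<le> exp (4 * t\<^sup>2)"
proof -
  have e: "1 + 4 * t\<^sup>2 + 8 * t ^ 4 \<le> exp (4 * t\<^sup>2)"
    using exp_lower_Taylor_quadratic[of "4 * t\<^sup>2"] by (simp add: power_mult_distrib flip: power_mult)
  have t1: "4 * t \<le> 1 + 4 * t\<^sup>2" using zero_le_power2[of "2 * t - 1"] by (simp add: power2_eq_square algebra_simps)
  have t4: "0 \<le> t ^ 4" using assms by simp
  have t3: "t ^ 3 \<le> t\<^sup>2 + t ^ 4"
    using mult_nonneg_nonneg[OF zero_le_power2[of t], of "1 - t + t\<^sup>2"] zero_le_power2[of "t - 1/2"]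
    by (simp add: power2_eq_square power3_eq_cube power4_eq_xxxx algebra_simps)
  show "4 * t \<le> exp (4 * t\<^sup>2)" using e t1 t4 by linarith
  then show "t \<le> exp (4 * t\<^sup>2)" using assms by linarith
  show "t\<^sup>2 \<le> exp (4 * t\<^sup>2)" using e t4 zero_le_power2[of t] by linarith
  show "t ^ 3 \<le> exp (4 * t\<^sup>2)" using e t4 t3 zero_le_power2[of t] by linarith
qed

lemma exp_square_le_1:
  fixes t :: real
  assumes "t \<ge> 0"
  shows "t * exp (- 4 * t\<^sup>2) \<le> 1" "t\<^sup>2 * exp (- 4 * t\<^sup>2) \<le> 1" "t ^ 3 * exp (- 4 * t\<^sup>2) \<le> 1"
    "4 * t * exp (- 4 * t\<^sup>2) \<le> 1"
  using le_exp_square[OF assms] by (simp_all add: exp_minus field_simps)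

section \<open>Second-order expansions of the trajectories\<close>

lemma q_second_order:
  assumes "t \<ge> 0" "\<delta> > 0"
  shows "\<bar>q_fun (t + \<delta>) - q_fun t + \<delta> * y_fun t\<bar> \<le> 400 * \<delta>\<^sup>2"
proof -
  \<comment> \<open>The bound 400 is shared by the three expansions; the second derivative is at
    most 36 here and at most 272 in the other two.\<close>
  have "\<bar>q_fun (t + \<delta>) - q_fun t - \<delta> * (- y_fun t)\<bar> \<le> 400 * \<delta>\<^sup>2"
  proof (rule second_order_bound[where \<phi>'' = "\<lambda>t. (32 * t\<^sup>2 - 4) * exp (- 4 * t\<^sup>2)"])
    fix s :: real assume s: "s \<ge> 0"
    have "exp (- 4 * s\<^sup>2) \<le> 1" "0 \<le> s\<^sup>2 * exp (- 4 * s\<^sup>2)" by simp_all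
    moreover have "(32 * s\<^sup>2 - 4) * exp (- 4 * s\<^sup>2) = 32 * (s\<^sup>2 * exp (- 4 * s\<^sup>2)) - 4 * exp (- 4 * s\<^sup>2)"
      by (simp add: left_diff_distrib)
    moreover have "0 < exp (- 4 * s\<^sup>2)" by simp
    ultimately show "\<bar>(32 * s\<^sup>2 - 4) * exp (- 4 * s\<^sup>2)\<bar> \<le> 400"
      using exp_square_le_1(2)[OF s] by linarith
  qed (use assms in \<open>auto simp: q_fun_def y_fun_def power2_eq_square algebra_simps intro!: derivative_eq_intros\<close>)
  then show ?thesis by simp
qed

lemma y_second_order:
  assumes "t \<ge> 0" "\<delta> > 0"
  shows "\<bar>y_fun (t + \<delta>) / 2 - y_fun t / 2 - \<delta> * ((2 - 16 * t\<^sup>2) * exp (- 4 * t\<^sup>2))\<bar> \<le> 400 * \<delta>\<^sup>2"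
proof (rule second_order_bound[where \<phi>'' = "\<lambda>t. (128 * t ^ 3 - 48 * t) * exp (- 4 * t\<^sup>2)"])
  fix s :: real assume s: "s \<ge> 0"
  have "0 \<le> s * exp (- 4 * s\<^sup>2)" "0 \<le> s ^ 3 * exp (- 4 * s\<^sup>2)" using s by simp_all
  then show "\<bar>(128 * s ^ 3 - 48 * s) * exp (- 4 * s\<^sup>2)\<bar> \<le> 400"
    using exp_square_le_1[OF s] by (simp add: left_diff_distrib mult.assoc)
qed (use assms in \<open>auto simp: y_fun_def power2_eq_square power3_eq_cube algebra_simps intro!: derivative_eq_intros\<close>)

text \<open>Heuristically a pair is open with probability exp(-4t^2) = 2q, so two given pairs are
  both open with probability exp(-8t^2).\<close>

definition x_fun :: "real \<Rightarrow> real" where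
  "x_fun t = exp (- 8 * t\<^sup>2)"

lemma x_second_order:
  assumes "t \<ge> 0" "\<delta> > 0"
  shows "\<bar>x_fun (t + \<delta>) - x_fun t - \<delta> * (- 16 * t * x_fun t)\<bar> \<le> 400 * \<delta>\<^sup>2"
proof (rule second_order_bound[where \<phi>'' = "\<lambda>t. (256 * t\<^sup>2 - 16) * exp (- 8 * t\<^sup>2)"])
  fix s :: real assume s: "s \<ge> 0"
  have "exp (- 8 * s\<^sup>2) \<le> 1" "0 \<le> s\<^sup>2 * exp (- 8 * s\<^sup>2)" by simp_all
  moreover have "s\<^sup>2 * exp (- 8 * s\<^sup>2) \<le> s\<^sup>2 * exp (- 4 * s\<^sup>2)" by (intro mult_left_mono) auto
  moreover have "(256 * s\<^sup>2 - 16) * exp (- 8 * s\<^sup>2) = 256 * (s\<^sup>2 * exp (- 8 * s\<^sup>2)) - 16 * exp (- 8 * s\<^sup>2)"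
    by (simp add: left_diff_distrib)
  moreover have "0 < exp (- 8 * s\<^sup>2)" by simp
  ultimately show "\<bar>(256 * s\<^sup>2 - 16) * exp (- 8 * s\<^sup>2)\<bar> \<le> 400"
    using exp_square_le_1(2)[OF s] by linarith
qed (use assms in \<open>auto simp: x_fun_def power2_eq_square algebra_simps intro!: derivative_eq_intros\<close>)

text \<open>This is exp(-4t^2) times \<open>g_y\<close>. The gain of \<open>half_open\<close> is
  \<open>both_open\<close> divided by Q, and Q carries a factor exp(-4t^2), so with this choice the
  induced error is of the order of \<open>g_y\<close>.\<close>

definition g_x :: "nat \<Rightarrow> real \<Rightarrow> real" where
  "g_x n t = exp (37 * t\<^sup>2 + 40 * t) * real n powr (-1/6)"

text \<open>A stricter tolerance for Q than \<open>g_q\<close>. In the drift of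
  \<open>half_open\<close> an error in Q is multiplied by about 1 + 8t^2; dividing by 1 + t leaves a
  factor linear in t, which the growth of \<open>g_y\<close> absorbs.\<close>

definition h_q :: "nat \<Rightarrow> real \<Rightarrow> real" where
  "h_q n t = g_y n t / (20 * (1 + t))"

section \<open>Growth of the tolerances\<close>

lemma g_y_mono: "0 \<le> s \<Longrightarrow> s \<le> t \<Longrightarrow> g_y n s \<le> g_y n t"
  unfolding g_y_def by (intro mult_right_mono) (auto intro!: add_mono power_mono mult_left_mono)

lemma g_x_mono: "0 \<le> s \<Longrightarrow> s \<le> t \<Longrightarrow> g_x n s \<le> g_x n t"
  unfolding g_x_def by (intro mult_right_mono) (auto intro!: add_mono power_mono mult_left_mono)

text \<open>The relative growth rate 82t + 40 is what makes the tracking close: the drift errors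
  relative to the tolerance are also linear in t, with smaller coefficients.\<close>

lemma g_y_growth:
  assumes "t \<ge> 0" "\<delta> > 0"
  shows "g_y n (t + \<delta>) - g_y n t \<ge> \<delta> * ((82 * t + 40) * g_y n t)"
proof -
  have "(g_y n has_real_derivative (82 * s + 40) * g_y n s) (at s)" for s
    unfolding g_y_def by (auto intro!: derivative_eq_intros simp: algebra_simps)
  then obtain z where z: "z > t" "z < t + \<delta>" "g_y n (t + \<delta>) - g_y n t = \<delta> * ((82 * z + 40) * g_y n z)"
    using MVT2[of t "t + \<delta>" "g_y n" "\<lambda>s. (82 * s + 40) * g_y n s"] assms by auto
  have "(82 * t + 40) * g_y n t \<le> (82 * z + 40) * g_y n z"
    using z assms g_y_mono[of t z n] by (intro mult_mono) (auto simp: g_y_def)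
  then show ?thesis using z assms by simp
qed

lemma g_x_growth:
  assumes "t \<ge> 0" "\<delta> > 0"
  shows "g_x n (t + \<delta>) - g_x n t \<ge> \<delta> * ((74 * t + 40) * g_x n t)"
proof -
  have "(g_x n has_real_derivative (74 * s + 40) * g_x n s) (at s)" for s
    unfolding g_x_def by (auto intro!: derivative_eq_intros simp: algebra_simps)
  then obtain z where z: "z > t" "z < t + \<delta>" "g_x n (t + \<delta>) - g_x n t = \<delta> * ((74 * z + 40) * g_x n z)"
    using MVT2[of t "t + \<delta>" "g_x n" "\<lambda>s. (74 * s + 40) * g_x n s"] assms by auto
  have "(74 * t + 40) * g_x n t \<le> (74 * z + 40) * g_x n z"
    using z assms g_x_mono[of t z n] by (intro mult_mono) (auto simp: g_x_def)
  then show ?thesis using z assms by simp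
qed

text \<open>One insertion changes Q with an error of sqrt n times \<open>g_y\<close>, coefficient 1.
  The surplus 9/10 covers the inserted pair itself and the second-order term of q.\<close>

lemma h_q_growth:
  assumes "t \<ge> 0" "\<delta> > 0"
  shows "h_q n (t + \<delta>) - h_q n t \<ge> \<delta> * (19 / 10 * g_y n t)"
proof -
  define h' where "h' s = ((82 * s + 40) * (1 + s) - 1) / (20 * (1 + s)\<^sup>2) * g_y n s" for s
  have "(h_q n has_real_derivative h' s) (at s)" if "s \<ge> 0" for s
    unfolding h_q_def g_y_def h'_def using that
    by (auto intro!: derivative_eq_intros simp: divide_simps power2_eq_square) (simp add: algebra_simps)
  then obtain z where z: "z > t" "z < t + \<delta>" "h_q n (t + \<delta>) - h_q n t = \<delta> * h' z"
    using MVT2[of t "t + \<delta>" "h_q n" h'] assms by auto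
  have "0 \<le> z" "0 \<le> z * z" using z assms by auto
  then have "19 / 10 * (20 * (1 + z)\<^sup>2) \<le> (82 * z + 40) * (1 + z) - 1"
    by (simp add: power2_eq_square algebra_simps)
  then have "19 / 10 \<le> ((82 * z + 40) * (1 + z) - 1) / (20 * (1 + z)\<^sup>2)"
    using z assms by (subst pos_le_divide_eq) auto
  then have "19 / 10 * g_y n t \<le> h' z"
    unfolding h'_def using z assms g_y_mono[of t z n] by (intro mult_mono') (auto simp: g_y_def)
  then show ?thesis using z assms by simp
qed

lemma h_q_le_g_q: "t \<ge> 0 \<Longrightarrow> h_q n t \<le> g_q n t"
proof (cases "t \<le> 1")
  case True
  assume "t \<ge> 0"
  then have "g_y n t / (20 * (1 + t)) \<le> g_y n t / 1"
    by (intro divide_left_mono) (auto simp: g_y_def)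
  then show ?thesis using True by (simp add: h_q_def g_q_def g_y_def)
next
  case False
  then have "g_y n t / (20 * (1 + t)) \<le> g_y n t / t"
    by (intro divide_left_mono) (auto simp: g_y_def)
  then show ?thesis using False by (simp add: h_q_def g_q_def g_y_def)
qed

text \<open>D/Q - M/q0 = (D - M)/Q + M (q0 - Q)/(q0 Q), and 11h <= q0 gives Q >= 10 q0/11, the
  source of the factor 11/10.\<close>

lemma ratio_deviation:
  fixes Q q0 h D M B :: real
  assumes "\<bar>Q - q0\<bar> \<le> h" "11 * h \<le> q0" "q0 > 0" "\<bar>D - M\<bar> \<le> B"
  shows "\<bar>D / Q - M / q0\<bar> \<le> 11 / 10 * (B / q0 + \<bar>M\<bar> * h / q0\<^sup>2)"
proof -
  have Q: "Q \<ge> 10 / 11 * q0" using assms(1,2) by linarith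
  then have Qp: "Q > 0" using assms(3) by linarith
  have iQ: "1 / Q \<le> 11 / 10 / q0" using Q Qp assms(3) by (simp add: field_simps)
  have "D / Q - M / q0 = (D - M) * (1 / Q) + M * (q0 - Q) / q0 * (1 / Q)"
    using Qp assms(3) by (simp add: field_simps)
  also have "\<bar>\<dots>\<bar> \<le> \<bar>(D - M) * (1 / Q)\<bar> + \<bar>M * (q0 - Q) / q0 * (1 / Q)\<bar>" by (rule abs_triangle_ineq)
  also have "\<dots> = (\<bar>D - M\<bar> + \<bar>M\<bar> * \<bar>q0 - Q\<bar> / q0) * (1 / Q)"
    using Qp assms(3) by (simp add: abs_mult add_divide_distrib mult.commute)
  also have "\<dots> \<le> (B + \<bar>M\<bar> * h / q0) * (11 / 10 / q0)"
    using assms iQ Qp by (intro mult_mono add_mono divide_right_mono mult_left_mono) auto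
  also have "\<dots> = 11 / 10 * (B / q0 + \<bar>M\<bar> * h / q0\<^sup>2)"
    using assms(3) by (simp add: field_simps power2_eq_square)
  finally show ?thesis .
qed

text \<open>In the next two lemmas \<open>c\<close> stands for \<open>exp (- 4 * t\<^sup>2)\<close>, \<open>S\<close> for \<open>sqrt n\<close> and \<open>f\<close> for
  \<open>g_y n t\<close>, so that \<open>q = c / 2\<close>, \<open>y = 4 * t * c\<close>, \<open>x = c\<^sup>2\<close> and \<open>g_x = c * f\<close>.\<close>

lemma half_open_drift:
  fixes c t f S X A P D Q :: real
  assumes c: "0 < c" "c \<le> 1" and t: "0 \<le> t" "2 * t * c \<le> 1 / 2" and f: "0 < f" "f \<le> c / 22"
    and S: "0 < S" "1 / S \<le> c * f / 20"
    and X: "\<bar>X - S\<^sup>2 * c\<^sup>2\<bar> \<le> S\<^sup>2 * (c * f)"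
    and A: "\<bar>A - S * (2 * t * c)\<bar> \<le> S * f / 2" "0 \<le> A"
    and P: "\<bar>P - A * (S * (4 * t * c))\<bar> \<le> A * (S * f)"
    and D: "\<bar>D - (X - P)\<bar> \<le> A"
    and Q: "\<bar>Q - S ^ 4 * (c / 2)\<bar> \<le> S ^ 4 * (f / (20 * (1 + t)))"
  shows "\<bar>D / Q - (2 - 16 * t\<^sup>2) * c / S\<^sup>2\<bar> \<le> (3 + 11 * t) * f / S\<^sup>2"
proof -
  \<comment> \<open>The gain is about S^2 c^2 and the loss about 2tcS times 4tcS. Divided by S^4 c/2
    the difference becomes the derivative of y/2, namely (2 - 16t^2) c, over n.\<close>
  define M where "M = S\<^sup>2 * (c\<^sup>2 - 8 * t\<^sup>2 * c\<^sup>2)"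
  \<comment> \<open>11/10 rounds up 1 + 1/20 + 1/44: the shares of X, of the count A and of the
    product of two deviations. The 4t comes from the loss P.\<close>
  define B where "B = S\<^sup>2 * (c * f) * (11 / 10 + 4 * t)"
  let ?h = "S ^ 4 * (f / (20 * (1 + t)))" and ?q = "S ^ 4 * (c / 2)"
  have Ale: "A \<le> S * (2 * t * c + f / 2)" unfolding distrib_left using A(1) by linarith
  also have "\<dots> \<le> S * 1" using t f c S by (intro mult_left_mono) auto
  also have "S * 1 = S\<^sup>2 * (1 / S)" using S by (simp add: power2_eq_square)
  also have "\<dots> \<le> S\<^sup>2 * (c * f / 20)" using S by (intro mult_left_mono) auto
  finally have AS: "A \<le> S\<^sup>2 * (c * f / 20)" .
  have ff: "f * f \<le> c * f / 22" using f by (simp add: mult_right_mono)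
  have "\<bar>P - S\<^sup>2 * (8 * t\<^sup>2 * c\<^sup>2)\<bar> \<le> \<bar>P - A * (S * (4 * t * c))\<bar> + \<bar>(A - S * (2 * t * c)) * (S * (4 * t * c))\<bar>"
    by (rule order_trans[OF _ abs_triangle_ineq]) (simp add: algebra_simps power2_eq_square)
  also have "\<dots> \<le> A * (S * f) + S * f / 2 * (S * (4 * t * c))"
    unfolding abs_mult using P A t c S f by (intro add_mono mult_mono) auto
  also have "\<dots> \<le> S * (2 * t * c + f / 2) * (S * f) + S * f / 2 * (S * (4 * t * c))"
    using Ale S f by (intro add_right_mono mult_right_mono) auto
  also have "\<dots> = S\<^sup>2 * (4 * t * (c * f) + f * f / 2)" by (simp add: algebra_simps power2_eq_square)
  also have "\<dots> \<le> S\<^sup>2 * (4 * t * (c * f) + c * f / 44)" using ff by (intro mult_left_mono) auto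
  finally have P': "\<bar>P - S\<^sup>2 * (8 * t\<^sup>2 * c\<^sup>2)\<bar> \<le> S\<^sup>2 * (4 * t * (c * f) + c * f / 44)" .
  have "\<bar>D - M\<bar> \<le> \<bar>D - (X - P)\<bar> + \<bar>X - S\<^sup>2 * c\<^sup>2\<bar> + \<bar>P - S\<^sup>2 * (8 * t\<^sup>2 * c\<^sup>2)\<bar>"
    unfolding M_def by (simp add: right_diff_distrib)
  also have "\<dots> \<le> S\<^sup>2 * (c * f / 20) + S\<^sup>2 * (c * f) + S\<^sup>2 * (4 * t * (c * f) + c * f / 44)"
    using D AS X P' by linarith
  also have "\<dots> = S\<^sup>2 * (c * f) * (1 / 20 + 1 + 4 * t + 1 / 44)" by (simp add: algebra_simps)
  also have "\<dots> \<le> B" unfolding B_def using S c f by (intro mult_left_mono) auto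
  finally have DM: "\<bar>D - M\<bar> \<le> B" .
  have "f / (20 * (1 + t)) \<le> f / 1" using f t by (intro divide_left_mono) auto
  then have "11 * (f / (20 * (1 + t))) \<le> c / 2" using f by linarith
  from mult_left_mono[OF this, of "S ^ 4"] have hq: "11 * ?h \<le> ?q" using S by (simp add: algebra_simps)
  have "\<bar>D / Q - M / ?q\<bar> \<le> 11 / 10 * (B / ?q + \<bar>M\<bar> * ?h / ?q\<^sup>2)"
    by (rule ratio_deviation[OF Q hq _ DM]) (use S c in auto)
  also have "M / ?q = (2 - 16 * t\<^sup>2) * c / S\<^sup>2"
    using S c unfolding M_def by (simp add: field_simps power2_eq_square power4_eq_xxxx)
  also have "11 / 10 * (B / ?q + \<bar>M\<bar> * ?h / ?q\<^sup>2) \<le> (3 + 11 * t) * f / S\<^sup>2"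
  proof -
    have "\<bar>M\<bar> = S\<^sup>2 * c\<^sup>2 * \<bar>1 - 8 * t\<^sup>2\<bar>"
    proof -
      have "M = S\<^sup>2 * c\<^sup>2 * (1 - 8 * t\<^sup>2)" by (simp add: M_def algebra_simps)
      then show ?thesis by (simp add: abs_mult)
    qed
    also have "\<dots> \<le> S\<^sup>2 * c\<^sup>2 * (1 + 8 * t\<^sup>2)"
      using zero_le_power2[of t] by (intro mult_left_mono) (simp_all add: abs_le_iff)
    \<comment> \<open>The factor 1 + t is split off in order to cancel the denominator of the
      tolerance for Q.\<close>
    also have "\<dots> \<le> S\<^sup>2 * c\<^sup>2 * ((1 + 8 * t) * (1 + t))"
    proof (rule mult_left_mono)
      show "1 + 8 * t\<^sup>2 \<le> (1 + 8 * t) * (1 + t)" using t by (simp add: algebra_simps power2_eq_square)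
    qed simp
    finally have "\<bar>M\<bar> * ?h / ?q\<^sup>2 \<le> S\<^sup>2 * c\<^sup>2 * ((1 + 8 * t) * (1 + t)) * ?h / ?q\<^sup>2"
      using f t S by (intro divide_right_mono mult_right_mono) auto
    also have "\<dots> = (1 + 8 * t) / 5 * (f / S\<^sup>2)"
    proof -
      have "1 + t \<noteq> 0" "c \<noteq> 0" "S \<noteq> 0" using t c S by auto
      then show ?thesis by (simp add: divide_simps power2_eq_square power4_eq_xxxx)
    qed
    finally have 1: "\<bar>M\<bar> * ?h / ?q\<^sup>2 \<le> (1 + 8 * t) / 5 * (f / S\<^sup>2)" .
    have 2: "B / ?q = (22 / 10 + 8 * t) * (f / S\<^sup>2)"
      using S c unfolding B_def by (simp add: divide_simps power2_eq_square power4_eq_xxxx)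
    have "11 / 10 * (B / ?q + \<bar>M\<bar> * ?h / ?q\<^sup>2)
        \<le> 11 / 10 * ((22 / 10 + 8 * t) * (f / S\<^sup>2) + (1 + 8 * t) / 5 * (f / S\<^sup>2))"
      unfolding 2 using 1 by (intro mult_left_mono add_left_mono) auto
    also have "\<dots> = 11 / 10 * ((22 / 10 + 8 * t) + (1 + 8 * t) / 5) * (f / S\<^sup>2)"
      by (simp only: distrib_left distrib_right mult.assoc)
    also have "\<dots> \<le> (3 + 11 * t) * (f / S\<^sup>2)"
    proof (rule mult_right_mono)
      show "11 / 10 * ((22 / 10 + 8 * t) + (1 + 8 * t) / 5) \<le> 3 + 11 * t" using t by (simp add: field_simps)
    qed (use f S in auto)
    finally show ?thesis by simp
  qed
  finally show ?thesis .
qed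

lemma both_open_drift:
  fixes c t f S X P D Q z :: real
  assumes c: "0 < c" "c \<le> 1" and t: "0 \<le> t" and f: "0 < f" "f \<le> c / 22"
    and S: "0 < S" and z: "0 \<le> z" "2 + z \<le> S * (f / 10)"
    and X: "\<bar>X - S\<^sup>2 * c\<^sup>2\<bar> \<le> S\<^sup>2 * (c * f)" "0 \<le> X"
    and P: "\<bar>P - X * (2 * (S * (4 * t * c)))\<bar> \<le> X * (2 * (S * f))"
    and D: "\<bar>D - P\<bar> \<le> X * (2 + z)"
    and Q: "\<bar>Q - S ^ 4 * (c / 2)\<bar> \<le> S ^ 4 * (f / (20 * (1 + t)))"
  shows "\<bar>D / Q - 16 * t * c\<^sup>2 / S\<bar> \<le> (7 + 18 * t) * (c * f) / S"
proof -
  \<comment> \<open>About S^2 c^2 vertices, each lost through about 8tcS pairs. Divided by S^4 c/2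
    this is -x'/S.\<close>
  define M where "M = 8 * S ^ 3 * t * c ^ 3"
  \<comment> \<open>22/10 rounds up 483/220, the product of 23/22 for the size of X and 21/10 for
    the error per vertex.\<close>
  define B where "B = S ^ 3 * c\<^sup>2 * f * (22 / 10 + 8 * t)"
  let ?h = "S ^ 4 * (f / (20 * (1 + t)))" and ?q = "S ^ 4 * (c / 2)"
  have cf: "c * f \<le> c * (c / 22)" using f c by (intro mult_left_mono) auto
  have "X \<le> S\<^sup>2 * (c\<^sup>2 + c * f)" using X by (simp add: algebra_simps)
  also have "\<dots> \<le> S\<^sup>2 * (c\<^sup>2 * (23 / 22))"
    using cf by (intro mult_left_mono) (auto simp: power2_eq_square)
  finally have Xle: "X \<le> S\<^sup>2 * (c\<^sup>2 * (23 / 22))" .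
  have "\<bar>D - M\<bar> \<le> \<bar>D - P\<bar> + \<bar>P - X * (2 * (S * (4 * t * c)))\<bar> + \<bar>(X - S\<^sup>2 * c\<^sup>2) * (8 * S * t * c)\<bar>"
  proof -
    have "D - M = (D - P) + (P - X * (2 * (S * (4 * t * c)))) + (X - S\<^sup>2 * c\<^sup>2) * (8 * S * t * c)"
      unfolding M_def by (simp add: algebra_simps power2_eq_square power3_eq_cube)
    then show ?thesis by linarith
  qed
  also have "\<dots> \<le> X * (2 + z) + X * (2 * (S * f)) + S\<^sup>2 * (c * f) * (8 * S * t * c)"
    unfolding abs_mult[of "X - S\<^sup>2 * c\<^sup>2"] using D P X t c S by (intro add_mono mult_mono) auto
  also have "\<dots> \<le> X * (S * (f / 10)) + X * (2 * (S * f)) + S\<^sup>2 * (c * f) * (8 * S * t * c)"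
    using mult_left_mono[OF z(2) X(2)] by linarith
  also have "\<dots> = X * (S * f * (21 / 10)) + S\<^sup>2 * (c * f) * (8 * S * t * c)" by (simp add: algebra_simps)
  also have "\<dots> \<le> S\<^sup>2 * (c\<^sup>2 * (23 / 22)) * (S * f * (21 / 10)) + S\<^sup>2 * (c * f) * (8 * S * t * c)"
    using Xle S f by (intro add_right_mono mult_right_mono) auto
  also have "\<dots> = S ^ 3 * c\<^sup>2 * f * (483 / 220 + 8 * t)"
    by (simp add: algebra_simps power2_eq_square power3_eq_cube)
  also have "\<dots> \<le> B" unfolding B_def using S c f by (intro mult_left_mono) auto
  finally have DM: "\<bar>D - M\<bar> \<le> B" .
  have "f / (20 * (1 + t)) \<le> f / 1" using f t by (intro divide_left_mono) auto
  then have "11 * (f / (20 * (1 + t))) \<le> c / 2" using f by linarith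
  from mult_left_mono[OF this, of "S ^ 4"] have hq: "11 * ?h \<le> ?q" using S by (simp add: algebra_simps)
  have nz: "1 + t \<noteq> 0" "c \<noteq> 0" "S \<noteq> 0" using t c S by auto
  have "\<bar>D / Q - M / ?q\<bar> \<le> 11 / 10 * (B / ?q + \<bar>M\<bar> * ?h / ?q\<^sup>2)"
    by (rule ratio_deviation[OF Q hq _ DM]) (use S c in auto)
  also have "M / ?q = 16 * t * c\<^sup>2 / S"
    using nz unfolding M_def by (simp add: divide_simps power2_eq_square power3_eq_cube power4_eq_xxxx)
  also have "11 / 10 * (B / ?q + \<bar>M\<bar> * ?h / ?q\<^sup>2) \<le> (7 + 18 * t) * (c * f) / S"
  proof -
    have "\<bar>M\<bar> = M" unfolding M_def using S t c by simp
    also have "M \<le> 8 * S ^ 3 * (1 + t) * c ^ 3"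
      unfolding M_def using S c by (intro mult_right_mono mult_left_mono) auto
    finally have "\<bar>M\<bar> * ?h / ?q\<^sup>2 \<le> 8 * S ^ 3 * (1 + t) * c ^ 3 * ?h / ?q\<^sup>2"
      using f t S by (intro divide_right_mono mult_right_mono) auto
    also have "\<dots> = 8 / 5 * (c * f / S)"
      using nz by (simp add: divide_simps power2_eq_square power3_eq_cube power4_eq_xxxx)
    finally have 1: "\<bar>M\<bar> * ?h / ?q\<^sup>2 \<le> 8 / 5 * (c * f / S)" .
    have 2: "B / ?q = (44 / 10 + 16 * t) * (c * f / S)"
      using nz unfolding B_def
      by (simp add: divide_simps power2_eq_square power3_eq_cube power4_eq_xxxx)
    have "11 / 10 * (B / ?q + \<bar>M\<bar> * ?h / ?q\<^sup>2)
        \<le> 11 / 10 * ((44 / 10 + 16 * t) * (c * f / S) + 8 / 5 * (c * f / S))"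
      unfolding 2 using 1 by (intro mult_left_mono add_left_mono) auto
    also have "\<dots> = 11 / 10 * ((44 / 10 + 16 * t) + 8 / 5) * (c * f / S)"
      by (simp only: distrib_left distrib_right mult.assoc)
    also have "\<dots> \<le> (7 + 18 * t) * (c * f / S)"
      using t f S c by (intro mult_right_mono) auto
    finally show ?thesis by simp
  qed
  finally show ?thesis .
qed

section \<open>One step from a state that follows the trajectory\<close>

text \<open>Separates the analysis of one step from the choice of potential. z is the codegree cap;
  the hypotheses from \<open>g_le\<close> on are numerical and hold up to step m for large
  n.\<close>

locale tracked_state = triangle_free_graph "{..<n}" E for n :: nat and E :: "nat set set" +
  fixes t z :: real
  assumes t_nonneg: "0 \<le> t" and z_nonneg: "0 \<le> z"
    and Q_dev: "\<bar>real (card (open_pairs {..<n} E)) - (real n)\<^sup>2 * q_fun t\<bar> \<le> (real n)\<^sup>2 * h_q n t"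
    and half_dev: "\<And>u v. u < n \<Longrightarrow> v < n \<Longrightarrow> u \<noteq> v \<Longrightarrow> {u, v} \<notin> E \<Longrightarrow>
      \<bar>real (card (half_open {..<n} E u v)) - sqrt n * (y_fun t / 2)\<bar> \<le> sqrt n * g_y n t / 2"
    and both_dev: "\<And>u v. u < n \<Longrightarrow> v < n \<Longrightarrow> u \<noteq> v \<Longrightarrow> {u, v} \<notin> E \<Longrightarrow>
      \<bar>real (card (both_open {..<n} E u v)) - n * x_fun t\<bar> \<le> n * g_x n t"
    and codegree: "\<And>u v. u < n \<Longrightarrow> v < n \<Longrightarrow> u \<noteq> v \<Longrightarrow> {u, v} \<notin> E \<Longrightarrow>
      real (card (both_edge {..<n} E u v)) \<le> z"
    and g_le: "g_y n t \<le> exp (- 4 * t\<^sup>2) / 22"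
    and sqrt_ge: "1 / sqrt n \<le> exp (- 4 * t\<^sup>2) * g_y n t / 20"
    and z_le: "2 + z \<le> sqrt n * (g_y n t / 10)"
    and n_ge: "n \<ge> 400"
begin

abbreviation "S \<equiv> sqrt (real n)"
abbreviation "c \<equiv> exp (- 4 * t\<^sup>2)"
abbreviation "f \<equiv> g_y n t"
abbreviation "\<delta> \<equiv> real n powr (-3/2)"
abbreviation "V \<equiv> {..<n}"

lemma S_pos: "S \<ge> 20"
  using n_ge by (simp add: real_le_rsqrt)

lemma S_sq: "S\<^sup>2 = n" "S * S = n" "S ^ 4 = (real n)\<^sup>2" "S ^ 3 = n * S"
  by (simp_all add: power4_eq_xxxx power2_eq_square power3_eq_cube)

lemma delta: "\<delta> > 0" "S * \<delta> = 1 / n" "n * \<delta> = 1 / S" "(real n)\<^sup>2 * \<delta> = S" "\<delta> * (n * S) = 1"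
    "S * \<delta>\<^sup>2 * n = \<delta>" "(real n)\<^sup>2 * \<delta>\<^sup>2 = 1 / n" "n * \<delta>\<^sup>2 * S = \<delta>"
proof -
  have S: "S > 0" using S_pos by linarith
  have "\<delta> = 1 / (real n powr 1 * real n powr (1/2))"
    using n_ge by (subst powr_add[symmetric]) (simp_all add: powr_minus_divide)
  then have d: "\<delta> = 1 / (n * S)" using n_ge by (simp add: powr_half_sqrt)
  show "\<delta> > 0" using n_ge by simp
  show "S * \<delta> = 1 / n" "n * \<delta> = 1 / S" "(real n)\<^sup>2 * \<delta> = S" "\<delta> * (n * S) = 1"
    "S * \<delta>\<^sup>2 * n = \<delta>" "(real n)\<^sup>2 * \<delta>\<^sup>2 = 1 / n" "n * \<delta>\<^sup>2 * S = \<delta>"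
    using S n_ge S_sq(2) unfolding d by (simp_all add: divide_simps power2_eq_square)
qed

lemma c_bounds: "0 < c" "c \<le> 1"
  by simp_all

lemma f_bounds: "0 < f" "f \<le> 1 / 22"
proof -
  show "0 < f" using n_ge by (simp add: g_y_def)
  show "f \<le> 1 / 22" using g_le c_bounds by linarith
qed

lemma fun_eqs: "q_fun t = c / 2" "y_fun t = 4 * t * c" "x_fun t = c\<^sup>2" "g_x n t = c * f"
proof -
  show "x_fun t = c\<^sup>2" by (simp add: x_fun_def flip: exp_double)
  have "g_x n t = exp (- 4 * t\<^sup>2 + (41 * t\<^sup>2 + 40 * t)) * real n powr (-1/6)"
    by (simp add: g_x_def)
  then show "g_x n t = c * f" by (subst (asm) exp_add) (simp add: g_y_def)
qed (simp_all add: q_fun_def y_fun_def)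

lemma tc_le: "0 \<le> t * c" "4 * (t * c) \<le> 1"
  using exp_square_le_1(4)[OF t_nonneg] t_nonneg by simp_all

lemma Q_dev': "\<bar>real (card Op) - S ^ 4 * (c / 2)\<bar> \<le> S ^ 4 * (f / (20 * (1 + t)))"
  using Q_dev by (simp add: S_sq fun_eqs h_q_def)

lemma Q_ge: "real (card Op) \<ge> (real n)\<^sup>2 * c / 3"
proof -
  have "f / (20 * (1 + t)) \<le> f / 1" using f_bounds t_nonneg by (intro divide_left_mono) auto
  then have "c / 3 \<le> c / 2 - f / (20 * (1 + t))" using g_le c_bounds by linarith
  then have "(real n)\<^sup>2 * (c / 3) \<le> (real n)\<^sup>2 * (c / 2 - f / (20 * (1 + t)))" by (intro mult_left_mono) auto
  then show ?thesis using Q_dev' unfolding S_sq right_diff_distrib by linarith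
qed

lemma Q_pos: "real (card Op) > 0" "Op \<noteq> {}"
proof -
  have "0 < (real n)\<^sup>2 * c / 3" using n_ge by simp
  then show "real (card Op) > 0" using Q_ge by linarith
  then show "Op \<noteq> {}" by auto
qed

text \<open>Phrased for arbitrary natural numbers because \<open>both_loss_le\<close> asks for a
  bound over all nonadjacent a and b; outside \<open>{..<n}\<close> the set is empty.\<close>

lemma half_le:
  assumes "u \<noteq> v" "{u, v} \<notin> E"
  shows "real (card (half_open V E u v)) \<le> S"
proof (cases "u < n \<and> v < n")
  case True
  then have "\<bar>real (card (half_open V E u v)) - S * (4 * t * c / 2)\<bar> \<le> S * f / 2"
    using half_dev[of u v] assms unfolding fun_eqs by auto
  moreover have "S * (2 * (t * c) + f / 2) = S * (4 * t * c / 2) + S * f / 2" by (simp add: distrib_left)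
  ultimately have "real (card (half_open V E u v)) \<le> S * (2 * (t * c) + f / 2)" by linarith
  also have "\<dots> \<le> S * 1" using f_bounds tc_le by (intro mult_left_mono) auto
  finally show ?thesis by simp
next
  case False
  then have "w \<notin> half_open V E u v" for w
    using edgeD[of v w] by (auto simp: half_iff open_iff)
  then have "half_open V E u v = {}" by blast
  then show ?thesis by simp
qed

lemma both_le: "real (card (both_open V E u v)) \<le> n"
  using card_mono[of V "both_open V E u v"] by (auto simp: both_open_def)

text \<open>The cap on nonadjacent pairs extends to all pairs, since adjacent vertices of a
  triangle-free graph have no common neighbour.\<close>

lemma both_edge_le:
  assumes "u \<noteq> v"
  shows "card (both_edge V E u v) \<le> nat \<lfloor>z\<rfloor>"
proof -
  have "real (card (both_edge V E u v)) \<le> z"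
  proof (cases "u < n \<and> v < n \<and> {u, v} \<notin> E")
    case True
    then show ?thesis using codegree assms by blast
  next
    case False
    then have "w \<notin> both_edge V E u v" for w
      using edgeD[of v w] edgeD[of u w] assms edge_triangle[of u v w] by (auto simp: both_edge_iff)
    then have "both_edge V E u v = {}" by blast
    then show ?thesis using z_nonneg by simp
  qed
  then show ?thesis by (simp add: le_nat_floor)
qed

lemma closers_dev:
  assumes "u < n" "v < n" "u \<noteq> v" "{u, v} \<notin> E"
  shows "\<bar>real (card (closers V E u v)) - S * (4 * t * c)\<bar> \<le> S * f"
proof -
  have "{v, u} \<notin> E" using assms(4) by (simp add: insert_commute)
  then have "\<bar>real (card (half_open V E u v)) - S * (4 * t * c / 2)\<bar> \<le> S * f / 2"
    "\<bar>real (card (half_open V E v u)) - S * (4 * t * c / 2)\<bar> \<le> S * f / 2"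
    using half_dev[of u v] half_dev[of v u] assms unfolding fun_eqs by auto
  moreover have "S * (4 * t * c) = S * (4 * t * c / 2) + S * (4 * t * c / 2)" by simp
  ultimately show ?thesis unfolding card_closers[OF assms(3)] of_nat_add by linarith
qed

lemma closers_le:
  assumes "u \<noteq> v" "{u, v} \<notin> E"
  shows "real (card (closers V E u v)) \<le> 2 * S"
  using half_le[OF assms] half_le[of v u] assms card_closers[OF assms(1)] by (simp add: insert_commute)

text \<open>True for every single e, without averaging: all open pairs have nearly the same number
  of closers, so the loss of Q is deterministic up to an error that the growth of \<open>h_q\<close>
  exceeds.\<close>

lemma step_Q:
  assumes e: "e \<in> Op"
  shows "\<bar>real (card (open_pairs V (insert e E))) - (real n)\<^sup>2 * q_fun (t + \<delta>)\<bar> - (real n)\<^sup>2 * h_q n (t + \<delta>)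
    \<le> \<bar>real (card Op) - (real n)\<^sup>2 * q_fun t\<bar> - (real n)\<^sup>2 * h_q n t"
proof -
  obtain u v where uv: "e = {u, v}" "u \<in> V" "v \<in> V" "u \<noteq> v" using e by (rule openE)
  have nE: "{u, v} \<notin> E" using e uv by (simp add: open_iff)
  have "real (card Op) = real (card (open_pairs V (insert e E))) + 1 + real (card (closers V E u v))"
    using card_open_insert[of u v] e uv by simp
  moreover have "\<bar>real (card (closers V E u v)) - S * y_fun t\<bar> \<le> S * f"
    using closers_dev[of u v] uv nE by (simp add: fun_eqs)
  moreover have "\<bar>(real n)\<^sup>2 * q_fun (t + \<delta>) - (real n)\<^sup>2 * q_fun t + S * y_fun t\<bar> \<le> 1"
  proof -
    have "(real n)\<^sup>2 * q_fun (t + \<delta>) - (real n)\<^sup>2 * q_fun t + S * y_fun t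
        = (real n)\<^sup>2 * (q_fun (t + \<delta>) - q_fun t + \<delta> * y_fun t)"
      using delta(4) by (simp add: right_diff_distrib distrib_left flip: mult.assoc)
    also have "\<bar>\<dots>\<bar> \<le> (real n)\<^sup>2 * (400 * \<delta>\<^sup>2)"
      using q_second_order[OF t_nonneg delta(1)] by (simp add: abs_mult mult_left_mono)
    also have "\<dots> = 400 * ((real n)\<^sup>2 * \<delta>\<^sup>2)" by simp
    also have "\<dots> \<le> 1" unfolding delta(7) using n_ge by simp
    finally show ?thesis .
  qed
  moreover have "(real n)\<^sup>2 * h_q n (t + \<delta>) - (real n)\<^sup>2 * h_q n t \<ge> 19 / 10 * (S * f)"
  proof -
    have "(real n)\<^sup>2 * (\<delta> * (19 / 10 * f)) \<le> (real n)\<^sup>2 * (h_q n (t + \<delta>) - h_q n t)"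
      using h_q_growth[OF t_nonneg delta(1)] by (intro mult_left_mono) auto
    also have "(real n)\<^sup>2 * (\<delta> * (19 / 10 * f)) = ((real n)\<^sup>2 * \<delta>) * (19 / 10 * f)" by (simp only: mult.assoc)
    finally show ?thesis unfolding delta(4) right_diff_distrib by linarith
  qed
  moreover have "S * f \<ge> 20" using z_le z_nonneg by simp
  ultimately show ?thesis by linarith
qed

text \<open>The sign \<sigma> treats upper and lower deviations together. The rate l has to be so
  small that l times the second moment and the Taylor error fit into a share f/n of the growth of
  the tolerance.\<close>

lemma step_half:
  assumes uv: "u < n" "v < n" "u \<noteq> v" "{u, v} \<notin> E" and \<sigma>: "\<bar>\<sigma>\<bar> = (1 :: real)"
    and l: "0 < l" "l * (3 + z) \<le> 1" "l * (12 * (3 + z) / c) + 400 * \<delta> \<le> f"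
  shows "(\<Sum>e\<in>Op - {{u, v}}. exp (l * (\<sigma> * (real (card (half_open V (insert e E) u v)) - S * (y_fun (t + \<delta>) / 2))
            - S * g_y n (t + \<delta>) / 2))) / card Op
     \<le> exp (l * (\<sigma> * (real (card (half_open V E u v)) - S * (y_fun t / 2)) - S * f / 2))"
proof -
  define g where "g e = real (card {w \<in> both_open V E u v. e = {v, w}})" for e
  define lo where "lo e = real (card {w \<in> half_open V E u v. e = {u, w} \<or> e \<in> closers V E u w})" for e
  \<comment> \<open>Inserting {u, v} ends the tracking of this pair, so that insertion is given
    increment 0.\<close>
  define d where "d e = (if e = {u, v} then 0 else \<sigma> * (g e - lo e))" for e
  define A where "A = real (card (half_open V E u v))"
  define X where "X = real (card (both_open V E u v))"
  define P where "P = (\<Sum>w\<in>half_open V E u v. real (card (closers V E u w)))"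
  define r where "r = S * (\<sigma> * (y_fun (t + \<delta>) / 2 - y_fun t / 2) + (g_y n (t + \<delta>) - f) / 2)"
  define D where "D = (\<Sum>e\<in>Op. if e = {u, v} then 0 else g e - lo e)"
  let ?Q = "real (card Op)"
  have sum_g: "(\<Sum>e\<in>Op. g e) = X"
    unfolding g_def X_def of_nat_sum[symmetric] sum_gain[of u v] ..
  have sum_lo: "(\<Sum>e\<in>Op. lo e) = A + P"
  proof -
    have "(\<Sum>e\<in>Op. lo e) = real (\<Sum>w\<in>half_open V E u v. 1 + card (closers V E u w))"
      unfolding lo_def of_nat_sum[symmetric] sum_half_loss[of u v] ..
    then show ?thesis by (simp add: A_def P_def sum.distrib)
  qed
  have g_nonneg: "0 \<le> g e" and lo_nonneg: "0 \<le> lo e" for e by (simp_all add: g_def lo_def)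
  have lo_uv: "lo {u, v} \<le> A"
    unfolding lo_def A_def of_nat_le_iff by (intro card_mono) auto
  have g_uv: "g {u, v} = 0"
    unfolding g_def using uv by (auto simp: both_iff doubleton_eq_iff open_iff)
  have gain_le: "g e \<le> 1" for e
    unfolding g_def using gain_le_1[where u = u and v = v and e = e] by linarith
  have lo_le: "lo e \<le> 2 + z" if "e \<in> Op" "e \<noteq> {u, v}" for e
  proof -
    have "lo e \<le> real (2 + nat \<lfloor>z\<rfloor>)"
      unfolding lo_def of_nat_le_iff by (rule half_loss_le[OF that both_edge_le])
    then show ?thesis using z_nonneg by (simp add: of_nat_nat) linarith
  qed
  have A_nonneg: "0 \<le> A" and X_nonneg: "0 \<le> X" by (simp_all add: A_def X_def)
  have P_nonneg: "0 \<le> P" unfolding P_def by (intro sum_nonneg) auto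
  have D_dev: "\<bar>D - (X - P)\<bar> \<le> A"
  proof (cases "{u, v} \<in> Op")
    case True
    have "(\<Sum>e\<in>Op. g e - lo e) = (g {u, v} - lo {u, v}) + D"
      unfolding D_def using True by (subst (1 2) sum.remove[OF finite_Op True]) auto
    then have "X - (A + P) = - lo {u, v} + D"
      using sum_g sum_lo g_uv by (simp add: sum_subtractf)
    then show ?thesis using lo_uv lo_nonneg[of "{u, v}"] A_nonneg by linarith
  next
    case False
    then have "D = (\<Sum>e\<in>Op. g e - lo e)" unfolding D_def by (intro sum.cong) auto
    then show ?thesis using sum_g sum_lo A_nonneg by (simp add: sum_subtractf)
  qed
  have inner: "\<bar>real (card (closers V E u w)) - S * (4 * t * c)\<bar> \<le> S * f"
    "real (card (closers V E u w)) \<le> 2 * S" if "w \<in> half_open V E u v" for w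
    using that closers_dev[of u w] closers_le[of u w] by (auto simp: half_iff open_iff)
  have P_dev: "\<bar>P - A * (S * (4 * t * c))\<bar> \<le> A * (S * f)"
  proof -
    have eq: "P - A * (S * (4 * t * c)) = (\<Sum>w\<in>half_open V E u v. real (card (closers V E u w)) - S * (4 * t * c))"
      by (simp add: P_def A_def sum_subtractf)
    have "\<bar>P - A * (S * (4 * t * c))\<bar> \<le> (\<Sum>w\<in>half_open V E u v. \<bar>real (card (closers V E u w)) - S * (4 * t * c)\<bar>)"
      unfolding eq by (rule sum_abs)
    also have "\<dots> \<le> A * (S * f)"
      unfolding A_def by (rule sum_bounded_above) (rule inner)
    finally show ?thesis .
  qed
  have AS: "A \<le> S" unfolding A_def by (rule half_le[OF uv(3,4)])
  have P_le: "P \<le> 2 * real n"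
  proof -
    have "P \<le> A * (2 * S)" unfolding P_def A_def by (rule sum_bounded_above) (rule inner)
    also have "\<dots> \<le> S * (2 * S)" using AS S_pos by (intro mult_right_mono) auto
    also have "\<dots> = 2 * (S * S)" by (simp only: mult.left_commute)
    finally show ?thesis unfolding S_sq(2) .
  qed
  have D_bound: "\<bar>D / ?Q - (2 - 16 * t\<^sup>2) * c / S\<^sup>2\<bar> \<le> (3 + 11 * t) * f / S\<^sup>2"
  proof (rule half_open_drift[OF c_bounds t_nonneg _ f_bounds(1) g_le _ sqrt_ge, where X = X and A = A and P = P])
    show "\<bar>X - S\<^sup>2 * c\<^sup>2\<bar> \<le> S\<^sup>2 * (c * f)" using both_dev[OF uv] by (simp add: X_def fun_eqs S_sq)
    show "\<bar>A - S * (2 * t * c)\<bar> \<le> S * f / 2" using half_dev[OF uv] by (simp add: A_def fun_eqs mult.assoc)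
  qed (use tc_le n_ge A_nonneg P_dev D_dev Q_dev' in auto)
  have d_le: "\<bar>d e\<bar> \<le> 3 + z" "\<bar>d e\<bar> \<le> g e + lo e" if "e \<in> Op" for e
  proof -
    have "\<bar>d e\<bar> \<le> 3 + z \<and> \<bar>d e\<bar> \<le> g e + lo e"
    proof (cases "e = {u, v}")
      case True
      then show ?thesis using g_nonneg[of e] lo_nonneg[of e] z_nonneg by (simp add: d_def)
    next
      case False
      then have "\<bar>d e\<bar> = \<bar>g e - lo e\<bar>" using \<sigma> by (simp add: d_def abs_mult)
      then show ?thesis
        using gain_le[of e] lo_le[OF that False] g_nonneg[of e] lo_nonneg[of e] by linarith
    qed
    then show "\<bar>d e\<bar> \<le> 3 + z" "\<bar>d e\<bar> \<le> g e + lo e" by auto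
  qed
  \<comment> \<open>One factor of the square is bounded by the largest jump and the other by gain
    plus loss, so the second moment reduces to the sums already computed.\<close>
  have "(\<Sum>e\<in>Op. (d e)\<^sup>2) \<le> (\<Sum>e\<in>Op. (3 + z) * (g e + lo e))"
  proof (rule sum_mono)
    fix e assume "e \<in> Op"
    then have "\<bar>d e\<bar> * \<bar>d e\<bar> \<le> (3 + z) * (g e + lo e)"
      using d_le z_nonneg by (intro mult_mono) auto
    then show "(d e)\<^sup>2 \<le> (3 + z) * (g e + lo e)" by (simp add: power2_eq_square)
  qed
  also have "\<dots> = (3 + z) * (X + A + P)"
    using sum_g sum_lo by (simp add: sum_distrib_left[symmetric] sum.distrib)
  also have "\<dots> \<le> (3 + z) * (4 * n)"
  proof (rule mult_left_mono)
    have "S * 1 \<le> S * S" using n_ge by (intro mult_left_mono) auto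
    then show "X + A + P \<le> 4 * n" using both_le[of u v] AS P_le S_sq(2) unfolding X_def by simp
  qed (use z_nonneg in simp)
  finally have d2: "(\<Sum>e\<in>Op. (d e)\<^sup>2) \<le> (3 + z) * (4 * n)" .
  have "(\<Sum>e\<in>Op. (d e)\<^sup>2) / ?Q \<le> (3 + z) * (4 * n) / ((real n)\<^sup>2 * c / 3)"
    by (rule frac_le[OF _ d2 _ Q_ge]) (use z_nonneg n_ge in auto)
  also have "\<dots> = 12 * (3 + z) / c / n" using n_ge by (simp add: divide_simps power2_eq_square)
  finally have d2': "(\<Sum>e\<in>Op. (d e)\<^sup>2) / ?Q \<le> 12 * (3 + z) / c / n" .
  have sum_d: "(\<Sum>e\<in>Op. d e) = \<sigma> * D"
    unfolding D_def d_def sum_distrib_left by (intro sum.cong) auto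
  have \<sigma>_mult: "\<sigma> * x \<le> \<bar>x\<bar>" for x
    using abs_ge_self[of "\<sigma> * x"] \<sigma> by (simp add: abs_mult)
  have "\<sigma> * D / ?Q - \<sigma> * ((2 - 16 * t\<^sup>2) * c / n) \<le> (3 + 11 * t) * f / n"
    using \<sigma>_mult[of "D / ?Q - (2 - 16 * t\<^sup>2) * c / S\<^sup>2"] D_bound by (simp add: S_sq right_diff_distrib)
  moreover have "r \<ge> \<sigma> * ((2 - 16 * t\<^sup>2) * c / n) - 400 * \<delta> / n + (41 * t + 20) * f / n"
  proof -
    have "S * (g_y n (t + \<delta>) - f) / 2 \<ge> S * (\<delta> * ((82 * t + 40) * f)) / 2"
      using g_y_growth[OF t_nonneg delta(1), of n] S_pos by (intro divide_right_mono mult_left_mono) auto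
    also have "S * (\<delta> * ((82 * t + 40) * f)) / 2 = (41 * t + 20) * f / n"
    proof -
      have "S * (\<delta> * ((82 * t + 40) * f)) / 2 = (S * \<delta>) * ((82 * t + 40) * f) / 2" by (simp only: mult.assoc)
      also have "\<dots> = (41 * t + 20) * f / n" unfolding delta(2) using n_ge by (simp add: field_simps)
      finally show ?thesis .
    qed
    finally have 1: "S * (g_y n (t + \<delta>) - f) / 2 \<ge> (41 * t + 20) * f / n" .
    have "S * (\<sigma> * (\<delta> * ((2 - 16 * t\<^sup>2) * c) - (y_fun (t + \<delta>) / 2 - y_fun t / 2))) \<le> S * (400 * \<delta>\<^sup>2)"
      using \<sigma>_mult y_second_order[OF t_nonneg delta(1)] S_pos
      by (intro mult_left_mono order_trans[OF \<sigma>_mult]) (auto simp: abs_minus_commute)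
    also have "S * (400 * \<delta>\<^sup>2) = 400 * \<delta> / n"
      using delta(6) n_ge by (simp add: field_simps)
    finally have "S * (\<sigma> * (\<delta> * ((2 - 16 * t\<^sup>2) * c))) - S * (\<sigma> * (y_fun (t + \<delta>) / 2 - y_fun t / 2)) \<le> 400 * \<delta> / n"
      by (simp only: right_diff_distrib)
    moreover have "S * (\<sigma> * (\<delta> * ((2 - 16 * t\<^sup>2) * c))) = \<sigma> * ((2 - 16 * t\<^sup>2) * c) * (S * \<delta>)" by simp
    ultimately show ?thesis using 1 unfolding r_def delta(2) by (simp add: distrib_left)
  qed
  moreover have "l * (12 * (3 + z) / c / n) + 400 * \<delta> / n \<le> f / n"
    using divide_right_mono[OF l(3), of "real n"] by (simp only: add_divide_distrib times_divide_eq_right of_nat_0_le_iff)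
  moreover have "l * ((\<Sum>e\<in>Op. (d e)\<^sup>2) / ?Q) \<le> l * (12 * (3 + z) / c / n)"
    using d2' l(1) by (intro mult_left_mono) auto
  \<comment> \<open>Of the growth (41t + 20) f/n of the tolerance, the drift error takes (3 + 11t)
    f/n and the second-order terms take f/n.\<close>
  moreover have "(3 + 11 * t) * f / n + f / n \<le> (41 * t + 20) * f / n"
    using t_nonneg f_bounds(1) by (simp add: divide_right_mono mult_right_mono flip: add_divide_distrib distrib_right[of _ 1 f, simplified])
  ultimately have drift: "(\<Sum>e\<in>Op. d e) / ?Q + l * ((\<Sum>e\<in>Op. (d e)\<^sup>2) / ?Q) \<le> r"
    unfolding sum_d by linarith
  show ?thesis
  proof (rule average_exp_drift[OF finite_Op Q_pos(2) l(1) _ drift])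
    show "l * \<bar>d e\<bar> \<le> 1" if "e \<in> Op" for e
      using d_le(1)[OF that] l by (meson less_imp_le mult_left_mono order_trans)
    fix e assume e: "e \<in> Op - {{u, v}}"
    then have eq: "real (card (half_open V (insert e E) u v)) = A + (g e - lo e)"
      using card_half_open_insert[of e u v] uv by (auto simp: A_def g_def lo_def)
    have de: "d e = \<sigma> * (g e - lo e)" using e by (simp add: d_def)
    show "exp (l * (\<sigma> * (real (card (half_open V (insert e E) u v)) - S * (y_fun (t + \<delta>) / 2))
            - S * g_y n (t + \<delta>) / 2))
      = exp (l * (\<sigma> * (real (card (half_open V E u v)) - S * (y_fun t / 2)) - S * f / 2) + l * (d e - r))"
      unfolding r_def de A_def[symmetric] eq by (simp add: field_simps)
  qed auto
qed

text \<open>The scheme of \<open>step_half\<close>, but the variable only decreases, and one step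
  may remove 2 + sqrt n vertices. This forces a rate smaller by a factor of order sqrt n.\<close>

lemma step_both:
  assumes uv: "u < n" "v < n" "u \<noteq> v" "{u, v} \<notin> E" and \<sigma>: "\<bar>\<sigma>\<bar> = (1 :: real)"
    and l: "0 < l" "l * (2 + S) \<le> 1" "l * (3 * (2 + S) * (2 + 4 * S) / c / S) + 400 * \<delta> \<le> c * f"
  shows "(\<Sum>e\<in>Op - {{u, v}}. exp (l * (\<sigma> * (real (card (both_open V (insert e E) u v)) - n * x_fun (t + \<delta>))
            - n * g_x n (t + \<delta>)))) / card Op
     \<le> exp (l * (\<sigma> * (real (card (both_open V E u v)) - n * x_fun t) - n * g_x n t))"
proof -
  define K where "K w = {{u, w}, {v, w}} \<union> closers V E u w \<union> closers V E v w" for w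
  define lo where "lo e = real (card {w \<in> both_open V E u v. e \<in> K w})" for e
  define d where "d e = - \<sigma> * lo e" for e
  define X where "X = real (card (both_open V E u v))"
  define P where "P = (\<Sum>w\<in>both_open V E u v. real (card (closers V E u w)) + real (card (closers V E v w)))"
  define D where "D = (\<Sum>w\<in>both_open V E u v. real (card (K w)))"
  define r where "r = n * (\<sigma> * (x_fun (t + \<delta>) - x_fun t) + (g_x n (t + \<delta>) - g_x n t))"
  let ?Q = "real (card Op)"
  have sum_lo: "(\<Sum>e\<in>Op. lo e) = D"
    unfolding lo_def D_def K_def of_nat_sum[symmetric] sum_both_loss[of u v] ..
  have lo_nonneg: "0 \<le> lo e" for e by (simp add: lo_def)
  have X_nonneg: "0 \<le> X" by (simp add: X_def)
  have inner: "\<bar>real (card (closers V E u w)) + real (card (closers V E v w)) - 2 * (S * (4 * t * c))\<bar> \<le> 2 * (S * f)"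
    "real (card (closers V E u w)) + real (card (closers V E v w)) \<le> 4 * S" if "w \<in> both_open V E u v" for w
    using that closers_dev[of u w] closers_le[of u w] closers_dev[of v w] closers_le[of v w]
    by (auto simp: both_iff open_iff)
  have lo_le: "lo e \<le> 2 + S" if e: "e \<in> Op" for e
  \<comment> \<open>\<open>both_loss_le\<close> excludes e = {u, v}, for which the loss is
    0.\<close>
  proof (cases "e = {u, v}")
    case True
    then have "lo e = 0" using uv_notin_both_loss[OF uv(3)] unfolding lo_def K_def by auto
    then show ?thesis using S_pos by simp
  next
    case False
    have "lo e \<le> real (2 + nat \<lfloor>S\<rfloor>)"
      unfolding lo_def K_def of_nat_le_iff
      by (rule both_loss_le[OF e False uv(3,4)]) (simp add: half_le le_nat_floor)
    then show ?thesis using S_pos by (simp add: of_nat_nat) linarith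
  qed
  have P_dev: "\<bar>P - X * (2 * (S * (4 * t * c)))\<bar> \<le> X * (2 * (S * f))"
  proof -
    have eq: "P - X * (2 * (S * (4 * t * c))) =
        (\<Sum>w\<in>both_open V E u v. real (card (closers V E u w)) + real (card (closers V E v w)) - 2 * (S * (4 * t * c)))"
      by (simp add: P_def X_def sum_subtractf)
    have "\<bar>P - X * (2 * (S * (4 * t * c)))\<bar> \<le> (\<Sum>w\<in>both_open V E u v.
        \<bar>real (card (closers V E u w)) + real (card (closers V E v w)) - 2 * (S * (4 * t * c))\<bar>)"
      unfolding eq by (rule sum_abs)
    also have "\<dots> \<le> X * (2 * (S * f))"
      unfolding X_def by (rule sum_bounded_above) (rule inner)
    finally show ?thesis .
  qed
  have D_dev: "\<bar>D - P\<bar> \<le> X * (2 + z)"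
  proof -
    have eq: "D - P = (\<Sum>w\<in>both_open V E u v. real (card (K w)) - (real (card (closers V E u w)) + real (card (closers V E v w))))"
      by (simp add: D_def P_def sum_subtractf)
    have "\<bar>D - P\<bar> \<le> (\<Sum>w\<in>both_open V E u v.
        \<bar>real (card (K w)) - (real (card (closers V E u w)) + real (card (closers V E v w)))\<bar>)"
      unfolding eq by (rule sum_abs)
    also have "\<dots> \<le> X * (2 + z)"
      unfolding X_def
    proof (rule sum_bounded_above)
      fix w assume w: "w \<in> both_open V E u v"
      show "\<bar>real (card (K w)) - (real (card (closers V E u w)) + real (card (closers V E v w)))\<bar> \<le> 2 + z"
        using card_both_killers_le[of u w v] card_both_killers_ge[OF w uv(3)] codegree[OF uv] z_nonneg
        unfolding K_def by linarith
    qed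
    finally show ?thesis .
  qed
  have D_bound: "\<bar>D / ?Q - 16 * t * c\<^sup>2 / S\<bar> \<le> (7 + 18 * t) * (c * f) / S"
  proof (rule both_open_drift[OF c_bounds t_nonneg f_bounds(1) g_le _ z_nonneg z_le, where X = X and P = P])
    show "\<bar>X - S\<^sup>2 * c\<^sup>2\<bar> \<le> S\<^sup>2 * (c * f)" using both_dev[OF uv] by (simp add: X_def fun_eqs S_sq)
  qed (use n_ge X_nonneg P_dev D_dev Q_dev' in auto)
  have D_le: "D \<le> n * (2 + 4 * S)"
  proof -
    have "D \<le> X * (2 + 4 * S)" unfolding D_def X_def
    proof (rule sum_bounded_above)
      fix w assume w: "w \<in> both_open V E u v"
      show "real (card (K w)) \<le> 2 + 4 * S"
        using card_both_killers_le[of u w v] inner(2)[OF w] unfolding K_def by linarith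
    qed
    also have "\<dots> \<le> n * (2 + 4 * S)"
      using both_le[of u v] S_pos unfolding X_def by (intro mult_right_mono) auto
    finally show ?thesis .
  qed
  have "(\<Sum>e\<in>Op. (d e)\<^sup>2) \<le> (\<Sum>e\<in>Op. (2 + S) * lo e)"
  proof (rule sum_mono)
    fix e assume "e \<in> Op"
    then have "lo e * lo e \<le> (2 + S) * lo e"
      using lo_le lo_nonneg by (intro mult_right_mono) auto
    moreover have "(d e)\<^sup>2 = lo e * lo e"
      using \<sigma> abs_mult_self_eq[of \<sigma>] by (simp add: d_def power2_eq_square algebra_simps)
    ultimately show "(d e)\<^sup>2 \<le> (2 + S) * lo e" by simp
  qed
  also have "\<dots> = (2 + S) * D" using sum_lo by (simp add: sum_distrib_left[symmetric])
  also have "\<dots> \<le> (2 + S) * (n * (2 + 4 * S))" using D_le S_pos by (intro mult_left_mono) auto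
  finally have d2: "(\<Sum>e\<in>Op. (d e)\<^sup>2) \<le> (2 + S) * (n * (2 + 4 * S))" .
  have "(\<Sum>e\<in>Op. (d e)\<^sup>2) / ?Q \<le> (2 + S) * (n * (2 + 4 * S)) / ((real n)\<^sup>2 * c / 3)"
    by (rule frac_le[OF _ d2 _ Q_ge]) (use S_pos n_ge in auto)
  also have "\<dots> = 3 * (2 + S) * (2 + 4 * S) / c / n"
    using n_ge by (simp add: field_simps power2_eq_square)
  also have "\<dots> = 3 * (2 + S) * (2 + 4 * S) / c / S / S"
    by (simp add: S_sq(2))
  finally have d2': "(\<Sum>e\<in>Op. (d e)\<^sup>2) / ?Q \<le> 3 * (2 + S) * (2 + 4 * S) / c / S / S" .
  have sum_d: "(\<Sum>e\<in>Op. d e) = - \<sigma> * D"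
    unfolding d_def sum_lo[symmetric] sum_distrib_left ..
  have \<sigma>_mult: "\<sigma> * x \<le> \<bar>x\<bar>" for x
    using abs_ge_self[of "\<sigma> * x"] \<sigma> by (simp add: abs_mult)
  have "- \<sigma> * D / ?Q + \<sigma> * (16 * t * c\<^sup>2 / S) \<le> (7 + 18 * t) * (c * f) / S"
    using \<sigma>_mult[of "16 * t * c\<^sup>2 / S - D / ?Q"] D_bound by (simp add: right_diff_distrib abs_minus_commute)
  moreover have "r \<ge> - \<sigma> * (16 * t * c\<^sup>2 / S) - 400 * \<delta> / S + (74 * t + 40) * (c * f) / S"
  proof -
    have "n * (\<delta> * ((74 * t + 40) * g_x n t)) \<le> n * (g_x n (t + \<delta>) - g_x n t)"
      using g_x_growth[OF t_nonneg delta(1), of n] by (intro mult_left_mono) auto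
    moreover have "n * (\<delta> * ((74 * t + 40) * g_x n t)) = (n * \<delta>) * ((74 * t + 40) * (c * f))"
      by (simp only: mult.assoc fun_eqs)
    ultimately have 1: "n * (g_x n (t + \<delta>) - g_x n t) \<ge> (74 * t + 40) * (c * f) / S"
      unfolding delta(3) by simp
    have "n * (\<sigma> * (\<delta> * (- 16 * t * x_fun t) - (x_fun (t + \<delta>) - x_fun t))) \<le> n * (400 * \<delta>\<^sup>2)"
      using \<sigma>_mult x_second_order[OF t_nonneg delta(1)]
      by (intro mult_left_mono order_trans[OF \<sigma>_mult]) (auto simp: abs_minus_commute)
    also have "n * (400 * \<delta>\<^sup>2) = 400 * (n * \<delta>\<^sup>2 * S) / S" using n_ge by simp
    also have "\<dots> = 400 * \<delta> / S" unfolding delta(8) ..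
    finally have "n * (\<sigma> * (\<delta> * (- 16 * t * x_fun t))) - n * (\<sigma> * (x_fun (t + \<delta>) - x_fun t)) \<le> 400 * \<delta> / S"
      by (simp only: right_diff_distrib)
    moreover have "n * (\<sigma> * (\<delta> * (- 16 * t * x_fun t))) = - \<sigma> * (16 * t * c\<^sup>2) * (n * \<delta>)"
      by (simp add: fun_eqs)
    ultimately show ?thesis using 1 unfolding r_def delta(3) by (simp add: distrib_left)
  qed
  moreover have "l * (3 * (2 + S) * (2 + 4 * S) / c / S / S) + 400 * \<delta> / S \<le> c * f / S"
    using divide_right_mono[OF l(3), of S] by (simp only: add_divide_distrib times_divide_eq_right real_sqrt_ge_zero of_nat_0_le_iff)
  moreover have "l * ((\<Sum>e\<in>Op. (d e)\<^sup>2) / ?Q) \<le> l * (3 * (2 + S) * (2 + 4 * S) / c / S / S)"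
    using d2' l(1) by (intro mult_left_mono) auto
  moreover have "(7 + 18 * t) * (c * f) / S + c * f / S \<le> (74 * t + 40) * (c * f) / S"
  proof -
    have "(7 + 18 * t) * (c * f) / S + c * f / S = ((7 + 18 * t) * (c * f) + 1 * (c * f)) / S"
      by (simp only: add_divide_distrib mult_1)
    also have "\<dots> = (8 + 18 * t) * (c * f / S)"
      unfolding distrib_right[symmetric] by simp
    also have "\<dots> \<le> (74 * t + 40) * (c * f / S)"
      using t_nonneg f_bounds(1) S_pos by (intro mult_right_mono) auto
    finally show ?thesis by simp
  qed
  ultimately have drift: "(\<Sum>e\<in>Op. d e) / ?Q + l * ((\<Sum>e\<in>Op. (d e)\<^sup>2) / ?Q) \<le> r"
    unfolding sum_d by linarith
  show ?thesis
  proof (rule average_exp_drift[OF finite_Op Q_pos(2) l(1) _ drift])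
    show "l * \<bar>d e\<bar> \<le> 1" if "e \<in> Op" for e
    proof -
      have "l * \<bar>d e\<bar> \<le> l * (2 + S)"
        using lo_le[OF that] lo_nonneg[of e] \<sigma> l(1) by (intro mult_left_mono) (auto simp: d_def abs_mult)
      then show ?thesis using l(2) by linarith
    qed
    fix e assume e: "e \<in> Op - {{u, v}}"
    then have eq: "real (card (both_open V (insert e E) u v)) = X - lo e"
      using card_both_open_insert[of e u v] by (auto simp: X_def lo_def K_def)
    show "exp (l * (\<sigma> * (real (card (both_open V (insert e E) u v)) - n * x_fun (t + \<delta>)) - n * g_x n (t + \<delta>)))
      = exp (l * (\<sigma> * (real (card (both_open V E u v)) - n * x_fun t) - n * g_x n t) + l * (d e - r))"
      unfolding r_def d_def X_def[symmetric] eq by (simp add: algebra_simps)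
  qed auto
qed

text \<open>A codegree rises by 1 with probability at most 6 \<delta>/c. As exp 1 <= 3, its
  exponential grows on average by a factor of at most 1 + 12 \<delta>/c, which \<kappa> compensates.
  Only an upper bound is wanted, so a linear barrier replaces the trajectory.\<close>

lemma step_codegree:
  assumes uv: "u < n" "v < n" "u \<noteq> v" "{u, v} \<notin> E" and \<kappa>: "12 * \<delta> / c \<le> \<kappa>"
  shows "(\<Sum>e\<in>Op - {{u, v}}. exp (real (card (both_edge V (insert e E) u v)) - (b + \<kappa>))) / card Op
     \<le> exp (real (card (both_edge V E u v)) - b)"
proof -
  let ?Q = "real (card Op)" and ?Z = "real (card (both_edge V E u v))"
  have exp1: "exp (1 :: real) \<le> 3" by (rule exp_le)
  have "exp (real (card (both_edge V (insert e E) u v)) - (b + \<kappa>))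
      \<le> exp (?Z - (b + \<kappa>)) * (1 + 2 * indicator (closers V E u v) e)" if e: "e \<in> Op - {{u, v}}" for e
  proof -
    have "real (card (both_edge V (insert e E) u v)) \<le> ?Z + (if e \<in> closers V E u v then 1 else 0)"
      using card_both_edge_insert[of e u v] e uv by (auto simp flip: of_nat_Suc split: if_splits)
    then have "exp (real (card (both_edge V (insert e E) u v)) - (b + \<kappa>))
        \<le> exp (?Z - (b + \<kappa>) + (if e \<in> closers V E u v then 1 else 0))" by simp
    also have "\<dots> = exp (?Z - (b + \<kappa>)) * exp (if e \<in> closers V E u v then 1 else 0)"
      by (rule exp_add)
    also have "\<dots> \<le> exp (?Z - (b + \<kappa>)) * (1 + 2 * indicator (closers V E u v) e)"
      using exp1 by (intro mult_left_mono) auto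
    finally show ?thesis .
  qed
  then have "(\<Sum>e\<in>Op - {{u, v}}. exp (real (card (both_edge V (insert e E) u v)) - (b + \<kappa>)))
      \<le> (\<Sum>e\<in>Op - {{u, v}}. exp (?Z - (b + \<kappa>)) * (1 + 2 * indicator (closers V E u v) e))"
    by (rule sum_mono)
  also have "\<dots> \<le> (\<Sum>e\<in>Op. exp (?Z - (b + \<kappa>)) * (1 + 2 * indicator (closers V E u v) e))"
    by (intro sum_mono2) auto
  also have "\<dots> = exp (?Z - (b + \<kappa>)) * (?Q + 2 * real (card (closers V E u v)))"
  proof -
    have "closers V E u v \<subseteq> Op" by (auto simp: closers_iff)
    then have "(\<Sum>e\<in>Op. indicator (closers V E u v) e :: real) = card (closers V E u v)"
      by (simp add: indicator_def sum.If_cases Int_absorb1)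
    then show ?thesis by (simp add: sum.distrib flip: sum_distrib_left)
  qed
  finally have "(\<Sum>e\<in>Op - {{u, v}}. exp (real (card (both_edge V (insert e E) u v)) - (b + \<kappa>))) / ?Q
      \<le> exp (?Z - (b + \<kappa>)) * (1 + 2 * real (card (closers V E u v)) / ?Q)"
    using Q_pos(1) by (simp add: field_simps)
  also have "\<dots> \<le> exp (?Z - (b + \<kappa>)) * exp \<kappa>"
  proof (rule mult_left_mono)
    have "2 * real (card (closers V E u v)) / ?Q \<le> 4 * S / ((real n)\<^sup>2 * c / 3)"
      by (rule frac_le[OF _ _ _ Q_ge]) (use closers_le[OF uv(3,4)] S_pos n_ge in auto)
    also have "\<dots> = 12 * (S / (real n)\<^sup>2) / c" by simp
    also have "S / (real n)\<^sup>2 = \<delta>" using delta(4) n_ge by (simp add: field_simps)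
    finally have "2 * real (card (closers V E u v)) / ?Q \<le> \<kappa>" using \<kappa> by linarith
    then show "1 + 2 * real (card (closers V E u v)) / ?Q \<le> exp \<kappa>"
      using exp_ge_add_one_self[of \<kappa>] by linarith
  qed simp
  also have "\<dots> = exp (?Z - b)" by (simp flip: exp_add)
  finally show ?thesis .
qed

end

section \<open>The potential and the probability of the tracking event\<close>

text \<open>The exponent exceeds the 1/100 allowed for exp(4t^2): up to step m the barrier rises by
  order n^(1/100) sqrt(log n), which fits into half the cap. The other half makes the initial term
  small.\<close>

definition codegree_cap :: "nat \<Rightarrow> real" where
  "codegree_cap n = real n powr (1/50)"

text \<open>The exponent must lie between -1/3 and -1/6 - 3/100. The lower end lets the initial term
  exp(-n^(7/60)/2) beat n^2 pairs; the upper end lets the second moment, with its factors n^(1/50)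
  and exp(4t^2), fit into n^(-1/6).\<close>

definition rate_half :: "nat \<Rightarrow> real" where
  "rate_half n = real n powr (-13/60)"

text \<open>\<open>rate_half\<close> divided by sqrt n, to match the larger jumps; the initial
  exponent is again of order n^(7/60).\<close>

definition rate_both :: "nat \<Rightarrow> real" where
  "rate_both n = real n powr (-43/60)"

text \<open>The increment 12 n^(-3/2) exp(4t^2) of \<open>step_codegree\<close>, with n^(1/100) for
  the exponential.\<close>

definition rate_codegree :: "nat \<Rightarrow> real" where
  "rate_codegree n = 12 * real n powr (-149/100)"

definition pair_potential :: "nat \<Rightarrow> nat \<Rightarrow> nat set set \<Rightarrow> nat \<Rightarrow> nat \<Rightarrow> real" where
  "pair_potential n i E u v =
     (\<Sum>\<sigma>\<in>{1, -1}. exp (rate_half n * (\<sigma> * (real (card (half_open {..<n} E u v)) - sqrt n * (y_fun (time n i) / 2))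
        - sqrt n * g_y n (time n i) / 2)))
   + (\<Sum>\<sigma>\<in>{1, -1}. exp (rate_both n * (\<sigma> * (real (card (both_open {..<n} E u v)) - n * x_fun (time n i))
        - n * g_x n (time n i))))
   + exp (real (card (both_edge {..<n} E u v)) - (codegree_cap n / 2 + rate_codegree n * i))"

text \<open>Ordered pairs, so that both orientations of \<open>half_open\<close> enter the
  potential.\<close>

definition nonadjacent :: "nat \<Rightarrow> nat set set \<Rightarrow> (nat \<times> nat) set" where
  "nonadjacent n E = {(u, v). u < n \<and> v < n \<and> u \<noteq> v \<and> {u, v} \<notin> E}"

text \<open>A summand exceeds 1 when its variable leaves the tolerance, so a value below 1 certifies
  all tolerances at once. The first summand can have rate 1 because it never increases, by
  \<open>step_Q\<close>.\<close>

definition potential :: "nat \<Rightarrow> nat \<Rightarrow> nat set set \<Rightarrow> real" where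
  "potential n i E =
     exp (\<bar>real (card (open_pairs {..<n} E)) - (real n)\<^sup>2 * q_fun (time n i)\<bar> - (real n)\<^sup>2 * h_q n (time n i))
   + (\<Sum>(u, v)\<in>nonadjacent n E. pair_potential n i E u v)"

definition large :: "nat \<Rightarrow> bool" where
  "large n \<longleftrightarrow> n \<ge> 400 \<and> rate_half n * (3 + codegree_cap n) \<le> 1 \<and> rate_both n * (2 + sqrt n) \<le> 1 \<and>
     (\<forall>i\<le>m_step n. let t = time n i; c = exp (- 4 * t\<^sup>2) in
        g_y n t \<le> c / 22 \<and> 1 / sqrt n \<le> c * g_y n t / 20 \<and> 2 + codegree_cap n \<le> sqrt n * (g_y n t / 10) \<and>
        rate_half n * (12 * (3 + codegree_cap n) / c) + 400 * real n powr (-3/2) \<le> g_y n t \<and>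
        rate_both n * (3 * (2 + sqrt n) * (2 + 4 * sqrt n) / c / sqrt n) + 400 * real n powr (-3/2) \<le> c * g_y n t \<and>
        12 * real n powr (-3/2) / c \<le> rate_codegree n \<and>
        rate_codegree n * i \<le> codegree_cap n / 2)"

lemma finite_nonadjacent: "finite (nonadjacent n E)"
  by (rule finite_subset[of _ "{..<n} \<times> {..<n}"]) (auto simp: nonadjacent_def)

lemma card_nonadjacent_le: "card (nonadjacent n E) \<le> n * n"
  using card_mono[of "{..<n} \<times> {..<n}" "nonadjacent n E"] by (auto simp: nonadjacent_def)

lemma pair_potential_nonneg: "0 \<le> pair_potential n i E u v"
  unfolding pair_potential_def by (intro add_nonneg_nonneg sum_nonneg) auto

lemma potential_nonneg: "0 \<le> potential n i E"
  unfolding potential_def by (intro add_nonneg_nonneg sum_nonneg) (auto simp: pair_potential_nonneg)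

lemma time_Suc: "time n (Suc i) = time n i + real n powr (-3/2)"
  by (simp add: time_def add_divide_distrib powr_minus_divide)

lemma time_nonneg: "0 \<le> time n i"
  by (simp add: time_def)

lemma potential_imp_pair:
  assumes "potential n i E < 1" "u < n" "v < n" "u \<noteq> v" "{u, v} \<notin> E"
  shows "pair_potential n i E u v < 1"
proof -
  have "pair_potential n i E u v \<le> (\<Sum>(u, v)\<in>nonadjacent n E. pair_potential n i E u v)"
    using member_le_sum[of "(u, v)" "nonadjacent n E" "\<lambda>(u, v). pair_potential n i E u v"] assms finite_nonadjacent
    by (auto simp: nonadjacent_def pair_potential_nonneg)
  also have "\<dots> \<le> potential n i E" by (simp add: potential_def)
  finally show ?thesis using assms(1) by simp
qed

lemma abs_le_of_exp_less_1:
  fixes a r :: real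
  assumes "l > 0" "exp (l * (1 * a - r)) < 1" "exp (l * (- 1 * a - r)) < 1"
  shows "\<bar>a\<bar> \<le> r"
proof -
  have "1 * a - r < 0" "- 1 * a - r < 0" using assms by (simp_all add: mult_less_0_iff)
  then show ?thesis by linarith
qed

lemma pair_potential_bounds:
  assumes "pair_potential n i E u v < 1" and n: "n > 0"
  shows "\<bar>real (card (half_open {..<n} E u v)) - sqrt n * (y_fun (time n i) / 2)\<bar> \<le> sqrt n * g_y n (time n i) / 2"
    and "\<bar>real (card (both_open {..<n} E u v)) - n * x_fun (time n i)\<bar> \<le> n * g_x n (time n i)"
    and "real (card (both_edge {..<n} E u v)) \<le> codegree_cap n / 2 + rate_codegree n * i"
proof -
  let ?a = "real (card (half_open {..<n} E u v)) - sqrt n * (y_fun (time n i) / 2)"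
  let ?b = "real (card (both_open {..<n} E u v)) - n * x_fun (time n i)"
  let ?r = "sqrt n * g_y n (time n i) / 2" and ?s = "n * g_x n (time n i)"
  let ?z = "real (card (both_edge {..<n} E u v)) - (codegree_cap n / 2 + rate_codegree n * i)"
  have "exp (rate_half n * (1 * ?a - ?r)) + exp (rate_half n * (- 1 * ?a - ?r))
      + (exp (rate_both n * (1 * ?b - ?s)) + exp (rate_both n * (- 1 * ?b - ?s))) + exp ?z < 1"
    using assms(1) unfolding pair_potential_def by simp
  then have lt: "exp (rate_half n * (1 * ?a - ?r)) < 1" "exp (rate_half n * (- 1 * ?a - ?r)) < 1"
      "exp (rate_both n * (1 * ?b - ?s)) < 1" "exp (rate_both n * (- 1 * ?b - ?s)) < 1" "exp ?z < 1"
    by (smt (verit) exp_gt_zero)+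
  have pos: "rate_half n > 0" "rate_both n > 0" using n by (simp_all add: rate_half_def rate_both_def)
  show "\<bar>?a\<bar> \<le> ?r"
    by (rule abs_le_of_exp_less_1[OF pos(1) lt(1,2)])
  show "\<bar>?b\<bar> \<le> ?s"
    by (rule abs_le_of_exp_less_1[OF pos(2) lt(3,4)])
  show "real (card (both_edge {..<n} E u v)) \<le> codegree_cap n / 2 + rate_codegree n * i"
    using lt(5) by simp
qed

lemma potential_imp_tracked:
  assumes large: "large n" and i: "i \<le> m_step n" and E: "triangle_free_graph {..<n} E" and pot: "potential n i E < 1"
  shows "tracked_state n E (time n i) (codegree_cap n)"
proof -
  interpret triangle_free_graph "{..<n}" E by fact
  have n: "n \<ge> 400" using large by (simp add: large_def)
  have sz: "g_y n (time n i) \<le> exp (- 4 * (time n i)\<^sup>2) / 22"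
    "1 / sqrt n \<le> exp (- 4 * (time n i)\<^sup>2) * g_y n (time n i) / 20"
    "2 + codegree_cap n \<le> sqrt n * (g_y n (time n i) / 10)"
    "rate_codegree n * i \<le> codegree_cap n / 2"
    using large i by (auto simp: large_def Let_def)
  have "exp (\<bar>real (card Op) - (real n)\<^sup>2 * q_fun (time n i)\<bar> - (real n)\<^sup>2 * h_q n (time n i)) < 1"
  proof -
    have "0 \<le> (\<Sum>(u, v)\<in>nonadjacent n E. pair_potential n i E u v)"
      by (intro sum_nonneg) (auto simp: pair_potential_nonneg)
    then show ?thesis using pot unfolding potential_def by linarith
  qed
  then have Q: "\<bar>real (card Op) - (real n)\<^sup>2 * q_fun (time n i)\<bar> \<le> (real n)\<^sup>2 * h_q n (time n i)" by simp
  show ?thesis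
  proof (unfold_locales, goal_cases)
    case (4 u v)
    then show ?case using pair_potential_bounds(1)[OF potential_imp_pair[OF pot]] n by simp
  next
    case (5 u v)
    then show ?case using pair_potential_bounds(2)[OF potential_imp_pair[OF pot]] n by simp
  next
    case (6 u v)
    then show ?case using pair_potential_bounds(3)[OF potential_imp_pair[OF pot], of u v] n sz(4) by simp
  qed (use Q sz n in \<open>auto simp: time_nonneg codegree_cap_def\<close>)
qed

lemma potential_drift:
  assumes large: "large n" and i: "i < m_step n" and E: "triangle_free_graph {..<n} E" and pot: "potential n i E < 1"
  shows "measure_pmf.expectation (tf_step n E) (potential n (Suc i)) \<le> potential n i E"
proof -
  interpret tracked_state n E "time n i" "codegree_cap n"
    by (rule potential_imp_tracked) (use assms in auto)
  let ?t = "time n i" and ?Q = "real (card Op)" and ?c = "exp (- 4 * (time n i)\<^sup>2)"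
  have n: "n \<ge> 400" using large by (simp add: large_def)
  have pos: "rate_half n > 0" "rate_both n > 0" using n by (simp_all add: rate_half_def rate_both_def)
  have sz: "rate_half n * (3 + codegree_cap n) \<le> 1" "rate_both n * (2 + sqrt n) \<le> 1"
    "rate_half n * (12 * (3 + codegree_cap n) / ?c) + 400 * real n powr (-3/2) \<le> g_y n ?t"
    "rate_both n * (3 * (2 + sqrt n) * (2 + 4 * sqrt n) / ?c / sqrt n) + 400 * real n powr (-3/2) \<le> ?c * g_y n ?t"
    "12 * real n powr (-3/2) / ?c \<le> rate_codegree n"
    using large i by (auto simp: large_def Let_def)
  let ?q = "\<lambda>i E. exp (\<bar>real (card (open_pairs {..<n} E)) - (real n)\<^sup>2 * q_fun (time n i)\<bar> - (real n)\<^sup>2 * h_q n (time n i))"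
  have pair: "(\<Sum>e\<in>Op - {{u, v}}. pair_potential n (Suc i) (insert e E) u v) / ?Q \<le> pair_potential n i E u v"
    if uv: "u < n" "v < n" "u \<noteq> v" "{u, v} \<notin> E" for u v
  proof -
    have 1: "(\<Sum>\<sigma>\<in>{1, -1}. (\<Sum>e\<in>Op - {{u, v}}. exp (rate_half n * (\<sigma> * (real (card (half_open {..<n} (insert e E) u v))
          - sqrt n * (y_fun (time n (Suc i)) / 2)) - sqrt n * g_y n (time n (Suc i)) / 2))) / ?Q)
      \<le> (\<Sum>\<sigma>\<in>{1, -1}. exp (rate_half n * (\<sigma> * (real (card (half_open {..<n} E u v)) - sqrt n * (y_fun ?t / 2))
        - sqrt n * g_y n ?t / 2)))"
      unfolding time_Suc by (intro sum_mono step_half[OF uv _ pos(1) sz(1,3)]) auto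
    have 2: "(\<Sum>\<sigma>\<in>{1, -1}. (\<Sum>e\<in>Op - {{u, v}}. exp (rate_both n * (\<sigma> * (real (card (both_open {..<n} (insert e E) u v))
          - n * x_fun (time n (Suc i))) - n * g_x n (time n (Suc i))))) / ?Q)
      \<le> (\<Sum>\<sigma>\<in>{1, -1}. exp (rate_both n * (\<sigma> * (real (card (both_open {..<n} E u v)) - n * x_fun ?t)
        - n * g_x n ?t)))"
      unfolding time_Suc by (intro sum_mono step_both[OF uv _ pos(2) sz(2,4)]) auto
    have 3: "(\<Sum>e\<in>Op - {{u, v}}. exp (real (card (both_edge {..<n} (insert e E) u v))
        - (codegree_cap n / 2 + rate_codegree n * Suc i))) / ?Q
      \<le> exp (real (card (both_edge {..<n} E u v)) - (codegree_cap n / 2 + rate_codegree n * i))"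
      using step_codegree[OF uv sz(5), of "codegree_cap n / 2 + rate_codegree n * i"] by (simp add: algebra_simps)
    show ?thesis
      using add_mono[OF add_mono[OF 1 2] 3]
      unfolding pair_potential_def sum.distrib add_divide_distrib sum.swap[of _ "{1, -1}"] sum_divide_distrib .
  qed
  have "measure_pmf.expectation (tf_step n E) (potential n (Suc i)) = (\<Sum>e\<in>Op. potential n (Suc i) (insert e E)) / ?Q"
    by (rule expectation_tf_step[OF Q_pos(2)])
  also have "\<dots> = (\<Sum>e\<in>Op. ?q (Suc i) (insert e E)) / ?Q
      + (\<Sum>e\<in>Op. \<Sum>(u, v)\<in>nonadjacent n (insert e E). pair_potential n (Suc i) (insert e E) u v) / ?Q"
    unfolding potential_def sum.distrib add_divide_distrib ..
  also have "\<dots> \<le> ?q i E + (\<Sum>(u, v)\<in>nonadjacent n E. pair_potential n i E u v)"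
  proof (rule add_mono)
    have "(\<Sum>e\<in>Op. ?q (Suc i) (insert e E)) \<le> (\<Sum>e\<in>Op. ?q i E)"
      using step_Q unfolding time_Suc by (intro sum_mono) simp
    then show "(\<Sum>e\<in>Op. ?q (Suc i) (insert e E)) / ?Q \<le> ?q i E"
      using Q_pos(1) by (simp add: divide_le_eq mult.commute)
    \<comment> \<open>Inserting e removes only its own two orientations from
      \<open>nonadjacent\<close>. After the sums are swapped, each fixed pair skips e = {u, v},
      which is the form of the one-step lemmas.\<close>
    have "(\<Sum>e\<in>Op. \<Sum>(u, v)\<in>nonadjacent n (insert e E). pair_potential n (Suc i) (insert e E) u v)
      = (\<Sum>e\<in>Op. \<Sum>(u, v)\<in>nonadjacent n E. if e = {u, v} then 0 else pair_potential n (Suc i) (insert e E) u v)"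
    proof (rule sum.cong[OF refl])
      fix e assume "e \<in> Op"
      show "(\<Sum>(u, v)\<in>nonadjacent n (insert e E). pair_potential n (Suc i) (insert e E) u v)
        = (\<Sum>(u, v)\<in>nonadjacent n E. if e = {u, v} then 0 else pair_potential n (Suc i) (insert e E) u v)"
        by (rule sum.mono_neutral_cong_left) (auto simp: finite_nonadjacent, auto simp: nonadjacent_def)
    qed
    also have "\<dots> = (\<Sum>(u, v)\<in>nonadjacent n E. \<Sum>e\<in>Op. if e = {u, v} then 0 else pair_potential n (Suc i) (insert e E) u v)"
      by (subst sum.swap) (simp add: case_prod_unfold)
    also have "\<dots> = (\<Sum>(u, v)\<in>nonadjacent n E. \<Sum>e\<in>Op - {{u, v}}. pair_potential n (Suc i) (insert e E) u v)"
    proof (intro sum.cong refl, clarify)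
      fix u v
      show "(\<Sum>e\<in>Op. if e = {u, v} then 0 else pair_potential n (Suc i) (insert e E) u v)
        = (\<Sum>e\<in>Op - {{u, v}}. pair_potential n (Suc i) (insert e E) u v)"
        by (rule sum.mono_neutral_cong_right) auto
    qed
    finally have eq: "(\<Sum>e\<in>Op. \<Sum>(u, v)\<in>nonadjacent n (insert e E). pair_potential n (Suc i) (insert e E) u v)
      = (\<Sum>(u, v)\<in>nonadjacent n E. \<Sum>e\<in>Op - {{u, v}}. pair_potential n (Suc i) (insert e E) u v)" .
    show "(\<Sum>e\<in>Op. \<Sum>(u, v)\<in>nonadjacent n (insert e E). pair_potential n (Suc i) (insert e E) u v) / ?Q
      \<le> (\<Sum>(u, v)\<in>nonadjacent n E. pair_potential n i E u v)"
      unfolding eq sum_divide_distrib[of _ "nonadjacent n E"]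
    proof (rule sum_mono)
      fix p assume "p \<in> nonadjacent n E"
      then show "(case p of (u, v) \<Rightarrow> \<Sum>e\<in>Op - {{u, v}}. pair_potential n (Suc i) (insert e E) u v) / ?Q
          \<le> (case p of (u, v) \<Rightarrow> pair_potential n i E u v)"
        using pair by (auto simp: nonadjacent_def)
    qed
  qed
  also have "\<dots> = potential n i E" by (simp add: potential_def)
  finally show ?thesis .
qed

lemma tracked_imp_H:
  assumes "large n" "G \<in> set_pmf (tf_run n s)" "\<And>i. i \<le> m_step n \<Longrightarrow> potential n i (G i) < 1"
  shows "event_H n G"
  unfolding event_H_def
proof (intro allI impI conjI)
  fix i assume i: "i \<le> m_step n"
  interpret tracked_state n "G i" "time n i" "codegree_cap n"
    using potential_imp_tracked[OF assms(1) i tf_run_triangle_free[OF assms(2)] assms(3)[OF i]] .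
  have "(real n)\<^sup>2 * h_q n (time n i) \<le> (real n)\<^sup>2 * g_q n (time n i)"
    by (intro mult_left_mono h_q_le_g_q t_nonneg) simp
  then show "\<bar>real (card (open_pairs {..<n} (G i))) - (real n)\<^sup>2 * q_fun (time n i)\<bar> \<le> (real n)\<^sup>2 * g_q n (time n i)"
    using Q_dev by linarith
  fix u v assume "u < n" "v < n" "u \<noteq> v \<and> {u, v} \<notin> G i"
  then show "\<bar>real (card (Y_set {..<n} (G i) u v)) - sqrt n * y_fun (time n i)\<bar> \<le> sqrt n * g_y n (time n i)"
    using closers_dev[of u v] card_Y_set[of u v] card_closers[of u v] by (simp add: fun_eqs(2))
qed

lemma prob_not_H:
  assumes "large n" "m_step n \<le> s"
  shows "measure_pmf.prob (tf_run n s) {G. \<not> event_H n G} \<le> potential n 0 {}"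
proof -
  have "measure_pmf.prob (tf_run n s) {G. \<not> event_H n G} = measure_pmf.prob (tf_run n (m_step n)) {G. \<not> event_H n G}"
    by (rule prob_tf_run_marginal[OF assms(2)]) (simp add: event_H_def)
  also have "\<dots> \<le> measure_pmf.prob (tf_run n (m_step n)) {G. \<exists>i\<le>m_step n. potential n i (G i) \<ge> 1}"
    using tracked_imp_H[OF assms(1)]
    by (intro measure_pmf.finite_measure_mono_AE) (auto simp: AE_measure_pmf_iff not_le[symmetric])
  also have "\<dots> \<le> potential n 0 {}"
    by (rule prob_exceed_le) (rule potential_drift[OF assms(1)], assumption+, rule potential_nonneg)
  finally show ?thesis .
qed

section \<open>Sizes of the parameters up to step m, and the initial potential\<close>

lemma time_le:
  assumes "n \<ge> 2" "i \<le> m_step n"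
  shows "time n i \<le> sqrt (ln n) / 32"
proof -
  have "real i \<le> real (m_step n)" using assms by simp
  also have "\<dots> \<le> mu * real n powr (3/2) * sqrt (ln n)"
    unfolding m_step_def using assms(1) by (intro of_nat_floor) (simp add: mu_def)
  finally have "real i \<le> sqrt (ln n) / 32 * real n powr (3/2)" by (simp add: mu_def mult.commute)
  then show ?thesis using assms(1) by (simp add: time_def divide_le_eq mult.commute)
qed

lemma m_step_ge: "mu * real n powr (3/2) * sqrt (ln n) - 1 \<le> m_step n"
  unfolding m_step_def by linarith

text \<open>This is where mu = 1/32 enters: t^2 <= log n / 1024 gives exp(4t^2) <= n^(1/256), and
  41/1024 < 1/15 leaves room for the term 40t in \<open>g_y\<close> <= n^(1/15 - 1/6).\<close>

lemma trajectory_bounds: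
  fixes t :: real
  assumes n: "n \<ge> 2" and t: "0 \<le> t" "t \<le> sqrt (ln n) / 32"
    and big: "41 / 1024 * ln n + 40 / 32 * sqrt (ln n) \<le> ln (real n) / 15"
  shows "1 / exp (- 4 * t\<^sup>2) \<le> n powr (1/100)" "g_y n t \<le> n powr (-1/10)"
    "n powr (-1/6) \<le> exp (- 4 * t\<^sup>2) * g_y n t"
proof -
  have L: "ln (real n) \<ge> 0" using n by simp
  have "t\<^sup>2 \<le> (sqrt (ln n) / 32)\<^sup>2" using t by (intro power_mono)
  then have t2: "t\<^sup>2 \<le> ln n / 1024" using L by (simp add: power_divide)
  have "exp (4 * t\<^sup>2) \<le> exp (1/100 * ln n)" using t2 L by simp
  then show "1 / exp (- 4 * t\<^sup>2) \<le> n powr (1/100)"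
    using n by (simp add: powr_def exp_minus field_simps)
  have "exp (41 * t\<^sup>2 + 40 * t) \<le> exp (ln n / 15)"
    using t2 t big by simp
  also have "\<dots> = n powr (1/15)" using n by (simp add: powr_def)
  finally have "g_y n t \<le> n powr (1/15) * n powr (-1/6)"
    unfolding g_y_def by (intro mult_right_mono) auto
  also have "\<dots> = n powr (-1/10)" by (simp flip: powr_add)
  finally show "g_y n t \<le> n powr (-1/10)" .
  have "0 \<le> 37 * t\<^sup>2 + 40 * t" using t by simp
  then have "1 \<le> exp (37 * t\<^sup>2 + 40 * t)" by (simp only: one_le_exp_iff)
  also have "\<dots> = exp (- 4 * t\<^sup>2) * exp (41 * t\<^sup>2 + 40 * t)" by (simp flip: exp_add)
  finally have "1 * n powr (-1/6) \<le> exp (- 4 * t\<^sup>2) * exp (41 * t\<^sup>2 + 40 * t) * n powr (-1/6)"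
    by (intro mult_right_mono) auto
  then show "n powr (-1/6) \<le> exp (- 4 * t\<^sup>2) * g_y n t" by (simp add: g_y_def mult.assoc)
qed

lemma eventually_trajectory_big:
  "eventually (\<lambda>n. 41 / 1024 * ln n + 40 / 32 * sqrt (ln n) \<le> ln (real n) / 15) sequentially"
  by real_asymp

lemma eventually_large: "eventually large sequentially"
proof -
  have "eventually (\<lambda>n::nat. n \<ge> 400) sequentially" by (rule eventually_ge_at_top)
  moreover note eventually_trajectory_big
  moreover have "eventually (\<lambda>n::nat. n powr (-1/10) \<le> n powr (-1/100) / 22) sequentially" by real_asymp
  moreover have "eventually (\<lambda>n::nat. 1 / sqrt n \<le> n powr (-1/6) / 20) sequentially" by real_asymp
  moreover have "eventually (\<lambda>n::nat. 2 + n powr (1/50) \<le> sqrt n * (n powr (-1/6) / 10)) sequentially" by real_asymp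
  moreover have "eventually (\<lambda>n::nat. n powr (-13/60) * (3 + n powr (1/50)) \<le> 1) sequentially" by real_asymp
  moreover have "eventually (\<lambda>n::nat. n powr (-43/60) * (2 + sqrt n) \<le> 1) sequentially" by real_asymp
  moreover have "eventually (\<lambda>n::nat. n powr (-13/60) * (12 * (3 + n powr (1/50)) * n powr (1/100))
      + 400 * n powr (-3/2) \<le> n powr (-1/6)) sequentially" by real_asymp
  moreover have "eventually (\<lambda>n::nat. n powr (-43/60) * (3 * (2 + sqrt n) * (2 + 4 * sqrt n) * n powr (1/100) / sqrt n)
      + 400 * n powr (-3/2) \<le> n powr (-1/6)) sequentially" by real_asymp
  moreover have "eventually (\<lambda>n::nat. 12 * n powr (-149/100) * (n powr (3/2) * (sqrt (ln n) / 32)) \<le> n powr (1/50) / 2) sequentially"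
    by real_asymp
  ultimately show ?thesis
  proof eventually_elim
    case (elim n)
    note e = elim
    show "large n"
      unfolding large_def Let_def
    proof (intro conjI allI impI)
      show "n \<ge> 400" "rate_half n * (3 + codegree_cap n) \<le> 1" "rate_both n * (2 + sqrt n) \<le> 1"
        using e by (auto simp: rate_half_def rate_both_def codegree_cap_def)
      fix i assume i: "i \<le> m_step n"
      define t where "t = time n i"
      have tT: "0 \<le> t" "t \<le> sqrt (ln n) / 32"
        using time_le[OF _ i] e(1) by (auto simp: t_def time_nonneg)
      have n2: "n \<ge> 2" using e(1) by simp
      note b = trajectory_bounds[OF n2 tT e(2)]
      let ?c = "exp (- 4 * t\<^sup>2)"
      have "?c \<ge> 1 / n powr (1/100)"
        using b(1) n2 by (simp add: field_simps)
      then have c: "?c \<ge> n powr (-1/100)" by (simp add: powr_minus_divide)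
      have c1: "?c \<le> 1" by simp
      have "0 \<le> g_y n t" by (simp add: g_y_def)
      then have "?c * g_y n t \<le> 1 * g_y n t" using c1 by (intro mult_right_mono)
      then have g: "n powr (-1/6) \<le> g_y n t" using b(3) by linarith
      have "g_y n t \<le> ?c / 22" using b(2) c e(3) by linarith
      then show "g_y n (time n i) \<le> exp (- 4 * (time n i)\<^sup>2) / 22" by (simp add: t_def)
      have "1 / sqrt n \<le> ?c * g_y n t / 20" using b(3) e(4) by linarith
      then show "1 / sqrt n \<le> exp (- 4 * (time n i)\<^sup>2) * g_y n (time n i) / 20" by (simp add: t_def)
      have "sqrt n * (n powr (-1/6) / 10) \<le> sqrt n * (g_y n t / 10)"
        using g by (intro mult_left_mono) auto
      then show "2 + codegree_cap n \<le> sqrt n * (g_y n (time n i) / 10)"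
        using e(5) by (simp add: t_def codegree_cap_def)
      have "rate_half n * (12 * (3 + codegree_cap n) / ?c)
          = n powr (-13/60) * (12 * (3 + n powr (1/50)) * (1 / ?c))"
        by (simp add: rate_half_def codegree_cap_def)
      also have "\<dots> \<le> n powr (-13/60) * (12 * (3 + n powr (1/50)) * n powr (1/100))"
        using b(1) by (intro mult_left_mono) auto
      finally have "rate_half n * (12 * (3 + codegree_cap n) / ?c) + 400 * real n powr (-3/2) \<le> g_y n t"
        using e(8) g by linarith
      then show "rate_half n * (12 * (3 + codegree_cap n) / exp (- 4 * (time n i)\<^sup>2)) + 400 * real n powr (-3/2)
        \<le> g_y n (time n i)" by (simp add: t_def)
      have "rate_both n * (3 * (2 + sqrt n) * (2 + 4 * sqrt n) / ?c / sqrt n)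
          = n powr (-43/60) * (3 * (2 + sqrt n) * (2 + 4 * sqrt n) * (1 / ?c) / sqrt n)"
        by (simp add: rate_both_def)
      also have "\<dots> \<le> n powr (-43/60) * (3 * (2 + sqrt n) * (2 + 4 * sqrt n) * n powr (1/100) / sqrt n)"
        using b(1) by (intro mult_left_mono divide_right_mono) auto
      finally have "rate_both n * (3 * (2 + sqrt n) * (2 + 4 * sqrt n) / ?c / sqrt n) + 400 * real n powr (-3/2)
          \<le> ?c * g_y n t"
        using e(9) b(3) by linarith
      then show "rate_both n * (3 * (2 + sqrt n) * (2 + 4 * sqrt n) / exp (- 4 * (time n i)\<^sup>2) / sqrt n)
        + 400 * real n powr (-3/2) \<le> exp (- 4 * (time n i)\<^sup>2) * g_y n (time n i)" by (simp add: t_def)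
      have "12 * n powr (-3/2) * (1 / ?c) \<le> 12 * n powr (-3/2) * n powr (1/100)"
        using b(1) by (intro mult_left_mono) auto
      also have "\<dots> = rate_codegree n" unfolding rate_codegree_def mult.assoc powr_add[symmetric] by simp
      finally show "12 * real n powr (-3/2) / exp (- 4 * (time n i)\<^sup>2) \<le> rate_codegree n" by (simp add: t_def)
      have "real i = n powr (3/2) * t" using n2 by (simp add: t_def time_def)
      also have "\<dots> \<le> n powr (3/2) * (sqrt (ln n) / 32)" using tT by (intro mult_left_mono) auto
      finally have "rate_codegree n * i \<le> 12 * n powr (-149/100) * (n powr (3/2) * (sqrt (ln n) / 32))"
        unfolding rate_codegree_def by (intro mult_left_mono) auto
      then show "rate_codegree n * i \<le> codegree_cap n / 2" using e(10) by (simp add: codegree_cap_def)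
    qed
  qed
qed

text \<open>The empty graph deviates by n/2 in Q, as n choose 2 replaces n^2/2, by 2 in
  \<open>both_open\<close> and by nothing else; each is far below its tolerance.\<close>

lemma initial_potential:
  assumes n: "n \<ge> 2"
  shows "potential n 0 {} \<le> exp (n / 2 - (real n)\<^sup>2 * n powr (-1/6) / 20)
    + n * n * (2 * exp (- (n powr (-13/60) * sqrt n * n powr (-1/6) / 2))
        + 2 * exp (n powr (-43/60) * (2 - n * n powr (-1/6))) + exp (- (n powr (1/50) / 2)))"
proof -
  interpret triangle_free_graph "{..<n}" "{}" by (rule triangle_free_graph_empty) simp
  have Op: "Op = pairs {..<n}" by (auto simp: open_pairs_def closed_pair_def has_triangle_def)
  have "card Op = n choose 2" by (simp add: Op card_pairs)
  also have "real (n choose 2) = real n * (real n - 1) / 2"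
    using n by (simp add: choose_two real_of_nat_div of_nat_diff)
  finally have Q: "\<bar>real (card Op) - (real n)\<^sup>2 * q_fun (time n 0)\<bar> = n / 2"
    by (simp add: q_fun_def time_def power2_eq_square algebra_simps)
  have pair: "pair_potential n 0 {} u v \<le> 2 * exp (- (n powr (-13/60) * sqrt n * n powr (-1/6) / 2))
        + 2 * exp (n powr (-43/60) * (2 - n * n powr (-1/6))) + exp (- (n powr (1/50) / 2))"
    if uv: "u < n" "v < n" "u \<noteq> v" for u v
  proof -
    have h: "half_open {..<n} {} u v = {}" "both_edge {..<n} {} u v = {}"
      by (simp_all add: half_open_def both_edge_def)
    have "both_open {..<n} {} u v = {..<n} - {u, v}"
      using uv by (auto simp: both_open_def Op pairs_iff)
    then have b: "real (card (both_open {..<n} {} u v)) = real n - 2"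
      using uv n by (simp add: card_Diff_subset of_nat_diff)
    have "(\<Sum>\<sigma>\<in>{1, -1::real}. exp (rate_both n * (\<sigma> * (real (card (both_open {..<n} {} u v)) - n * x_fun 0) - n * g_x n 0)))
      \<le> (\<Sum>\<sigma>\<in>{1, -1::real}. exp (n powr (-43/60) * (2 - n * n powr (-1/6))))"
      unfolding b by (intro sum_mono) (auto simp: x_fun_def g_x_def rate_both_def intro!: mult_left_mono)
    then show ?thesis
      by (simp add: pair_potential_def h time_def y_fun_def g_y_def rate_half_def codegree_cap_def mult_ac)
  qed
  have "(\<Sum>(u, v)\<in>nonadjacent n {}. pair_potential n 0 {} u v)
    \<le> real (card (nonadjacent n {})) * (2 * exp (- (n powr (-13/60) * sqrt n * n powr (-1/6) / 2))
        + 2 * exp (n powr (-43/60) * (2 - n * n powr (-1/6))) + exp (- (n powr (1/50) / 2)))"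
    using pair by (intro sum_bounded_above) (auto simp: nonadjacent_def)
  also have "\<dots> \<le> real (n * n) * (2 * exp (- (n powr (-13/60) * sqrt n * n powr (-1/6) / 2))
        + 2 * exp (n powr (-43/60) * (2 - n * n powr (-1/6))) + exp (- (n powr (1/50) / 2)))"
    using card_nonadjacent_le by (intro mult_right_mono of_nat_mono add_nonneg_nonneg) auto
  finally show ?thesis
    unfolding potential_def Q by (simp add: h_q_def g_y_def time_def)
qed

lemma initial_potential_tendsto: "(\<lambda>n. potential n 0 {}) \<longlonglongrightarrow> 0"
proof (rule tendsto_sandwich[OF _ _ tendsto_const])
  show "eventually (\<lambda>n. 0 \<le> potential n 0 {}) sequentially" by (simp add: potential_nonneg)
  show "eventually (\<lambda>n. potential n 0 {} \<le> exp (n / 2 - (real n)\<^sup>2 * n powr (-1/6) / 20)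
    + n * n * (2 * exp (- (n powr (-13/60) * sqrt n * n powr (-1/6) / 2))
        + 2 * exp (n powr (-43/60) * (2 - n * n powr (-1/6))) + exp (- (n powr (1/50) / 2)))) sequentially"
    using eventually_ge_at_top[of 2] by eventually_elim (use initial_potential in simp)
  show "(\<lambda>n::nat. exp (n / 2 - (real n)\<^sup>2 * n powr (-1/6) / 20)
    + n * n * (2 * exp (- (n powr (-13/60) * sqrt n * n powr (-1/6) / 2))
        + 2 * exp (n powr (-43/60) * (2 - n * n powr (-1/6))) + exp (- (n powr (1/50) / 2)))) \<longlonglongrightarrow> 0"
    by real_asymp
qed

section \<open>Union bounds over small patterns\<close>

text \<open>Event H at one step as a property of the current graph, the form required of
  \<open>good\<close> in the supermartingale lemmas.\<close>

definition H_at :: "nat \<Rightarrow> nat \<Rightarrow> nat set set \<Rightarrow> bool" where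
  "H_at n i E \<longleftrightarrow>
        \<bar>real (card (open_pairs {..<n} E)) - (real n)\<^sup>2 * q_fun (time n i)\<bar> \<le> (real n)\<^sup>2 * g_q n (time n i) \<and>
        (\<forall>u<n. \<forall>v<n. u \<noteq> v \<and> {u, v} \<notin> E \<longrightarrow>
           \<bar>real (card (Y_set {..<n} E u v)) - sqrt (real n) * y_fun (time n i)\<bar> \<le> sqrt (real n) * g_y n (time n i))"

lemma event_H_iff: "event_H n G \<longleftrightarrow> (\<forall>i\<le>m_step n. H_at n i (G i))"
  by (simp add: event_H_def H_at_def)

lemma g_q_le_g_y: "g_q n t \<le> g_y n t"
proof (cases "t \<le> 1")
  case False
  then have "g_y n t / t \<le> g_y n t / 1" by (intro divide_left_mono) (auto simp: g_y_def)
  then show ?thesis using False by (simp add: g_q_def g_y_def)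
qed (simp add: g_q_def g_y_def)

lemma prob_good_and_at_le:
  fixes \<Phi> :: "nat \<Rightarrow> nat set set \<Rightarrow> real"
  assumes "r \<le> s"
    and "\<And>i E. i < r \<Longrightarrow> triangle_free_graph {..<n} E \<Longrightarrow> good i E \<Longrightarrow>
      measure_pmf.expectation (tf_step n E) (\<Phi> (Suc i)) \<le> \<Phi> i E"
    and "\<And>i E. 0 \<le> \<Phi> i E" and "\<And>E. triangle_free_graph {..<n} E \<Longrightarrow> R E \<Longrightarrow> b \<le> \<Phi> r E" and "b > 0"
  shows "measure_pmf.prob (tf_run n s) {G. (\<forall>i<r. good i (G i)) \<and> R (G r)} \<le> \<Phi> 0 {} / b"
proof -
  have "measure_pmf.prob (tf_run n s) {G. (\<forall>i<r. good i (G i)) \<and> R (G r)}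
      = measure_pmf.prob (tf_run n r) {G. (\<forall>i<r. good i (G i)) \<and> R (G r)}"
    by (rule prob_tf_run_marginal[OF assms(1)]) simp
  also have "\<dots> \<le> \<Phi> 0 {} / b" by (rule prob_good_and_le[OF assms(2-5)])
  finally show ?thesis .
qed

text \<open>At most n^j sets W and, for each, 2^(j choose 2) sets B; the second number is constant
  for fixed j.\<close>

lemma prob_pattern_le:
  fixes P :: "nat set \<Rightarrow> nat set set \<Rightarrow> (nat \<Rightarrow> nat set set) \<Rightarrow> bool"
  assumes p: "\<And>W B. W \<subseteq> {..<n} \<Longrightarrow> card W = j \<Longrightarrow> B \<subseteq> pairs W \<Longrightarrow> measure_pmf.prob M {G. P W B G} \<le> p"
    and p0: "0 \<le> p"
  shows "measure_pmf.prob M {G. \<exists>W\<subseteq>{..<n}. card W = j \<and> (\<exists>B\<subseteq>pairs W. P W B G)} \<le> real n ^ j * 2 ^ (j choose 2) * p"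
proof -
  define I where "I = Sigma {W. W \<subseteq> {..<n} \<and> card W = j} (\<lambda>W. Pow (pairs W))"
  have finW: "finite {W. W \<subseteq> {..<n} \<and> card W = j}" by simp
  have fin: "finite W" if "W \<subseteq> {..<n}" for W :: "nat set" using that finite_subset by blast
  have finI: "finite I"
    unfolding I_def using fin by (intro finite_SigmaI finW) (auto simp: finite_pairs)
  have "card I = (\<Sum>W\<in>{W. W \<subseteq> {..<n} \<and> card W = j}. 2 ^ (j choose 2))"
    unfolding I_def using fin
    by (subst card_SigmaI[OF finW]) (auto simp: finite_pairs card_Pow card_pairs intro!: sum.cong)
  also have "\<dots> = (n choose j) * 2 ^ (j choose 2)" by (simp add: n_subsets)
  also have "\<dots> \<le> n ^ j * 2 ^ (j choose 2)" using binomial_le_pow[of j n] by (cases "j \<le> n") (auto simp: binomial_eq_0)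
  finally have cI: "card I \<le> n ^ j * 2 ^ (j choose 2)" .
  have "{G. \<exists>W\<subseteq>{..<n}. card W = j \<and> (\<exists>B\<subseteq>pairs W. P W B G)} = (\<Union>x\<in>I. {G. P (fst x) (snd x) G})"
    unfolding set_eq_iff mem_Collect_eq UN_iff I_def Bex_def split_paired_Ex mem_Sigma_iff Pow_iff fst_conv snd_conv
    by blast
  then have "measure_pmf.prob M {G. \<exists>W\<subseteq>{..<n}. card W = j \<and> (\<exists>B\<subseteq>pairs W. P W B G)}
      \<le> (\<Sum>x\<in>I. measure_pmf.prob M {G. P (fst x) (snd x) G})"
    using measure_pmf.finite_measure_subadditive_finite[OF finI, of "\<lambda>x. {G. P (fst x) (snd x) G}" M] by simp
  also have "\<dots> \<le> real (card I) * p"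
    using p by (intro sum_bounded_above) (auto simp: I_def)
  also have "\<dots> \<le> real n ^ j * 2 ^ (j choose 2) * p"
  proof (rule mult_right_mono[OF _ p0])
    have "real (card I) \<le> real (n ^ j * 2 ^ (j choose 2))" using cI by (rule of_nat_mono)
    then show "real (card I) \<le> real n ^ j * 2 ^ (j choose 2)" by simp
  qed
  finally show ?thesis .
qed

lemma H_at_open_ge:
  assumes n: "n \<ge> 2" and i: "i \<le> m_step n" and H: "H_at n i E"
    and big: "41 / 1024 * ln n + 40 / 32 * sqrt (ln n) \<le> ln (real n) / 15"
    and c4: "n powr (-1/10) \<le> n powr (-1/100) / 22"
  shows "real (card (open_pairs {..<n} E)) \<ge> n powr (199/100) / 4"
proof -
  define t where "t = time n i"
  have tT: "0 \<le> t" "t \<le> sqrt (ln n) / 32" using time_le[OF n i] by (auto simp: t_def time_nonneg)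
  note b = trajectory_bounds[OF n tT big]
  have "exp (- 4 * t\<^sup>2) \<ge> 1 / n powr (1/100)" using b(1) n by (simp add: field_simps)
  then have c: "exp (- 4 * t\<^sup>2) \<ge> n powr (-1/100)" by (simp add: powr_minus_divide)
  have "n powr (-1/100) / 4 \<le> q_fun t - g_q n t"
    using c b(2) c4 g_q_le_g_y[of n t] powr_ge_zero[of "real n" "-1/100"] unfolding q_fun_def by linarith
  then have "(real n)\<^sup>2 * (n powr (-1/100) / 4) \<le> (real n)\<^sup>2 * (q_fun t - g_q n t)" by (intro mult_left_mono) auto
  also have "\<dots> \<le> real (card (open_pairs {..<n} E))"
    using H unfolding H_at_def t_def[symmetric] right_diff_distrib by linarith
  also have "(real n)\<^sup>2 * (n powr (-1/100) / 4) = n powr (199/100) / 4"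
  proof -
    have sq: "(real n)\<^sup>2 = n powr 2" using n by simp
    have "(real n)\<^sup>2 * n powr (-1/100) = n powr (199/100)"
      unfolding sq powr_add[symmetric] by simp
    then show ?thesis by simp
  qed
  finally show ?thesis .
qed

text \<open>An exponential moment: every pair of B that is present has weight R = n^(9/20), and a
  step raises the product on average by a factor of at most 1 + R l / Q <= exp \<kappa>. The total
  growth stays bounded because 9/20 < 199/100 - 3/2.\<close>

lemma prob_contains_le:
  assumes n: "n \<ge> 2" and s: "m_step n \<le> s"
    and big: "41 / 1024 * ln n + 40 / 32 * sqrt (ln n) \<le> ln (real n) / 15"
    and c4: "n powr (-1/10) \<le> n powr (-1/100) / 22"
    and \<kappa>: "4 * real l * n powr (-154/100) * m_step n \<le> 1"
    and B: "finite B" "card B = l"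
  shows "measure_pmf.prob (tf_run n s) {G. event_H n G \<and> B \<subseteq> G (m_step n)} \<le> exp 1 * n powr (- 9/20 * l)"
proof -
  define R where "R = real n powr (9/20)"
  define \<kappa> where "\<kappa> = 4 * real l * n powr (-154/100)"
  define \<Phi> where "\<Phi> i E = R ^ card (B \<inter> E) * exp (- \<kappa> * real i)" for i :: nat and E :: "nat set set"
  have R1: "R \<ge> 1" unfolding R_def using n by (intro ge_one_powr_ge_zero) auto
  have "measure_pmf.prob (tf_run n s) {G. event_H n G \<and> B \<subseteq> G (m_step n)}
      \<le> measure_pmf.prob (tf_run n s) {G. (\<forall>i<m_step n. H_at n i (G i)) \<and> B \<subseteq> G (m_step n)}"
    by (intro measure_pmf.finite_measure_mono) (auto simp: event_H_iff)
  also have "\<dots> \<le> \<Phi> 0 {} / (R ^ l * exp (- 1))"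
  proof (rule prob_good_and_at_le[OF s])
    fix i E assume i: "i < m_step n" and E: "triangle_free_graph {..<n} E" and H: "H_at n i E"
    interpret triangle_free_graph "{..<n}" E by fact
    let ?Q = "real (card Op)"
    have Q: "?Q \<ge> n powr (199/100) / 4" by (rule H_at_open_ge[OF n _ H big c4]) (use i in simp)
    moreover have "n powr (199/100) / 4 > 0" using n by simp
    ultimately have Qp: "?Q > 0" by linarith
    then have Ne: "Op \<noteq> {}" by auto
    have "(\<Sum>e\<in>Op. R ^ card (B \<inter> insert e E)) \<le> (\<Sum>e\<in>Op. R ^ card (B \<inter> E) * (1 + R * indicator B e))"
    proof (rule sum_mono)
      fix e assume "e \<in> Op"
      have "card (B \<inter> insert e E) \<le> Suc (card (B \<inter> E))" if "e \<in> B"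
        using that B(1) by (simp add: card_insert_if)
      then have "R ^ card (B \<inter> insert e E) \<le> R ^ Suc (card (B \<inter> E))" if "e \<in> B"
        using that R1 by (intro power_increasing)
      moreover have "R ^ Suc (card (B \<inter> E)) \<le> R ^ card (B \<inter> E) * (1 + R)" using R1 by (simp add: algebra_simps)
      ultimately show "R ^ card (B \<inter> insert e E) \<le> R ^ card (B \<inter> E) * (1 + R * indicator B e)"
        by (cases "e \<in> B") auto
    qed
    also have "\<dots> = R ^ card (B \<inter> E) * (?Q + R * card (B \<inter> Op))"
      by (simp add: sum.distrib indicator_def sum.If_cases Int_commute flip: sum_distrib_left)
    also have "\<dots> \<le> R ^ card (B \<inter> E) * (?Q + R * l)"
      using R1 B card_mono[of B "B \<inter> Op"] by (intro mult_left_mono add_left_mono) auto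
    finally have "(\<Sum>e\<in>Op. R ^ card (B \<inter> insert e E)) / ?Q \<le> R ^ card (B \<inter> E) * (1 + R * l / ?Q)"
      using Qp by (simp add: field_simps)
    also have "\<dots> \<le> R ^ card (B \<inter> E) * exp \<kappa>"
    proof (rule mult_left_mono)
      have "R * l / ?Q \<le> R * l / (n powr (199/100) / 4)"
        using Q Qp n R1 by (intro divide_left_mono) auto
      also have "\<dots> = 4 * real l * (n powr (9/20) / n powr (199/100))" by (simp add: R_def)
      also have "\<dots> = \<kappa>" unfolding \<kappa>_def powr_diff[symmetric] by simp
      finally show "1 + R * l / ?Q \<le> exp \<kappa>" using exp_ge_add_one_self[of \<kappa>] by linarith
    qed (use R1 in simp)
    finally have main: "(\<Sum>e\<in>Op. R ^ card (B \<inter> insert e E)) / ?Q \<le> R ^ card (B \<inter> E) * exp \<kappa>" .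
    have "measure_pmf.expectation (tf_step n E) (\<Phi> (Suc i)) = (\<Sum>e\<in>Op. R ^ card (B \<inter> insert e E)) / ?Q * exp (- \<kappa> * real (Suc i))"
      unfolding expectation_tf_step[OF Ne] \<Phi>_def sum_distrib_right[symmetric] by simp
    also have "\<dots> \<le> R ^ card (B \<inter> E) * exp \<kappa> * exp (- \<kappa> * real (Suc i))"
      using main by (intro mult_right_mono) auto
    also have "\<dots> = \<Phi> i E" by (simp add: \<Phi>_def algebra_simps flip: exp_add)
    finally show "measure_pmf.expectation (tf_step n E) (\<Phi> (Suc i)) \<le> \<Phi> i E" .
  next
    fix E :: "nat set set" assume "B \<subseteq> E"
    then have "B \<inter> E = B" by blast
    then show "R ^ l * exp (- 1) \<le> \<Phi> (m_step n) E"
      using \<open>4 * real l * n powr (-154/100) * m_step n \<le> 1\<close> R1 B by (auto simp: \<Phi>_def \<kappa>_def intro!: mult_left_mono)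
  qed (use R1 in \<open>auto simp: \<Phi>_def\<close>)
  also have "\<dots> = exp 1 * n powr (- 9/20 * l)"
    using n by (simp add: \<Phi>_def R_def exp_minus powr_minus field_simps powr_powr powr_realpow[symmetric])
  finally show ?thesis .
qed

text \<open>For l = 3j the bound n^(-27j/20) beats the n^j choices of W and leaves n^(-7j/20). The
  run has length at least m, to contain the events, and at least n choose 2, to have the law of the
  full process.\<close>

lemma prob_S_and_H_tendsto:
  assumes j: "j \<ge> 1"
  shows "(\<lambda>n. measure_pmf.prob (tf_run n (max (n choose 2) (m_step n))) {G. event_H n G \<and> event_S j n G}) \<longlonglongrightarrow> 0"
proof (rule tendsto_sandwich[OF _ _ tendsto_const])
  let ?u = "\<lambda>n::nat. real n ^ j * 2 ^ (j choose 2) * (exp 1 * n powr (- 9/20 * (3 * j)))"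
  show "eventually (\<lambda>n. 0 \<le> measure_pmf.prob (tf_run n (max (n choose 2) (m_step n))) {G. event_H n G \<and> event_S j n G}) sequentially"
    by simp
  have "eventually (\<lambda>n::nat. n \<ge> 2) sequentially" by (rule eventually_ge_at_top)
  moreover note eventually_trajectory_big
  moreover have "eventually (\<lambda>n::nat. n powr (-1/10) \<le> n powr (-1/100) / 22) sequentially" by real_asymp
  moreover have "eventually (\<lambda>n::nat. 4 * real (3 * j) * n powr (-154/100) * (mu * n powr (3/2) * sqrt (ln n)) \<le> 1) sequentially"
    unfolding mu_def by real_asymp
  ultimately show "eventually (\<lambda>n. measure_pmf.prob (tf_run n (max (n choose 2) (m_step n))) {G. event_H n G \<and> event_S j n G}
      \<le> ?u n) sequentially"
  proof eventually_elim
    case (elim n)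
    let ?M = "tf_run n (max (n choose 2) (m_step n))"
    have "real (m_step n) \<le> mu * n powr (3/2) * sqrt (ln n)"
      unfolding m_step_def using elim(1) by (intro of_nat_floor) (simp add: mu_def)
    then have "4 * real (3 * j) * n powr (-154/100) * m_step n
        \<le> 4 * real (3 * j) * n powr (-154/100) * (mu * n powr (3/2) * sqrt (ln n))"
      by (intro mult_left_mono) auto
    then have \<kappa>: "4 * real (3 * j) * n powr (-154/100) * m_step n \<le> 1" using elim(4) by linarith
    have "measure_pmf.prob ?M {G. event_H n G \<and> event_S j n G} \<le> measure_pmf.prob ?M {G. \<exists>W\<subseteq>{..<n}. card W = j \<and>
        (\<exists>B\<subseteq>pairs W. card B = 3 * j \<and> event_H n G \<and> B \<subseteq> G (m_step n))}"
    proof (rule measure_pmf.finite_measure_mono_AE)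
      show "AE G in ?M. G \<in> {G. event_H n G \<and> event_S j n G} \<longrightarrow> G \<in> {G. \<exists>W\<subseteq>{..<n}. card W = j \<and>
        (\<exists>B\<subseteq>pairs W. card B = 3 * j \<and> event_H n G \<and> B \<subseteq> G (m_step n))}"
      proof (rule AE_pmfI, clarify)
        fix G assume G: "G \<in> set_pmf ?M" and H: "event_H n G" and "event_S j n G"
        then obtain W where W: "W \<subseteq> {..<n}" "card W = j" "3 * j \<le> card (edges_within (G (m_step n)) W)"
          by (auto simp: event_S_def)
        then obtain B where B: "B \<subseteq> edges_within (G (m_step n)) W" "card B = 3 * j"
          using obtain_subset_with_card_n by metis
        interpret triangle_free_graph "{..<n}" "G (m_step n)" by (rule tf_run_triangle_free[OF G])
        have "B \<subseteq> pairs W" using B(1) E_pairs by (auto simp: edges_within_def pairs_def)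
        moreover have "B \<subseteq> G (m_step n)" using B(1) by (auto simp: edges_within_def)
        ultimately show "\<exists>W\<subseteq>{..<n}. card W = j \<and> (\<exists>B\<subseteq>pairs W. card B = 3 * j \<and> event_H n G \<and> B \<subseteq> G (m_step n))"
          using W B(2) H by blast
      qed
    qed simp
    also have "\<dots> \<le> ?u n"
    proof (rule prob_pattern_le)
      fix W :: "nat set" and B assume W: "W \<subseteq> {..<n}" and B: "B \<subseteq> pairs W"
      have "finite B" using W B by (meson finite_lessThan finite_pairs finite_subset)
      then show "measure_pmf.prob ?M {G. card B = 3 * j \<and> event_H n G \<and> B \<subseteq> G (m_step n)}
          \<le> exp 1 * n powr (- 9/20 * (3 * j))"
        using prob_contains_le[OF elim(1) max.cobounded2 elim(2,3) \<kappa>, of B "n choose 2"] by (cases "card B = 3 * j") auto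
    qed simp
    finally show ?case .
  qed
  have "eventually (\<lambda>n::nat. 2 ^ (j choose 2) * exp 1 * n powr (- 7/20 * j) = ?u n) sequentially"
    using eventually_gt_at_top[of 0]
  proof eventually_elim
    case (elim n)
    have "real n powr (- 7/20 * j) = n powr j * n powr (- 9/20 * (3 * j))" by (simp flip: powr_add)
    then show ?case using elim by (simp add: powr_realpow)
  qed
  moreover have "(\<lambda>n::nat. 2 ^ (j choose 2) * exp 1 * n powr (- 7/20 * real j)) \<longlonglongrightarrow> 0"
  proof -
    have "- 7/20 * real j < 0" using j by simp
    then have "(\<lambda>n::nat. n powr (- 7/20 * real j)) \<longlonglongrightarrow> 0"
      by (intro tendsto_neg_powr filterlim_real_sequentially)
    then show ?thesis using tendsto_mult_right_zero by blast
  qed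
  ultimately show "?u \<longlonglongrightarrow> 0" using Lim_transform_eventually by fast
qed

section \<open>Patterns of open pairs\<close>

text \<open>\<open>closers\<close> of a pair given as a set, without naming its endpoints, so that
  it can be united over a pattern.\<close>

definition killers :: "'a set \<Rightarrow> 'a set set \<Rightarrow> 'a set \<Rightarrow> 'a set set" where
  "killers V E p = {e \<in> open_pairs V E. e \<noteq> p \<and> p \<notin> open_pairs V (insert e E)}"

text \<open>The failure of S_2k for a single graph, as 6k is 3 times 2k.\<close>

definition locally_sparse :: "nat \<Rightarrow> 'a set \<Rightarrow> 'a set set \<Rightarrow> bool" where
  "locally_sparse k V E \<longleftrightarrow> \<not> (\<exists>W\<subseteq>V. card W = 2 * k \<and> 6 * k \<le> card (edges_within E W))"

context triangle_free_graph
begin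

lemma open_pairs_antimono:
  assumes "triangle_free_graph V E'" "E \<subseteq> E'"
  shows "open_pairs V E' \<subseteq> Op"
proof
  interpret E': triangle_free_graph V E' by fact
  fix p assume p: "p \<in> open_pairs V E'"
  then obtain u v where uv: "p = {u, v}" by (rule E'.openE)
  show "p \<in> Op" using p assms(2) unfolding uv E'.open_iff open_iff by blast
qed

lemma finite_killers [simp]: "finite (killers V E p)"
  by (simp add: killers_def)

lemma killers_eq_closers:
  assumes "{u, v} \<in> Op"
  shows "killers V E {u, v} = closers V E u v"
  using open_insert_iff[of _ u v] assms self_notin_closers[of u v]
  by (auto simp: killers_def closers_iff)

text \<open>Any k such vertices together with W would form a 2k-set with at least 6k edges, all
  running between W and the new vertices.\<close>

lemma few_rich_vertices:
  assumes W: "W \<subseteq> V" "card W = k" and sparse: "locally_sparse k V E"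
  shows "card {w \<in> V - W. 6 \<le> card {x \<in> W. {x, w} \<in> E}} < k"
proof (rule ccontr)
  let ?D = "{w \<in> V - W. 6 \<le> card {x \<in> W. {x, w} \<in> E}}"
  assume "\<not> card ?D < k"
  then have "k \<le> card ?D" by simp
  then obtain D where D: "D \<subseteq> ?D" "card D = k" by (rule obtain_subset_with_card_n)
  have finW: "finite W" by (rule finite_subset[OF W(1) finite_V])
  have finD: "finite D" by (rule finite_subset[OF D(1)]) (simp add: finite_V)
  have sub: "W \<union> D \<subseteq> V" using W D by blast
  have "W \<inter> D = {}" using D by blast
  then have card2: "card (W \<union> D) = 2 * k" using finW finD W D by (simp add: card_Un_disjoint)
  let ?N = "\<lambda>w. (\<lambda>x. {x, w}) ` {x \<in> W. {x, w} \<in> E}"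
  have inj: "inj_on (\<lambda>x. {x, w}) X" for w X
    by (auto simp: inj_on_def doubleton_eq_iff)
  have "6 * k \<le> (\<Sum>w\<in>D. card (?N w))"
  proof -
    have "(\<Sum>w\<in>D. 6) \<le> (\<Sum>w\<in>D. card (?N w))"
      using D by (intro sum_mono) (auto simp: card_image[OF inj])
    then show ?thesis using D(2) by simp
  qed
  also have "\<dots> = card (\<Union>w\<in>D. ?N w)"
  proof (rule card_UN_disjoint[symmetric])
    show "\<forall>i\<in>D. \<forall>j\<in>D. i \<noteq> j \<longrightarrow> ?N i \<inter> ?N j = {}"
      using \<open>W \<inter> D = {}\<close> by (auto simp: doubleton_eq_iff)
  qed (use finD finW in auto)
  also have "\<dots> \<le> card (edges_within E (W \<union> D))"
    by (rule card_mono) (auto simp: edges_within_def finite_E)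
  finally show False using sparse sub card2 unfolding locally_sparse_def by blast
qed

text \<open>Let D be the vertices outside W with at least 6 neighbours in W. A pair {x, w} with x in
  W and w outside W and D kills only pattern pairs {x, y} with y adjacent to w, at most 5 of them.
  Any other killer of p joins an endpoint of p to W or D, and there are at most 2 times 2k such
  pairs.\<close>

lemma sum_killers_le:
  assumes W: "W \<subseteq> V" "card W = k" and B: "B \<subseteq> pairs W" "B \<subseteq> Op" and sparse: "locally_sparse k V E"
  shows "(\<Sum>p\<in>B. card (killers V E p)) \<le> 5 * card (\<Union>p\<in>B. killers V E p) + card B * (4 * k)"
proof -
  define D where "D = {w \<in> V - W. 6 \<le> card {x \<in> W. {x, w} \<in> E}}"
  define U where "U = (\<Union>p\<in>B. killers V E p)"
  define N where "N = {{x, w} |x w. x \<in> W \<and> w \<in> V - (W \<union> D)}"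
  have finW: "finite W" by (rule finite_subset[OF W(1) finite_V])
  have finB: "finite B" by (rule finite_subset[OF B(2)]) simp
  have finU: "finite U" unfolding U_def using finB by (auto simp: killers_def)
  have finD: "finite D" by (simp add: D_def finite_V)
  have WD: "card (W \<union> D) \<le> 2 * k"
  proof -
    have "card D < k" unfolding D_def by (rule few_rich_vertices[OF W sparse])
    then show ?thesis using card_Un_le[of W D] W(2) by linarith
  qed
  have rest: "card (killers V E p - N) \<le> 4 * k" if p: "p \<in> B" for p
  proof -
    obtain u v where uv: "p = {u, v}" "u \<in> W" "v \<in> W" using p B(1) pairsE by blast
    have "killers V E p - N \<subseteq> (\<lambda>z. {u, z}) ` (W \<union> D) \<union> (\<lambda>z. {v, z}) ` (W \<union> D)"
    proof
      fix e assume e: "e \<in> killers V E p - N"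
      then have "e \<in> closers V E u v" using killers_eq_closers[of u v] p B(2) uv by auto
      then obtain z where z: "e = {u, z} \<or> e = {v, z}" "e \<in> Op" by (auto simp: closers_iff)
      then have "z \<in> V" by (auto simp: open_iff)
      then have "z \<in> W \<union> D" using e z(1) uv unfolding N_def by blast
      then show "e \<in> (\<lambda>z. {u, z}) ` (W \<union> D) \<union> (\<lambda>z. {v, z}) ` (W \<union> D)" using z(1) by blast
    qed
    then have "card (killers V E p - N) \<le> card ((\<lambda>z. {u, z}) ` (W \<union> D) \<union> (\<lambda>z. {v, z}) ` (W \<union> D))"
      by (intro card_mono) (use finW finD in auto)
    also have "\<dots> \<le> card (W \<union> D) + card (W \<union> D)"
      by (intro order_trans[OF card_Un_le] add_mono card_image_le) (use finW finD in auto)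
    finally show ?thesis using WD by linarith
  qed
  have main: "(\<Sum>p\<in>B. card (killers V E p \<inter> N)) \<le> 5 * card U"
  proof -
    have "(\<Sum>p\<in>B. card (killers V E p \<inter> N)) = (\<Sum>e\<in>U. card {p \<in> B. e \<in> killers V E p \<inter> N})"
      by (rule sum_card_swap[symmetric]) (auto simp: finB finU U_def)
    also have "\<dots> \<le> (\<Sum>e\<in>U. 5)"
    proof (rule sum_mono)
      fix e assume "e \<in> U"
      show "card {p \<in> B. e \<in> killers V E p \<inter> N} \<le> 5"
      proof (cases "e \<in> N")
        case True
        then obtain x w where xw: "e = {x, w}" "x \<in> W" "w \<in> V" "w \<notin> W" "w \<notin> D" unfolding N_def by blast
        have "{p \<in> B. e \<in> killers V E p \<inter> N} \<subseteq> (\<lambda>y. {x, y}) ` {y \<in> W. {y, w} \<in> E}"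
        proof
          fix p assume p: "p \<in> {p \<in> B. e \<in> killers V E p \<inter> N}"
          then obtain u v where uv: "p = {u, v}" "u \<in> W" "v \<in> W" using B(1) pairsE by blast
          have xwO: "{x, w} \<in> Op" using p xw(1) by (auto simp: killers_def)
          have "{x, w} \<in> closers V E u v" using p killers_eq_closers[of u v] B(2) uv xw(1) by auto
          then have "x = u \<and> {v, w} \<in> E \<or> x = v \<and> {u, w} \<in> E"
            unfolding closers_pair_iff[OF xwO] using xw uv by auto
          then show "p \<in> (\<lambda>y. {x, y}) ` {y \<in> W. {y, w} \<in> E}"
            using uv by (auto simp: insert_commute)
        qed
        then have "card {p \<in> B. e \<in> killers V E p \<inter> N} \<le> card ((\<lambda>y. {x, y}) ` {y \<in> W. {y, w} \<in> E})"
          by (intro card_mono) (use finW in auto)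
        also have "\<dots> \<le> card {y \<in> W. {y, w} \<in> E}" by (rule card_image_le) (use finW in simp)
        also have "\<dots> \<le> 5" using xw unfolding D_def by auto
        finally show ?thesis .
      qed simp
    qed
    finally show ?thesis by simp
  qed
  have "(\<Sum>p\<in>B. card (killers V E p)) \<le> (\<Sum>p\<in>B. card (killers V E p \<inter> N) + 4 * k)"
  proof (rule sum_mono)
    fix p assume p: "p \<in> B"
    have "card (killers V E p) = card (killers V E p \<inter> N) + card (killers V E p - N)"
      by (subst card_Un_disjoint[symmetric]) (auto simp: killers_def Int_Diff_Un)
    then show "card (killers V E p) \<le> card (killers V E p \<inter> N) + 4 * k" using rest[OF p] by linarith
  qed
  also have "\<dots> = (\<Sum>p\<in>B. card (killers V E p \<inter> N)) + card B * (4 * k)" by (simp add: sum.distrib)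
  finally show ?thesis using main unfolding U_def by linarith
qed

end

text \<open>On the exact trajectories a pair has 4tc sqrt n killers among n^2 c/2 open pairs, a
  factor 8t instead of 4t - 1. The slack absorbs the deviations f <= c/22 and the overlap 4k <= f
  sqrt n; for 4t <= 1 the bound is trivial.\<close>

lemma killers_rate:
  fixes b :: real
  assumes large: "large n" and i: "i < m_step n" and E: "triangle_free_graph {..<n} E" and H: "H_at n i E"
    and k: "4 * real k \<le> sqrt n * n powr (-1/6)"
    and W: "W \<subseteq> {..<n}" "card W = k" and B: "B \<subseteq> pairs W" "B \<subseteq> open_pairs {..<n} E"
    and sparse: "locally_sparse k {..<n} E"
    and t: "t = time n i"
  shows "real (card B) / 5 * (n powr (-3/2) * (4 * t - 1)) * card (open_pairs {..<n} E)
    \<le> real (card (\<Union>p\<in>B. killers {..<n} E p))"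
proof (cases "4 * t \<le> 1")
  case True
  then have "real (card B) / 5 * (n powr (-3/2) * (4 * t - 1)) * card (open_pairs {..<n} E) \<le> 0"
    by (intro mult_nonpos_nonneg mult_nonneg_nonpos) auto
  then show ?thesis by (rule order_trans) simp
next
  case False
  interpret triangle_free_graph "{..<n}" E by fact
  define c where "c = exp (- 4 * t\<^sup>2)"
  define f where "f = g_y n t"
  define S where "S = sqrt (real n)"
  define U where "U = (\<Union>p\<in>B. killers {..<n} E p)"
  have n: "n \<ge> 400" using large by (simp add: large_def)
  have t0: "0 \<le> t" by (simp add: t time_nonneg)
  have f: "0 < f" "f \<le> c / 22" and c: "0 < c"
    using large i n by (auto simp: large_def Let_def t c_def f_def g_y_def)
  have f6: "n powr (-1/6) \<le> f"
    unfolding f_def g_y_def using t0 by (simp add: mult_le_cancel_right1)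
  have S: "0 < S" "S * S = n" using n by (simp_all add: S_def)
  have kSf: "4 * real k \<le> S * f"
  proof -
    have "S * n powr (-1/6) \<le> S * f" using f6 S by (intro mult_left_mono) auto
    then show ?thesis using k unfolding S_def by linarith
  qed
  have lower: "S * (4 * t * c) - S * f \<le> real (card (killers {..<n} E p))" if p: "p \<in> B" for p
  proof -
    have "p \<in> Op" using p B by blast
    then obtain u v where uv: "p = {u, v}" "u \<in> {..<n}" "v \<in> {..<n}" "u \<noteq> v" by (rule openE)
    then have nE: "{u, v} \<notin> E" "{u, v} \<in> Op" using \<open>p \<in> Op\<close> by (auto simp: open_iff)
    have "\<bar>real (card (Y_set {..<n} E u v)) - S * y_fun t\<bar> \<le> S * f"
      using H uv nE unfolding H_at_def t S_def f_def by auto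
    moreover have "card (Y_set {..<n} E u v) = card (killers {..<n} E p)"
      using card_Y_set[OF uv(4) nE(1)] card_closers[OF uv(4)] killers_eq_closers[OF nE(2)] uv(1) by simp
    ultimately show ?thesis by (simp add: y_fun_def c_def abs_le_iff)
  qed
  have "real (card B) * (S * (4 * t * c) - S * f) \<le> (\<Sum>p\<in>B. real (card (killers {..<n} E p)))"
    using lower by (intro sum_bounded_below) auto
  also have "\<dots> \<le> real (5 * card U + card B * (4 * k))"
    using sum_killers_le[OF W B sparse] unfolding U_def of_nat_sum[symmetric] of_nat_le_iff .
  also have "\<dots> = 5 * real (card U) + real (card B) * (4 * real k)" by simp
  also have "\<dots> \<le> 5 * real (card U) + real (card B) * (S * f)"
    using kSf by (intro add_left_mono mult_left_mono) auto
  finally have "real (card B) * (S * (4 * t * c) - S * f) - real (card B) * (S * f) \<le> 5 * real (card U)" by linarith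
  then have U5: "real (card B) / 5 * (S * (4 * t * c - 2 * f)) \<le> real (card U)"
    by (simp add: algebra_simps)
  have "g_q n t \<le> f" using g_q_le_g_y by (simp add: f_def)
  then have "(real n)\<^sup>2 * g_q n t \<le> (real n)\<^sup>2 * f" by (intro mult_left_mono) auto
  then have Q: "real (card Op) \<le> (real n)\<^sup>2 * (c / 2 + f)"
    using H unfolding H_at_def t[symmetric] distrib_left by (simp add: q_fun_def c_def abs_le_iff)
  have "n powr (-3/2) = n powr (1/2) * n powr (-2)" by (simp flip: powr_add)
  then have \<delta>: "n powr (-3/2) * (real n)\<^sup>2 = S"
    using n by (simp add: powr_half_sqrt powr_minus S_def field_simps)
  have "(4 * t - 1) * (c / 2 + f) \<le> 4 * t * c - 2 * f"
  proof -
    have "t * f \<le> t * (c / 22)" using f t0 by (intro mult_left_mono)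
    moreover have "0 \<le> t * c" using t0 c by simp
    ultimately have "4 * (t * f) + f \<le> 2 * (t * c) + c / 2" using f by linarith
    then show ?thesis by (simp add: algebra_simps)
  qed
  then have Sle: "S * ((4 * t - 1) * (c / 2 + f)) \<le> S * (4 * t * c - 2 * f)" using S by (intro mult_left_mono) auto
  have "real (card B) / 5 * (n powr (-3/2) * (4 * t - 1)) * card Op
      \<le> real (card B) / 5 * (n powr (-3/2) * (4 * t - 1)) * ((real n)\<^sup>2 * (c / 2 + f))"
    using Q False by (intro mult_left_mono) auto
  also have "\<dots> = real (card B) / 5 * ((n powr (-3/2) * (real n)\<^sup>2) * ((4 * t - 1) * (c / 2 + f)))"
    by (simp only: mult_ac)
  also have "\<dots> \<le> real (card B) / 5 * (S * (4 * t * c - 2 * f))"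
    unfolding \<delta> by (rule mult_left_mono) (use Sle in auto)
  also note U5
  finally show ?thesis unfolding U_def .
qed

text \<open>A pair that stops being open never becomes open again, so the weighted indicator of
  survival stays 0 once it is 0. While the pattern survives, the exponent of its weight grows by no
  more than the probability of hitting a killer.\<close>

lemma prob_open_pattern_le:
  assumes large: "large n" and s: "m_step n \<le> s" and k: "4 * real k \<le> sqrt n * n powr (-1/6)"
    and W: "W \<subseteq> {..<n}" "card W = k" and B: "B \<subseteq> pairs W"
  shows "measure_pmf.prob (tf_run n s)
      {G. (\<forall>i<m_step n. H_at n i (G i) \<and> locally_sparse k {..<n} (G i)) \<and> B \<subseteq> open_pairs {..<n} (G (m_step n))}
    \<le> exp (- (real (card B) / 5 * (2 * (time n (m_step n))\<^sup>2 - 2 * time n (m_step n))))"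
proof -
  define \<beta> where "\<beta> = real (card B) / 5"
  \<comment> \<open>The derivative is 4t - 2, not 4t - 1: the slack pays for the term 2d in the
    discrete increment d (4t + 2d - 2).\<close>
  define h where "h t = 2 * t\<^sup>2 - 2 * t" for t :: real
  define \<Phi> where "\<Phi> i E = (if B \<subseteq> open_pairs {..<n} E then exp (\<beta> * h (time n i)) else 0)" for i E
  have n: "n \<ge> 400" using large by (simp add: large_def)
  have "measure_pmf.prob (tf_run n s)
      {G. (\<forall>i<m_step n. H_at n i (G i) \<and> locally_sparse k {..<n} (G i)) \<and> B \<subseteq> open_pairs {..<n} (G (m_step n))}
    \<le> \<Phi> 0 {} / exp (\<beta> * h (time n (m_step n)))"
  proof (rule prob_good_and_at_le[OF s])
    fix i E assume i: "i < m_step n" and E: "triangle_free_graph {..<n} E"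
      and good: "H_at n i E \<and> locally_sparse k {..<n} E"
    interpret triangle_free_graph "{..<n}" E by fact
    define t where "t = time n i"
    define d where "d = real n powr (-3/2)"
    let ?Q = "real (card Op)"
    show "measure_pmf.expectation (tf_step n E) (\<Phi> (Suc i)) \<le> \<Phi> i E"
    proof (cases "B \<subseteq> Op")
      case True
      show ?thesis
      proof (cases "Op = {}")
        case False
        then have Qp: "?Q > 0" by (simp add: card_gt_0_iff)
        define U where "U = (\<Union>p\<in>B. killers {..<n} E p)"
        have U_sub: "U \<subseteq> Op" by (auto simp: U_def killers_def)
        have "measure_pmf.expectation (tf_step n E) (\<Phi> (Suc i)) = (\<Sum>e\<in>Op. \<Phi> (Suc i) (insert e E)) / ?Q"
          by (rule expectation_tf_step[OF False])
        also have "\<dots> \<le> (\<Sum>e\<in>Op. if e \<in> U then 0 else exp (\<beta> * h (time n (Suc i)))) / ?Q"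
        proof (intro divide_right_mono sum_mono)
          fix e assume "e \<in> Op"
          show "\<Phi> (Suc i) (insert e E) \<le> (if e \<in> U then 0 else exp (\<beta> * h (time n (Suc i))))"
            unfolding \<Phi>_def U_def killers_def by auto
        qed simp
        also have "\<dots> = (1 - card U / ?Q) * exp (\<beta> * h (time n (Suc i)))"
        proof -
          let ?w = "exp (\<beta> * h (time n (Suc i)))"
          have "card (Op \<inter> - U) = card Op - card U"
            using card_Diff_subset[of U Op] U_sub finite_subset[OF U_sub] by (simp add: Diff_eq)
          then have c: "real (card (Op \<inter> - U)) = ?Q - card U"
            using card_mono[OF finite_Op U_sub] by (simp add: of_nat_diff)
          have "(\<Sum>e\<in>Op. if e \<in> U then 0 else ?w) = real (card (Op \<inter> - U)) * ?w"
            by (simp add: sum.If_cases)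
          then have "(\<Sum>e\<in>Op. if e \<in> U then 0 else ?w) = (?Q - card U) * ?w" unfolding c .
          moreover have "(?Q - card U) * ?w / ?Q = (1 - card U / ?Q) * ?w"
            using Qp False by (simp add: left_diff_distrib diff_divide_distrib)
          ultimately show ?thesis by simp
        qed
        also have "\<dots> \<le> exp (- (card U / ?Q)) * exp (\<beta> * h (time n (Suc i)))"
          using exp_ge_add_one_self[of "- (card U / ?Q)"] by (intro mult_right_mono) auto
        also have "\<dots> = exp (\<beta> * h (time n (Suc i)) - card U / ?Q)" by (simp flip: exp_add)
        also have "\<dots> \<le> exp (\<beta> * h t)"
        proof -
          have d: "0 < d" "2 * d \<le> 1"
          proof -
            show "0 < d" using n by (simp add: d_def)
            have "real n powr (-3/2) \<le> real n powr (-1)" using n by (intro powr_mono) auto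
            then show "2 * d \<le> 1" using n by (simp add: d_def powr_minus field_simps)
          qed
          have "h (t + d) - h t = d * (4 * t + 2 * d - 2)"
            by (simp add: h_def power2_eq_square algebra_simps)
          also have "\<dots> \<le> d * (4 * t - 1)" using d by (intro mult_left_mono) auto
          finally have "\<beta> * (h (t + d) - h t) \<le> \<beta> * (d * (4 * t - 1))"
            by (intro mult_left_mono) (auto simp: \<beta>_def)
          also have "\<dots> \<le> card U / ?Q"
            using killers_rate[OF large i E _ k W B True _ t_def] good Qp
            unfolding \<beta>_def d_def U_def by (subst pos_le_divide_eq) auto
          finally show ?thesis unfolding time_Suc t_def[symmetric] d_def[symmetric] by (simp add: right_diff_distrib)
        qed
        finally show ?thesis using True by (simp add: \<Phi>_def t_def)
      next
        \<comment> \<open>No open pair is left, so B is empty, \<beta> = 0 and both sides equal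
          1.\<close>
        case empty: True
        then have "B = {}" using True by blast
        then show ?thesis using empty by (simp add: tf_step_def \<Phi>_def \<beta>_def)
      qed
    next
      case False
      have "\<Phi> (Suc i) E' = 0" if E': "E' \<in> set_pmf (tf_step n E)" for E'
      proof -
        have "open_pairs {..<n} E' \<subseteq> Op"
          using open_pairs_antimono triangle_free_graph_step[OF E E'] by blast
        then show ?thesis using False by (auto simp: \<Phi>_def)
      qed
      then have "measure_pmf.expectation (tf_step n E) (\<Phi> (Suc i)) = measure_pmf.expectation (tf_step n E) (\<lambda>_. 0)"
        by (intro integral_cong_AE) (auto simp: AE_measure_pmf_iff)
      then show ?thesis using False by (simp add: \<Phi>_def)
    qed
  qed (auto simp: \<Phi>_def)
  also have "\<dots> \<le> 1 / exp (\<beta> * h (time n (m_step n)))"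
    by (intro divide_right_mono) (auto simp: \<Phi>_def h_def time_def)
  also have "\<dots> = exp (- (\<beta> * h (time n (m_step n))))" by (simp add: exp_minus field_simps)
  finally show ?thesis unfolding \<beta>_def h_def .
qed

text \<open>A copy edge absent at step m is inserted later, so it is open at step m: a common
  neighbour of its endpoints would give a triangle in the graph containing the copy. The failure of
  S_k leaves fewer than 3k copy edges present at step m.\<close>

lemma copy_imp_open_pattern:
  fixes VF :: "'b set" and EF :: "'b set set"
  assumes F: "finite VF" "card VF = k" "EF \<subseteq> pairs VF" "card EF = e"
    and G: "G \<in> set_pmf (tf_run n s)" and T: "event_T VF EF n G" and S: "\<not> event_S k n G"
  shows "\<exists>W\<subseteq>{..<n}. card W = k \<and>
     (\<exists>B\<subseteq>pairs W. e < card B + 3 * k \<and> B \<subseteq> open_pairs {..<n} (G (m_step n)))"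
proof -
  obtain i f where f: "inj_on f VF" "f ` VF \<subseteq> {..<n}" "\<And>u v. {u, v} \<in> EF \<Longrightarrow> {f u, f v} \<in> G i"
    using T by (auto simp: event_T_def has_copy_def)
  interpret M: triangle_free_graph "{..<n}" "G (m_step n)" by (rule tf_run_triangle_free[OF G])
  interpret I: triangle_free_graph "{..<n}" "G i" by (rule tf_run_triangle_free[OF G])
  define W where "W = f ` VF"
  define A where "A = (\<lambda>p. f ` p) ` EF"
  define B where "B = A - G (m_step n)"
  have W: "W \<subseteq> {..<n}" "card W = k" using f F by (auto simp: W_def card_image)
  have A_sub: "A \<subseteq> pairs W"
  proof
    fix p assume "p \<in> A"
    then obtain q where q: "q \<in> EF" "p = f ` q" by (auto simp: A_def)
    then obtain u v where uv: "q = {u, v}" "u \<in> VF" "v \<in> VF" "u \<noteq> v" using F(3) pairsE by blast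
    then show "p \<in> pairs W" using q f(1) by (auto simp: pairs_iff W_def inj_on_def)
  qed
  have A_G: "A \<subseteq> G i"
  proof
    fix p assume "p \<in> A"
    then obtain q where q: "q \<in> EF" "p = f ` q" by (auto simp: A_def)
    then obtain u v where "q = {u, v}" using F(3) pairsE by blast
    then show "p \<in> G i" using q f(3)[of u v] by auto
  qed
  have "EF \<subseteq> Pow VF" using F(3) by (auto simp: pairs_def)
  then have "inj_on ((`) f) EF" using inj_on_image_Pow[OF f(1)] inj_on_subset by blast
  then have cA: "card A = e" by (simp add: A_def card_image F(4))
  have finA: "finite A" using A_G I.finite_E finite_subset by blast
  have "card (A \<inter> G (m_step n)) \<le> card (edges_within (G (m_step n)) W)"
    using A_sub M.finite_E by (intro card_mono) (auto simp: edges_within_def pairs_def)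
  also have "\<dots> < 3 * k" using S W by (auto simp: event_S_def not_le)
  finally have "e < card B + 3 * k"
    using card_Int_Diff[OF finA, of "G (m_step n)"] cA unfolding B_def by linarith
  moreover have "B \<subseteq> open_pairs {..<n} (G (m_step n))"
  proof
    fix p assume p: "p \<in> B"
    then have pI: "p \<in> G i" "p \<notin> G (m_step n)" using A_G by (auto simp: B_def)
    \<comment> \<open>As p is in \<open>G i\<close> but not in \<open>G (m_step n)\<close>,
      monotonicity forces i to be the later step.\<close>
    then have sub: "G (m_step n) \<subseteq> G i"
      using tf_run_mono[OF G, of i "m_step n"] tf_run_mono[OF G, of "m_step n" i] by (meson nat_le_linear subsetD)
    obtain u v where uv: "p = {u, v}" using pI(1) I.E_pairs pairsE by blast
    have "u < n" "v < n" "u \<noteq> v" using I.edgeD[of u v] pI(1) uv by auto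
    moreover have "{v, z} \<notin> G (m_step n)" if "{u, z} \<in> G (m_step n)" for z
      using I.edge_triangle[of u v z] pI(1) uv sub that by blast
    ultimately show "p \<in> open_pairs {..<n} (G (m_step n))"
      using pI(2) unfolding uv M.open_iff by auto
  qed
  moreover have "B \<subseteq> pairs W" using A_sub by (auto simp: B_def)
  ultimately show ?thesis using W by blast
qed

lemma locally_sparse_of_not_S:
  assumes G: "G \<in> set_pmf (tf_run n s)" and S: "\<not> event_S (2 * k) n G" and i: "i \<le> m_step n"
  shows "locally_sparse k {..<n} (G i)"
  unfolding locally_sparse_def
proof (rule notI, elim exE conjE)
  fix W assume W: "W \<subseteq> {..<n}" "card W = 2 * k" "6 * k \<le> card (edges_within (G i) W)"
  interpret triangle_free_graph "{..<n}" "G (m_step n)" by (rule tf_run_triangle_free[OF G])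
  have "edges_within (G i) W \<subseteq> edges_within (G (m_step n)) W"
    using tf_run_mono[OF G i] by (auto simp: edges_within_def)
  then have "card (edges_within (G i) W) \<le> card (edges_within (G (m_step n)) W)"
    by (rule card_mono[rotated]) (simp add: edges_within_def finite_E)
  then show False using W S by (auto simp: event_S_def)
qed

text \<open>Rounding m down shifts the time by at most n^(-3/2), crudely replaced by 1.\<close>

lemma time_m_step_ge:
  assumes n: "n \<ge> 2"
  shows "sqrt (ln n) / 32 - 1 \<le> time n (m_step n)"
proof -
  have p: "1 \<le> n powr (3/2)" using n by (intro ge_one_powr_ge_zero) auto
  have "(sqrt (ln n) / 32 - 1) * n powr (3/2) \<le> mu * n powr (3/2) * sqrt (ln n) - 1"
    using p by (simp add: mu_def algebra_simps)
  also have "\<dots> \<le> m_step n" by (rule m_step_ge)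
  finally show ?thesis using n by (simp add: time_def pos_le_divide_eq)
qed

lemma prob_T_bound:
  fixes VF :: "'b set" and EF :: "'b set set"
  assumes F: "finite VF" "card VF = k" "EF \<subseteq> pairs VF" "card EF = e"
    and e: "real e \<ge> 10 * real k / mu\<^sup>2"
    and large: "large n" and s: "m_step n \<le> s" and k4: "4 * real k \<le> sqrt n * n powr (-1/6)"
    and T1: "7 \<le> sqrt (ln n) / 32"
  shows "measure_pmf.prob (tf_run n s)
      {G. event_T VF EF n G \<and> \<not> event_S k n G \<and> \<not> event_S (2 * k) n G \<and> event_H n G}
    \<le> real n ^ k * 2 ^ (k choose 2) * n powr (- 2 * real k)"
proof -
  define M where "M = tf_run n s"
  define t where "t = time n (m_step n)"
  define good where "good G \<longleftrightarrow> (\<forall>i<m_step n. H_at n i (G i) \<and> locally_sparse k {..<n} (G i))" for G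
  have n: "n \<ge> 400" using large by (simp add: large_def)
  have "measure_pmf.prob M {G. event_T VF EF n G \<and> \<not> event_S k n G \<and> \<not> event_S (2 * k) n G \<and> event_H n G}
    \<le> measure_pmf.prob M {G. \<exists>W\<subseteq>{..<n}. card W = k \<and>
        (\<exists>B\<subseteq>pairs W. e < card B + 3 * k \<and> good G \<and> B \<subseteq> open_pairs {..<n} (G (m_step n)))}"
  proof (rule measure_pmf.finite_measure_mono_AE)
    show "AE G in M. G \<in> {G. event_T VF EF n G \<and> \<not> event_S k n G \<and> \<not> event_S (2 * k) n G \<and> event_H n G} \<longrightarrow>
       G \<in> {G. \<exists>W\<subseteq>{..<n}. card W = k \<and>
        (\<exists>B\<subseteq>pairs W. e < card B + 3 * k \<and> good G \<and> B \<subseteq> open_pairs {..<n} (G (m_step n)))}"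
    proof (rule AE_pmfI, intro impI CollectI, elim CollectE conjE)
      fix G assume G: "G \<in> set_pmf M" and ev: "event_T VF EF n G" "\<not> event_S k n G" "\<not> event_S (2 * k) n G" "event_H n G"
      have "good G"
        using ev(4) locally_sparse_of_not_S[OF G[unfolded M_def] ev(3)] by (auto simp: good_def event_H_iff)
      then show "\<exists>W\<subseteq>{..<n}. card W = k \<and>
        (\<exists>B\<subseteq>pairs W. e < card B + 3 * k \<and> good G \<and> B \<subseteq> open_pairs {..<n} (G (m_step n)))"
        using copy_imp_open_pattern[OF F G[unfolded M_def] ev(1,2)] by blast
    qed
  qed simp
  also have "\<dots> \<le> real n ^ k * 2 ^ (k choose 2) * n powr (- 2 * real k)"
  proof (rule prob_pattern_le)
    fix W :: "nat set" and B assume W: "W \<subseteq> {..<n}" "card W = k" and B: "B \<subseteq> pairs W"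
    show "measure_pmf.prob M {G. e < card B + 3 * k \<and> good G \<and> B \<subseteq> open_pairs {..<n} (G (m_step n))}
        \<le> n powr (- 2 * real k)"
    proof (cases "e < card B + 3 * k")
      case True
      then have "real e < real (card B) + 3 * real k"
        by (metis of_nat_add of_nat_less_iff of_nat_mult of_nat_numeral)
      \<comment> \<open>e >= 10240k and the loss of 3k edges leave more than 10000k pairs in
        B.\<close>
      then have b: "2000 * real k \<le> real (card B) / 5"
        using e by (simp add: mu_def power2_eq_square)
      have tge: "sqrt (ln n) / 32 - 1 \<le> t" using time_m_step_ge[of n] n by (simp add: t_def)
      have "(sqrt (ln n) / 32 - 1) * ((sqrt (ln n) / 32 - 1) - 1) \<le> t * (t - 1)"
        using tge T1 by (intro mult_mono) auto
      \<comment> \<open>With a = sqrt(log n)/32 the right side is 2a^2 - 6a + 4. For a >= 7 it is at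
        least 8a^2/7, while log n / 1000 = 1.024 a^2.\<close>
      moreover have "ln n / 1000 \<le> 2 * ((sqrt (ln n) / 32 - 1) * ((sqrt (ln n) / 32 - 1) - 1))"
      proof -
        define a where "a = sqrt (ln (real n)) / 32"
        have a7: "7 \<le> a" using T1 by (simp add: a_def)
        then have "7 * a \<le> a * a" by (intro mult_right_mono) auto
        moreover have "ln n / 1000 = 1024 / 1000 * (a * a)" using n by (simp add: a_def)
        moreover have "(a - 1) * ((a - 1) - 1) = a * a - 3 * a + 2" by (simp add: algebra_simps)
        ultimately have "ln n / 1000 \<le> 2 * ((a - 1) * ((a - 1) - 1))" using a7 by linarith
        then show ?thesis unfolding a_def .
      qed
      moreover have "2 * t\<^sup>2 - 2 * t = 2 * (t * (t - 1))" by (simp add: power2_eq_square algebra_simps)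
      ultimately have "ln n / 1000 \<le> 2 * t\<^sup>2 - 2 * t" by linarith
      then have "2000 * real k * (ln n / 1000) \<le> real (card B) / 5 * (2 * t\<^sup>2 - 2 * t)"
        using b n by (intro mult_mono) auto
      then have "exp (- (real (card B) / 5 * (2 * t\<^sup>2 - 2 * t))) \<le> exp (- (2 * real k * ln n))" by simp
      also have "\<dots> = n powr (- 2 * real k)" using n by (simp add: powr_def)
      finally have "exp (- (real (card B) / 5 * (2 * t\<^sup>2 - 2 * t))) \<le> n powr (- 2 * real k)" .
      then show ?thesis
        using prob_open_pattern_le[OF large s k4 W B] True unfolding M_def good_def t_def by simp
    qed simp
  qed simp
  finally show ?thesis unfolding M_def .
qed

theorem theorem3:
  fixes VF :: "'b set" and EF :: "'b set set" and k e :: nat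
  assumes "k \<ge> 1"
    and "finite VF" and "card VF = k"
    and "EF \<subseteq> pairs VF" and "card EF = e"
    and "real e \<ge> 10 * real k / mu\<^sup>2"
  shows "(\<lambda>n. \<P>(G in tf_process n. event_T VF EF n G \<bar>
             \<not> event_S k n G \<and> \<not> event_S (2 * k) n G \<and> event_H n G)) \<in> o(\<lambda>_. 1)"
proof -
  define s where "s n = max (n choose 2) (m_step n)" for n
  define good where "good n G \<longleftrightarrow> \<not> event_S k n G \<and> \<not> event_S (2 * k) n G \<and> event_H n G" for n G
  let ?P = "\<lambda>n. measure_pmf.prob (tf_run n (s n))"
  have s: "m_step n \<le> s n" for n by (simp add: s_def)
  have process: "tf_process n = tf_run n (s n)" for n
    by (rule tf_run_eq_process[symmetric]) (simp add: s_def)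
  have S1: "(\<lambda>n. ?P n {G. event_H n G \<and> event_S k n G}) \<longlonglongrightarrow> 0"
    unfolding s_def by (rule prob_S_and_H_tendsto[OF assms(1)])
  have S2: "(\<lambda>n. ?P n {G. event_H n G \<and> event_S (2 * k) n G}) \<longlonglongrightarrow> 0"
    unfolding s_def by (rule prob_S_and_H_tendsto) (use assms(1) in simp)
  have "(\<lambda>n. potential n 0 {} + ?P n {G. event_H n G \<and> event_S k n G} + ?P n {G. event_H n G \<and> event_S (2 * k) n G}) \<longlonglongrightarrow> 0 + 0 + 0"
    by (intro tendsto_add initial_potential_tendsto S1 S2)
  then have "eventually (\<lambda>n. potential n 0 {} + ?P n {G. event_H n G \<and> event_S k n G}
      + ?P n {G. event_H n G \<and> event_S (2 * k) n G} < 1/2) sequentially"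
    by (rule order_tendstoD) simp
  then have good_half: "eventually (\<lambda>n. 1/2 \<le> ?P n {G. good n G}) sequentially"
    using eventually_large
  proof eventually_elim
    case (elim n)
    have "1 = ?P n UNIV" by simp
    also have "UNIV = {G. good n G} \<union> ({G. \<not> event_H n G} \<union> ({G. event_H n G \<and> event_S k n G} \<union> {G. event_H n G \<and> event_S (2 * k) n G}))"
      by (auto simp: good_def)
    also have "?P n \<dots> \<le> ?P n {G. good n G} + (?P n {G. \<not> event_H n G} + (?P n {G. event_H n G \<and> event_S k n G}
        + ?P n {G. event_H n G \<and> event_S (2 * k) n G}))"
      by (intro order_trans[OF measure_Un_le] add_left_mono) auto
    also have "?P n {G. \<not> event_H n G} \<le> potential n 0 {}" by (rule prob_not_H[OF elim(2) s])
    finally show ?case using elim(1) by simp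
  qed
  let ?u = "\<lambda>n::nat. real n ^ k * 2 ^ (k choose 2) * n powr (- 2 * real k)"
  have k4: "eventually (\<lambda>n::nat. 4 * real k \<le> sqrt n * n powr (-1/6)) sequentially" by real_asymp
  have T1: "eventually (\<lambda>n::nat. 7 \<le> sqrt (ln n) / 32) sequentially" by real_asymp
  have bound: "eventually (\<lambda>n. \<P>(G in tf_process n. event_T VF EF n G \<bar> good n G) \<le> 2 * ?u n) sequentially"
    using good_half eventually_large k4 T1
  proof eventually_elim
    case (elim n)
    have "\<P>(G in tf_process n. event_T VF EF n G \<bar> good n G)
        = ?P n {G. event_T VF EF n G \<and> good n G} / ?P n {G. good n G}"
      by (simp add: cond_prob_def process)
    also have "\<dots> \<le> ?u n / (1/2)"
    proof (rule frac_le)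
      show "?P n {G. event_T VF EF n G \<and> good n G} \<le> ?u n"
        unfolding good_def by (rule prob_T_bound[OF assms(2-6) elim(2) s elim(3,4)])
    qed (use elim(1) in auto)
    finally show ?case by simp
  qed
  have u: "?u \<longlonglongrightarrow> 0"
  proof -
    \<comment> \<open>The union bound spends n^k of the factor n^(-2k).\<close>
    have "eventually (\<lambda>n::nat. 2 ^ (k choose 2) * n powr (- real k) = ?u n) sequentially"
      using eventually_gt_at_top[of 0]
    proof eventually_elim
      case (elim n)
      have "real n powr (- real k) = n powr k * n powr (- 2 * real k)" by (simp flip: powr_add)
      then show ?case using elim by (simp add: powr_realpow)
    qed
    moreover have "(\<lambda>n::nat. n powr (- real k)) \<longlonglongrightarrow> 0"
      using assms(1) by (intro tendsto_neg_powr filterlim_real_sequentially) simp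
    then have "(\<lambda>n::nat. 2 ^ (k choose 2) * n powr (- real k)) \<longlonglongrightarrow> 0"
      using tendsto_mult_right_zero by blast
    ultimately show ?thesis using Lim_transform_eventually by fast
  qed
  have "(\<lambda>n. \<P>(G in tf_process n. event_T VF EF n G \<bar> good n G)) \<longlonglongrightarrow> 0"
  proof (rule tendsto_sandwich[OF _ bound tendsto_const])
    show "eventually (\<lambda>n. 0 \<le> \<P>(G in tf_process n. event_T VF EF n G \<bar> good n G)) sequentially"
      by (simp add: cond_prob_def)
    show "(\<lambda>n. 2 * ?u n) \<longlonglongrightarrow> 0" using tendsto_mult_right_zero[OF u] .
  qed
  then show ?thesis
    unfolding good_def by (intro smalloI_tendsto) auto
qed

end
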